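(* Let $n\ge2$ and let $\Omega\subseteq\mathbb{R}^n$ be an open set. There exists a constant $C=C(n)$ such that for every $u\in W^{1,1}_{loc}(\Omega)$ the inequality $$\inf_{c\in\mathbb{R}}\int_B|u-c|\,d\mathcal{H}^{n-1}_\infty\le C\int_B|\nabla u|\,dx$$ holds for every open ball $B\subseteq\Omega$. Moreover, if $|\nabla u|\in\mathcal{M}^{n-1}(\Omega)$, then $$\|u\|_{BMO^{n-1}(\Omega)}\le C\,\|\nabla u\|_{\mathcal{M}^{n-1}(\Omega)}.$$ Here $u$ on the left-hand sides is understood as its precise representative.
   Context: Precise representative: $u^*(x)=\lim_{r\to0}\frac1{|B(x,r)|}\int_{B(x,r)}u\,dy$ if $x$ is a Lebesgue point of $u$, and $u^*(x)=0$ otherwise. Hausdorff content: for $0<\beta\le n$ and $E\subseteq\mathbb{R}^n$, $\mathcal{H}^\beta_\infty(E)=\inf\{\sum_{i=1}^\infty\omega_\beta r_i^\beta: E\subset\bigcup_{i=1}^\infty B(x_i,r_i)\}$ with $\omega_\beta=\pi^{\beta/2}/\Gamma(\beta/2+1)$. Choquet integral: for $f:A\to[0,\infty]$, $\int_A f\,d\mathcal{H}^\beta_\infty=\int_0^\infty\mathcal{H}^\beta_\infty(\{x\in A:f(x)>t\})\,dt$. $$\|u\|_{BMO^\beta(\Omega)}=\sup_{2Q\subset\Omega}\ \inf_{c\in\mathbb{R}}\frac1{l(Q)^\beta}\int_Q|u-c|\,d\mathcal{H}^\beta_\infty,$$ where the supremum is over cubes $Q$ (sides parallel to the axes) such that the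 concentric cube $2Q$ of twice the side length is contained in $\Omega$, and $l(Q)$ is the side length of $Q$. Morrey space: a locally integrable function $f$ belongs to $\mathcal{M}^\beta(\Omega)$ if $\|f\|_{\mathcal{M}^\beta(\Omega)}=\sup_{x\in\Omega,\,r>0}r^{-\beta}\int_{\Omega\cap B(x,r)}|f|\,dy<\infty$. *)

theory Defs
  imports "HOL-Analysis.Analysis"
begin

definition locally_integrable ::
    "(real ^ 'n) set \<Rightarrow> (real ^ 'n \<Rightarrow> 'b::euclidean_space) \<Rightarrow> bool" where
  "locally_integrable \<Omega> f \<longleftrightarrow> (\<forall>K. compact K \<and> K \<subseteq> \<Omega> \<longrightarrow> f absolutely_integrable_on K)"

definition partial_deriv :: "'n \<Rightarrow> (real ^ 'n \<Rightarrow> real) \<Rightarrow> real ^ 'n \<Rightarrow> real" where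
  "partial_deriv i f x = frechet_derivative f (at x) (axis i 1)"

primrec C_k :: "nat \<Rightarrow> (real ^ 'n \<Rightarrow> real) \<Rightarrow> bool" where
  "C_k 0 f \<longleftrightarrow> continuous_on UNIV f"
| "C_k (Suc k) f \<longleftrightarrow> f differentiable_on UNIV \<and> (\<forall>i. C_k k (partial_deriv i f))"

text \<open>The space of smooth functions whose support is a compact subset of \<open>\<Omega>\<close>.\<close>

definition test_functions :: "(real ^ 'n) set \<Rightarrow> (real ^ 'n \<Rightarrow> real) set" where
  "test_functions \<Omega> =
     {\<phi>. (\<forall>k. C_k k \<phi>) \<and> compact (closure {x. \<phi> x \<noteq> 0}) \<and> closure {x. \<phi> x \<noteq> 0} \<subseteq> \<Omega>}"

text \<open>
  Functions on \<open>\<Omega>\<close> are represented by total functions, whose values outside \<open>\<Omega>\<close> are irrelevant.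
  Weak gradients are unique up to null sets only, hence a relation.
\<close>

definition is_weak_gradient ::
    "(real ^ 'n) set \<Rightarrow> (real ^ 'n \<Rightarrow> real) \<Rightarrow> (real ^ 'n \<Rightarrow> real ^ 'n) \<Rightarrow> bool" where
  "is_weak_gradient \<Omega> u g \<longleftrightarrow> locally_integrable \<Omega> g \<and>
     (\<forall>\<phi>\<in>test_functions \<Omega>. \<forall>i.
        (LINT x:\<Omega>|lebesgue. u x * partial_deriv i \<phi> x) = - (LINT x:\<Omega>|lebesgue. g x $ i * \<phi> x))"

definition W11_loc :: "(real ^ 'n) set \<Rightarrow> (real ^ 'n \<Rightarrow> real) set" where
  "W11_loc \<Omega> = {u. locally_integrable \<Omega> u \<and> (\<exists>g. is_weak_gradient \<Omega> u g)}"

definition ball_average :: "(real ^ 'n \<Rightarrow> real) \<Rightarrow> real ^ 'n \<Rightarrow> real \<Rightarrow> real" where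
  "ball_average u x r = (1 / measure lebesgue (ball x r)) * (LINT y:ball x r|lebesgue. u y)"

text \<open>
  The value \<open>c\<close> is not required to be \<open>u x\<close>, so that the notion does not depend on the
  choice of \<open>u\<close> in its class of almost everywhere equal functions. Lebesgue points are meaningful
  only at points near which \<open>u\<close> is integrable.
\<close>

definition lebesgue_point :: "(real ^ 'n \<Rightarrow> real) \<Rightarrow> real ^ 'n \<Rightarrow> bool" where
  "lebesgue_point u x \<longleftrightarrow>
     (\<exists>c. ((\<lambda>r. ball_average (\<lambda>y. \<bar>u y - c\<bar>) x r) \<longlongrightarrow> 0) (at_right 0))"

definition precise_rep :: "(real ^ 'n \<Rightarrow> real) \<Rightarrow> real ^ 'n \<Rightarrow> real" where
  "precise_rep u x = (if lebesgue_point u x then Lim (at_right 0) (ball_average u x) else 0)"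

definition hausdorff_content :: "real \<Rightarrow> (real ^ 'n) set \<Rightarrow> ennreal" where
  "hausdorff_content \<beta> E =
     (INF (x, r) \<in> {(x :: nat \<Rightarrow> real ^ 'n, r :: nat \<Rightarrow> real).
                      (\<forall>i. 0 < r i) \<and> E \<subseteq> (\<Union>i. ball (x i) (r i))}.
        \<Sum>i. ennreal (unit_ball_vol \<beta> * r i powr \<beta>))"

definition choquet_integral ::
    "real \<Rightarrow> (real ^ 'n) set \<Rightarrow> (real ^ 'n \<Rightarrow> ennreal) \<Rightarrow> ennreal" where
  "choquet_integral \<beta> A f =
     (\<integral>\<^sup>+ t\<in>{0..}. hausdorff_content \<beta> {x \<in> A. ennreal t < f x} \<partial>lborel)"

text \<open>The open cube with centre \<open>x\<close> and side length \<open>l\<close>.\<close>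

definition cube :: "real ^ 'n \<Rightarrow> real \<Rightarrow> (real ^ 'n) set" where
  "cube x l = {y. \<forall>i. \<bar>y $ i - x $ i\<bar> < l / 2}"

definition bmo_norm :: "real \<Rightarrow> (real ^ 'n) set \<Rightarrow> (real ^ 'n \<Rightarrow> real) \<Rightarrow> ennreal" where
  "bmo_norm \<beta> \<Omega> u =
     (SUP (x, l) \<in> {(x, l). 0 < l \<and> cube x (2 * l) \<subseteq> \<Omega>}.
        INF c :: real. choquet_integral \<beta> (cube x l) (\<lambda>y. ennreal \<bar>u y - c\<bar>) / ennreal (l powr \<beta>))"

definition morrey_norm ::
    "real \<Rightarrow> (real ^ 'n) set \<Rightarrow> (real ^ 'n \<Rightarrow> 'b::euclidean_space) \<Rightarrow> ennreal" where
  "morrey_norm \<beta> \<Omega> f =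
     (SUP (x, r) \<in> \<Omega> \<times> {0<..}.
        ennreal (r powr (- \<beta>)) * (\<integral>\<^sup>+ y\<in>\<Omega> \<inter> ball x r. ennreal (norm (f y)) \<partial>lebesgue))"

definition morrey_space ::
    "real \<Rightarrow> (real ^ 'n) set \<Rightarrow> (real ^ 'n \<Rightarrow> 'b::euclidean_space) set" where
  "morrey_space \<beta> \<Omega> = {f. locally_integrable \<Omega> f \<and> morrey_norm \<beta> \<Omega> f < \<infinity>}"

end

theory Submission
  imports Defs "HOL-Computational_Algebra.Polynomial"
begin

text \<open>
  The classical route (coarea formula and boxing inequality for sets of finite perimeter) is followed
  without any theory of functions of bounded variation. The perimeter of \<open>E\<close> in \<open>U\<close> is replaced by the
  lower limit for \<open>h \<rightarrow> 0\<close> of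
  \<open>h\<^sup>-\<^sup>n\<^sup>-\<^sup>1\<close> times the measure of the pairs \<open>(x, w)\<close> with \<open>|w| < h\<close>, \<open>[x, x + w] \<subseteq> U\<close> and exactly one
  of \<open>x\<close>, \<open>x + w\<close> in \<open>E\<close>. For this quantity the coarea inequality is the layer cake formula together
  with \<open>\<integral> |u(x + w) - u(x)| dx \<le> |w| \<integral>\<^bsub>U\<^esub> |\<nabla>u|\<close>, and the relative isoperimetric inequality in a convex set
  follows by subdividing segments.

  Let \<open>m\<close> be a median of \<open>u\<close> in a convex set \<open>D\<close> comparable to a ball, and \<open>E = {u > m + t}\<close>. A point of \<open>D\<close>
  where \<open>E\<close> has full density lies in a homothetic copy of \<open>D\<close> inside \<open>D\<close> in which \<open>E\<close> has intermediate
  density; a Vitali covering by balls around these copies bounds the content of the set of all such points by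
  the perimeter of \<open>E\<close> in \<open>D\<close>. Integrating over \<open>t\<close>, and arguing likewise for \<open>-u\<close>, gives the estimate,
  because the points without a Lebesgue value have content zero: there the energy concentrates, or the
  averages over small balls oscillate across an interval \<open>(a, b)\<close>, or they diverge to \<open>\<plusminus>\<infinity>\<close>. In the second
  case all level sets with \<open>t \<in> (a, b)\<close> have intermediate density at arbitrarily small scales, and averaging
  the covering estimate over \<open>t\<close> bounds the content by the energy of an arbitrary neighbourhood.
\<close>

subsection \<open>Smooth cut-off functions\<close>

text \<open>The exponent n - 1 comes from one comparison. If \<open>E\<close> fills a fixed fraction
  of a convex set of size R and omits a fixed fraction, the pairs of points separated by
  \<open>E\<close> have measure of order R^(2n), while the isoperimetric inequality bounds this
  measure by R^(n+1) times the increment energy of \<open>E\<close> at scale h. The constant is the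
  same for all h up to the diameter, and at each h the energy is superadditive over disjoint open
  sets. A finite family of disjoint sets is therefore summed at one common small h, and only
  afterwards is the lower limit taken.

  Homothetic copies of the convex set replace balls because balls around points near its boundary
  leave it. A median as base level gives the copy of ratio 1 density at most 1/2, for upper and
  lower level sets alike.

  The Choquet integral sees Lebesgue null sets, so a change of u on such a set is not harmless. The
  estimate is therefore proved for Lebesgue values, which depend only on the class of u, and all
  remaining points must be shown to form a set of content zero.\<close>

definition flat_exp :: "real poly \<Rightarrow> real \<Rightarrow> real" where
  "flat_exp p s = (if 0 < s then poly p (1 / s) * exp (- 1 / s) else 0)"

lemma tendsto_poly_times_exp_minus: "((\<lambda>y. poly p y * exp (- y)) \<longlongrightarrow> 0) (at_top :: real filter)"
proof -
  have "((\<lambda>y. \<Sum>i\<le>degree p. coeff p i * (y ^ i / exp y)) \<longlongrightarrow> (\<Sum>i\<le>degree p. coeff p i * 0)) at_top"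
    by (intro tendsto_sum tendsto_mult tendsto_const tendsto_power_div_exp_0)
  then show ?thesis
    by (simp add: poly_altdef exp_minus sum_distrib_right divide_inverse mult.assoc)
qed

text \<open>With y = 1/s one has d/ds = -y^2 d/dy, so differentiation maps p(y) exp(-y) to y^2 (p -
  p')(y) exp(-y). The family is closed under differentiation, hence every member is smooth, also at
  0.\<close>

lemma has_real_derivative_flat_exp:
  "(flat_exp p has_real_derivative flat_exp ([:0, 0, 1:] * (p - pderiv p)) s) (at s)"
proof -
  consider "s < 0" | "s > 0" | "s = 0" by linarith
  then show ?thesis
  proof cases
    case 1
    have "(flat_exp p has_real_derivative 0) (at s)"
      by (rule has_field_derivative_transform_within_open[of "\<lambda>_. 0" _ _ "{..<0}"])
        (use 1 in \<open>auto simp: flat_exp_def\<close>)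
    with 1 show ?thesis by (simp add: flat_exp_def)
  next
    case 2
    have "((\<lambda>s. poly p (1 / s) * exp (- 1 / s)) has_real_derivative
        flat_exp ([:0, 0, 1:] * (p - pderiv p)) s) (at s)"
      using 2 by (auto intro!: derivative_eq_intros DERIV_chain'[OF _ poly_DERIV]
          simp: flat_exp_def field_simps power2_eq_square)
    then show ?thesis
      by (rule has_field_derivative_transform_within_open[of _ _ _ "{0<..}"])
        (use 2 in \<open>auto simp: flat_exp_def\<close>)
  next
    case 3
    \<comment> \<open>With y = 1/s, \<open>pCons 0 p\<close> stands for y p(y), so this expression
      is the difference quotient of \<open>flat_exp p\<close> at 0.\<close>
    have "((\<lambda>s. poly (pCons 0 p) (inverse s) * exp (- inverse s)) \<longlongrightarrow> 0) (at_right 0)"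
      by (rule filterlim_compose[OF tendsto_poly_times_exp_minus filterlim_inverse_at_top_right])
    then have "((\<lambda>s. flat_exp p s / s) \<longlongrightarrow> 0) (at_right 0)"
      by (rule Lim_transform_eventually)
        (auto simp: eventually_at_right_field flat_exp_def divide_inverse intro!: exI[of _ 1])
    moreover have "((\<lambda>s. flat_exp p s / s) \<longlongrightarrow> 0) (at_left 0)"
      by (rule Lim_transform_eventually[of "\<lambda>_. 0"])
        (auto simp: eventually_at_left_field flat_exp_def intro!: exI[of _ "-1"])
    ultimately have "((\<lambda>s. flat_exp p s / s) \<longlongrightarrow> 0) (at 0)"
      by (simp add: filterlim_split_at)
    with 3 show ?thesis
      by (simp add: has_field_derivative_iff flat_exp_def)
  qed
qed

text \<open>The whole chain of derivatives is the witness, so that inductions on the order in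
  \<open>C_k\<close> can generalise over the index in the chain.\<close>

definition smooth_real :: "(real \<Rightarrow> real) \<Rightarrow> bool" where
  "smooth_real f \<longleftrightarrow> (\<exists>d. d 0 = f \<and> (\<forall>m s. (d m has_real_derivative d (Suc m) s) (at s)))"

lemma smooth_real_flat_exp: "smooth_real (flat_exp p)"
proof -
  define P where "P = rec_nat p (\<lambda>_ q. [:0, 0, 1:] * (q - pderiv q))"
  have "P 0 = p" "\<And>m. P (Suc m) = [:0, 0, 1:] * (P m - pderiv (P m))"
    by (simp_all add: P_def)
  then show ?thesis
    unfolding smooth_real_def
    by (intro exI[of _ "\<lambda>m. flat_exp (P m)"]) (metis has_real_derivative_flat_exp)
qed

lemma smooth_real_affine:
  assumes "smooth_real f" shows "smooth_real (\<lambda>s. f (a * s + b))"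
proof -
  obtain d where d: "d 0 = f" "\<And>m s. (d m has_real_derivative d (Suc m) s) (at s)"
    using assms unfolding smooth_real_def by blast
  have "((\<lambda>s. a ^ m * d m (a * s + b)) has_real_derivative a ^ Suc m * d (Suc m) (a * s + b)) (at s)" for m s
    by (rule derivative_eq_intros DERIV_chain'[OF _ d(2)] | simp)+
  then show ?thesis
    unfolding smooth_real_def
    by (intro exI[of _ "\<lambda>m s. a ^ m * d m (a * s + b)"]) (auto simp: d(1))
qed

section \<open>Closure properties of the classes \<open>C_k\<close>\<close>

lemma partial_deriv_eq:
  assumes "(f has_derivative f') (at x)" shows "partial_deriv i f x = f' (axis i 1)"
  using frechet_derivative_at[OF assms] by (simp add: partial_deriv_def)

text \<open>The product rule leaves one factor undifferentiated. The induction in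
  \<open>C_k_mult\<close> then needs that factor with one order less.\<close>

lemma C_k_Suc_imp: "C_k (Suc k) f \<Longrightarrow> C_k k f"
proof (induction k arbitrary: f)
  case 0
  then show ?case by (auto intro: differentiable_imp_continuous_on)
next
  case (Suc k)
  then show ?case by (meson C_k.simps(2))
qed

lemma C_k_const: "C_k k (\<lambda>_. c)"
proof (induction k arbitrary: c)
  case (Suc k)
  have "partial_deriv i (\<lambda>_. c) = (\<lambda>_. 0)" for i :: 'a
    by (auto intro!: partial_deriv_eq[THEN trans] derivative_eq_intros)
  with Suc show ?case by simp
qed simp

lemma C_k_add: "C_k k f \<Longrightarrow> C_k k g \<Longrightarrow> C_k k (\<lambda>x. f x + g x)"
proof (induction k arbitrary: f g)
  case 0
  then show ?case by (auto intro: continuous_intros)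
next
  case (Suc k)
  have "partial_deriv i (\<lambda>x. f x + g x) = (\<lambda>x. partial_deriv i f x + partial_deriv i g x)" for i
  proof
    fix x
    have "f differentiable at x" "g differentiable at x"
      using Suc.prems by (auto simp: differentiable_on_def)
    then show "partial_deriv i (\<lambda>x. f x + g x) x = partial_deriv i f x + partial_deriv i g x"
      unfolding frechet_derivative_works
      by (intro partial_deriv_eq[THEN trans, OF has_derivative_add]) (auto simp: partial_deriv_def)
  qed
  with Suc show ?case by (auto simp: differentiable_on_def)
qed

lemma C_k_mult: "C_k k f \<Longrightarrow> C_k k g \<Longrightarrow> C_k k (\<lambda>x. f x * g x)"
proof (induction k arbitrary: f g)
  case 0
  then show ?case by (auto intro: continuous_intros)
next
  case (Suc k)
  have "partial_deriv i (\<lambda>x. f x * g x) = (\<lambda>x. f x * partial_deriv i g x + partial_deriv i f x * g x)" for i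
  proof
    fix x
    have "f differentiable at x" "g differentiable at x"
      using Suc.prems by (auto simp: differentiable_on_def)
    then show "partial_deriv i (\<lambda>x. f x * g x) x = f x * partial_deriv i g x + partial_deriv i f x * g x"
      unfolding frechet_derivative_works
      by (intro partial_deriv_eq[THEN trans, OF has_derivative_mult]) (auto simp: partial_deriv_def)
  qed
  moreover have "C_k k f" "C_k k g"
    using Suc.prems by (auto dest!: C_k_Suc_imp simp del: C_k.simps)
  ultimately show ?case using Suc by (auto simp: differentiable_on_def intro!: C_k_add)
qed

lemma C_k_prod: "finite I \<Longrightarrow> (\<And>i. i \<in> I \<Longrightarrow> C_k k (f i)) \<Longrightarrow> C_k k (\<lambda>x. \<Prod>i\<in>I. f i x)"
  by (induction I rule: finite_induct) (auto intro: C_k_const C_k_mult)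

lemma C_k_coordinate:
  fixes i :: "'n::finite"
  assumes "smooth_real f" shows "C_k k (\<lambda>x :: real ^ 'n. f (x $ i))"
proof -
  obtain d where d: "d 0 = f" "\<And>m s. (d m has_real_derivative d (Suc m) s) (at s)"
    using assms unfolding smooth_real_def by blast
  have "C_k k (\<lambda>x :: real ^ 'n. d m (x $ i))" for m
  proof (induction k arbitrary: m)
    case 0
    have "continuous_on UNIV (d m)"
      using d(2) by (meson DERIV_continuous_on DERIV_subset subset_UNIV)
    then show ?case
      by (auto intro!: continuous_on_compose2[of UNIV "d m"] continuous_intros)
  next
    case (Suc k)
    have D: "((\<lambda>x :: real ^ 'n. d m (x $ i)) has_derivative (\<lambda>h. h $ i * d (Suc m) (x $ i))) (at x)" for x
      using DERIV_compose_FDERIV[OF d(2) bounded_linear_imp_has_derivative[OF bounded_linear_vec_nth]] .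
    have "partial_deriv j (\<lambda>x :: real ^ 'n. d m (x $ i)) = (\<lambda>x. axis j 1 $ i * d (Suc m) (x $ i))" for j
      by (auto intro!: partial_deriv_eq[THEN trans, OF D])
    moreover have "C_k k (\<lambda>x :: real ^ 'n. axis j 1 $ i * d (Suc m) (x $ i))" for j
      by (intro C_k_mult C_k_const Suc)
    ultimately show ?case using D by (auto simp: differentiable_on_def differentiable_def)
  qed
  from this[of 0] show ?thesis by (simp add: d)
qed

lemma partial_deriv_shift:
  assumes "f differentiable at (x - z)"
  shows "partial_deriv i (\<lambda>x. f (x - z)) x = partial_deriv i f (x - z)"
proof -
  have "(f has_derivative frechet_derivative f (at (x - z))) (at (x - z))"
    using assms by (simp add: frechet_derivative_works)
  moreover have "((\<lambda>x. x - z) has_derivative (\<lambda>h. h)) (at x)"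
    by (auto intro!: derivative_eq_intros)
  ultimately have "((\<lambda>x. f (x - z)) has_derivative (\<lambda>h. frechet_derivative f (at (x - z)) h)) (at x)"
    using has_derivative_compose[of "\<lambda>x. x - z" "\<lambda>h. h" x UNIV f] by auto
  then show ?thesis
    by (simp add: partial_deriv_eq) (simp add: partial_deriv_def)
qed

lemma C_k_shift: "C_k k f \<Longrightarrow> C_k k (\<lambda>x. f (x - z))"
proof (induction k arbitrary: f)
  case 0
  then show ?case by (auto intro!: continuous_on_compose2[of UNIV f] continuous_intros)
next
  case (Suc k)
  have diff: "f differentiable at y" for y
    using Suc.prems by (auto simp: differentiable_on_def)
  have "(\<lambda>x. f (x - z)) differentiable at x" for x
    using differentiable_chain_at[of "\<lambda>x. x - z" x f] diff by (simp add: o_def)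
  moreover have "partial_deriv i (\<lambda>x. f (x - z)) = (\<lambda>x. partial_deriv i f (x - z))" for i
    by (rule ext) (rule partial_deriv_shift[OF diff])
  ultimately show ?case using Suc by (simp add: differentiable_on_def)
qed

text \<open>The cut-offs are not normalised to integral one. Each factor exp(-1/((j + 1) s)) with s
  > 0 increases to 1 as j grows, so they converge to the indicator of the open box from below, and
  box averages inherit the weak gradient identity by dominated convergence.\<close>

definition box_cutoff :: "real \<Rightarrow> nat \<Rightarrow> real ^ 'n \<Rightarrow> real" where
  "box_cutoff h j x =
     (\<Prod>i\<in>UNIV. flat_exp 1 (real (Suc j) * (x $ i)) * flat_exp 1 (real (Suc j) * (h - x $ i)))"

lemma C_k_box_cutoff: "C_k k (box_cutoff h j)"
proof -
  have "smooth_real (\<lambda>s. flat_exp 1 (real (Suc j) * s))"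
    using smooth_real_affine[OF smooth_real_flat_exp, of 1 "real (Suc j)" 0] by simp
  moreover have "smooth_real (\<lambda>s. flat_exp 1 (real (Suc j) * (h - s)))"
    using smooth_real_affine[OF smooth_real_flat_exp, of 1 "- real (Suc j)" "real (Suc j) * h"]
    by (simp add: algebra_simps)
  ultimately show ?thesis
    unfolding box_cutoff_def[abs_def]
    by (intro C_k_prod C_k_mult C_k_coordinate[of "\<lambda>s. flat_exp 1 (real (Suc j) * s)"]
        C_k_coordinate[of "\<lambda>s. flat_exp 1 (real (Suc j) * (h - s))"] finite)
qed

lemma flat_exp_1_bounds: "0 \<le> flat_exp 1 s" "flat_exp 1 s \<le> 1"
  by (auto simp: flat_exp_def)

lemma box_cutoff_nonneg: "0 \<le> box_cutoff h j x"
  unfolding box_cutoff_def by (intro prod_nonneg) (simp add: flat_exp_1_bounds)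

lemma box_cutoff_le: "box_cutoff h j x \<le> indicator {y. \<forall>i. 0 < y $ i \<and> y $ i < h} x"
proof (cases "\<forall>i. 0 < x $ i \<and> x $ i < h")
  case True
  have "box_cutoff h j x \<le> (\<Prod>i\<in>(UNIV :: 'a set). 1)"
    unfolding box_cutoff_def
    by (intro prod_mono) (auto simp: flat_exp_1_bounds intro: mult_le_one)
  with True show ?thesis by simp
next
  case False
  then obtain i where "x $ i \<le> 0 \<or> h \<le> x $ i" by (meson not_le)
  then have "flat_exp 1 (real (Suc j) * (x $ i)) * flat_exp 1 (real (Suc j) * (h - x $ i)) = 0"
    by (auto simp: flat_exp_def mult_less_0_iff zero_less_mult_iff)
  then have "box_cutoff h j x = 0"
    unfolding box_cutoff_def by (intro prod_zero) (auto intro!: bexI[of _ i])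
  then show ?thesis by simp
qed

lemma abs_box_cutoff_le_1: "\<bar>box_cutoff h j x\<bar> \<le> 1"
proof -
  have "indicator {y. \<forall>i. 0 < y $ i \<and> y $ i < h} x \<le> (1 :: real)"
    by (rule indicator_le_1)
  with box_cutoff_le[of h j x] box_cutoff_nonneg[of h j x] show ?thesis by linarith
qed

lemma box_cutoff_tendsto:
  "(\<lambda>j. box_cutoff h j x) \<longlonglongrightarrow> indicator {y. \<forall>i. 0 < y $ i \<and> y $ i < h} x"
proof (cases "\<forall>i. 0 < x $ i \<and> x $ i < h")
  case True
  have *: "(\<lambda>j. flat_exp 1 (real (Suc j) * s)) \<longlonglongrightarrow> 1" if "0 < s" for s
  proof -
    have "(\<lambda>j. exp (- (inverse (real (Suc j)) * (1 / s)))) \<longlonglongrightarrow> exp (- (0 * (1 / s)))"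
      by (intro tendsto_intros LIMSEQ_inverse_real_of_nat)
    moreover have "flat_exp 1 (real (Suc j) * s) = exp (- (inverse (real (Suc j)) * (1 / s)))" for j
      using that by (simp add: flat_exp_def divide_simps)
    ultimately show ?thesis by simp
  qed
  have "(\<lambda>j. box_cutoff h j x) \<longlonglongrightarrow> (\<Prod>i\<in>(UNIV :: 'a set). 1 * 1)"
    unfolding box_cutoff_def using True by (intro tendsto_prod tendsto_mult *) auto
  with True show ?thesis by simp
next
  case False
  have "box_cutoff h j x = 0" for j
    using False box_cutoff_le[of h j x] box_cutoff_nonneg[of h j x] by (auto simp: not_le)
  with False show ?thesis by simp
qed

lemma differentiable_box_cutoff: "box_cutoff h j differentiable at (x :: real ^ 'n)"
  using C_k_box_cutoff[of 1 h j, where ?'a = 'n] by (simp add: differentiable_on_def)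

lemma continuous_on_partial_deriv_box_cutoff:
  "continuous_on UNIV (partial_deriv i (box_cutoff h j :: real ^ 'n \<Rightarrow> real))"
  using C_k_box_cutoff[of 1 h j, where ?'a = 'n] by simp

subsection \<open>Difference quotients\<close>

lemma nn_integral_lborel_affine:
  fixes t :: "'a::euclidean_space"
  assumes "f \<in> borel_measurable borel" "c \<noteq> 0"
  shows "(\<integral>\<^sup>+ x. f x \<partial>lborel) = ennreal (\<bar>c\<bar> ^ DIM('a)) * (\<integral>\<^sup>+ x. f (t + c *\<^sub>R x) \<partial>lborel)"
proof -
  have [measurable]: "f \<in> borel_measurable borel" by fact
  show ?thesis
    by (subst lborel_affine[OF assms(2), of t])
      (simp add: nn_integral_density nn_integral_distr nn_integral_cmult ennreal_power)
qed

lemma nn_integral_lborel_shift: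
  fixes t :: "'a::euclidean_space"
  assumes "f \<in> borel_measurable borel"
  shows "(\<integral>\<^sup>+ x. f (x + t) \<partial>lborel) = (\<integral>\<^sup>+ x. f x \<partial>lborel)"
  using nn_integral_lborel_affine[OF assms, of 1 t] by (simp add: add.commute)

lemma nn_integral_lborel_reflect:
  fixes t :: "'a::euclidean_space"
  assumes "f \<in> borel_measurable borel"
  shows "(\<integral>\<^sup>+ x. f (t - x) \<partial>lborel) = (\<integral>\<^sup>+ x. f x \<partial>lborel)"
  using nn_integral_lborel_affine[OF assms, of "-1" t] by simp

text \<open>Integrability need not be assumed, because the Bochner integral of a non-integrable
  function is 0.\<close>

lemma norm_integral_le_nn_integral:
  fixes f :: "'a \<Rightarrow> 'b::{banach, second_countable_topology}"
  shows "ennreal (norm (\<integral>x. f x \<partial>M)) \<le> (\<integral>\<^sup>+ x. ennreal (norm (f x)) \<partial>M)"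
  by (cases "integrable M f") (auto simp: integral_norm_bound_ennreal not_integrable_integral_eq)

text \<open>The origin is a corner and not the centre because the differentiation theorem behind
  \<open>AE_box_average_tendsto\<close> averages over
  \<open>cbox x (x + h *\<^sub>R One)\<close>.\<close>

definition corner_box :: "real \<Rightarrow> (real ^ 'n) set" where
  "corner_box h = {y. \<forall>i. 0 < y $ i \<and> y $ i < h}"

lemma corner_box_eq_box: "corner_box h = box 0 (\<chi> i. h)"
  by (auto simp: corner_box_def mem_box_cart)

lemma corner_box_borel [measurable]: "corner_box h \<in> sets borel"
  by (simp add: corner_box_eq_box)

lemma corner_box_subset_cball: "corner_box h \<subseteq> cball (0 :: real ^ 'n) (real CARD('n) * h)"
proof
  fix y :: "real ^ 'n" assume y: "y \<in> corner_box h"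
  have "norm y \<le> (\<Sum>i\<in>UNIV. \<bar>y $ i\<bar>)" by (rule norm_le_l1_cart)
  also have "\<dots> \<le> (\<Sum>i\<in>(UNIV :: 'n set). h)"
    using y by (intro sum_mono) (auto simp: corner_box_def abs_of_pos less_imp_le)
  finally show "y \<in> cball 0 (real CARD('n) * h)" by simp
qed

lemma emeasure_corner_box:
  assumes "0 \<le> h" shows "emeasure lborel (corner_box h :: (real ^ 'n) set) = ennreal (h ^ CARD('n))"
proof -
  have "emeasure lborel (box 0 (\<chi> i. h) :: (real ^ 'n) set) =
      (\<Prod>b\<in>Basis. ((\<chi> i. h) - 0 :: real ^ 'n) \<bullet> b)"
    by (rule emeasure_lborel_box) (use assms in \<open>auto simp: Basis_vec_def inner_axis\<close>)
  also have "(\<Prod>b\<in>Basis. ((\<chi> i. h) - 0 :: real ^ 'n) \<bullet> b) = (\<Prod>b\<in>(Basis :: (real ^ 'n) set). h)"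
    by (intro prod.cong) (auto simp: Basis_vec_def inner_axis)
  finally show ?thesis by (simp add: corner_box_eq_box)
qed

section \<open>Increments of box averages along a segment\<close>

lemma frechet_derivative_eq_sum_partial_deriv:
  fixes f :: "real ^ 'n \<Rightarrow> real"
  assumes "f differentiable at x"
  shows "frechet_derivative f (at x) w = (\<Sum>i\<in>UNIV. w $ i * partial_deriv i f x)"
proof -
  interpret linear "frechet_derivative f (at x)"
    using assms by (rule linear_frechet_derivative)
  have "frechet_derivative f (at x) w = frechet_derivative f (at x) (\<Sum>i\<in>UNIV. w $ i *\<^sub>R axis i 1)"
    using basis_expansion[of w] by (simp add: scalar_mult_eq_scaleR)
  then show ?thesis
    by (simp add: sum scale partial_deriv_def)
qed

text \<open>
  To be instantiated with Borel representatives that vanish outside \<open>\<Omega>\<close>, so that all integrals range over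
  the whole space.
\<close>

locale sobolev_function =
  fixes \<Omega> :: "(real ^ 'n) set" and u :: "real ^ 'n \<Rightarrow> real" and g :: "real ^ 'n \<Rightarrow> real ^ 'n"
  assumes open_domain: "open \<Omega>"
    and u_borel [measurable]: "u \<in> borel_measurable borel"
    and g_borel [measurable]: "g \<in> borel_measurable borel"
    and u_integrable: "\<And>K. compact K \<Longrightarrow> K \<subseteq> \<Omega> \<Longrightarrow> integrable lborel (\<lambda>x. indicator K x * u x)"
    and g_integrable: "\<And>K. compact K \<Longrightarrow> K \<subseteq> \<Omega> \<Longrightarrow> integrable lborel (\<lambda>x. indicator K x * norm (g x))"
    and weak_gradient: "\<And>\<phi> i. \<phi> \<in> test_functions \<Omega> \<Longrightarrow>
      (\<integral>x. u x * partial_deriv i \<phi> x \<partial>lborel) = - (\<integral>x. g x $ i * \<phi> x \<partial>lborel)"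
begin

context
  fixes z w :: "real ^ 'n" and h :: real
  assumes h: "0 < h"
    and tube: "\<And>s. s \<in> {0..1} \<Longrightarrow> cball (z + s *\<^sub>R w) (real CARD('n) * h) \<subseteq> \<Omega>"
begin

text \<open>Local integrability gives integrable functions only on compact subsets of \<Omega>.
  \<open>T\<close> is one compact set containing the supports of the cut-offs shifted to all points
  of the segment, so it provides majorants that are uniform in s.\<close>

private definition "T = (\<Union>s\<in>{0..1::real}. cball (z + s *\<^sub>R w) (real CARD('n) * h))"

private lemma T_eq: "T = (\<lambda>(s, y). z + s *\<^sub>R w + y) ` ({0..1} \<times> cball 0 (real CARD('n) * h))"
proof (intro set_eqI iffI)
  fix x assume "x \<in> T"
  then obtain s where "s \<in> {0..1}" "dist (z + s *\<^sub>R w) x \<le> real CARD('n) * h"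
    by (auto simp: T_def)
  then show "x \<in> (\<lambda>(s, y). z + s *\<^sub>R w + y) ` ({0..1} \<times> cball 0 (real CARD('n) * h))"
    by (intro image_eqI[of _ _ "(s, x - (z + s *\<^sub>R w))"]) (auto simp: dist_norm norm_minus_commute)
next
  fix x assume "x \<in> (\<lambda>(s, y). z + s *\<^sub>R w + y) ` ({0..1} \<times> cball 0 (real CARD('n) * h))"
  then obtain s y where "s \<in> {0..1}" "norm y \<le> real CARD('n) * h" "x = z + s *\<^sub>R w + y"
    by auto
  then show "x \<in> T" by (auto simp: T_def dist_norm intro!: bexI[of _ s])
qed

private lemma T_compact: "compact T"
  unfolding T_eq
  by (intro compact_continuous_image compact_Times compact_cball compact_Icc)
    (auto simp: split_beta intro!: continuous_intros)

private lemma T_borel [measurable]: "T \<in> sets borel"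
  using T_compact by (simp add: borel_compact)

private lemma T_subset: "T \<subseteq> \<Omega>"
  unfolding T_def using tube by (rule UN_least)

private lemma corner_box_imp_T:
  assumes "s \<in> {0..1}" "x - z - s *\<^sub>R w \<in> corner_box h" shows "x \<in> T"
proof -
  have "norm (x - z - s *\<^sub>R w) \<le> real CARD('n) * h"
    using assms(2) corner_box_subset_cball by fastforce
  then show ?thesis
    using assms(1) by (auto simp: T_def dist_norm norm_minus_commute algebra_simps intro!: bexI[of _ s])
qed

private lemma box_cutoff_eq_0: "x \<notin> corner_box h \<Longrightarrow> box_cutoff h j x = 0"
  using box_cutoff_le[of h j x] box_cutoff_nonneg[of h j x] by (simp add: corner_box_def)

private lemma abs_box_cutoff_le_indicator:
  assumes "s \<in> {0..1}" shows "\<bar>box_cutoff h j (x - (z + s *\<^sub>R w))\<bar> \<le> indicator T x"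
proof (cases "x - (z + s *\<^sub>R w) \<in> corner_box h")
  case True
  then have "x \<in> T" using corner_box_imp_T[OF assms] by (simp add: algebra_simps)
  then show ?thesis using abs_box_cutoff_le_1 by simp
qed (simp add: box_cutoff_eq_0)

private lemma norm_mult_box_cutoff_le:
  fixes a :: real
  assumes "s \<in> {0..1}"
  shows "norm (a * box_cutoff h j (x - (z + s *\<^sub>R w))) \<le> norm (indicator T x * a)"
  using mult_left_mono[OF abs_box_cutoff_le_indicator[OF assms, of j x], of "\<bar>a\<bar>"]
  by (simp add: abs_mult mult.commute)

private lemma partial_deriv_eq_0:
  fixes x :: "real ^ 'n"
  assumes "x \<notin> cball 0 (real CARD('n) * h)" shows "partial_deriv i (box_cutoff h j) x = 0"
proof -
  have "(box_cutoff h j has_derivative (\<lambda>_. 0)) (at x)"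
  proof (rule has_derivative_transform_within_open)
    show "((\<lambda>_. 0) has_derivative (\<lambda>_. 0)) (at x)" by simp
    show "open (- cball (0 :: real ^ 'n) (real CARD('n) * h))" by (simp add: open_Compl)
    show "x \<in> - cball 0 (real CARD('n) * h)" using assms by simp
    show "0 = box_cutoff h j y" if "y \<in> - cball 0 (real CARD('n) * h)" for y :: "real ^ 'n"
      using that corner_box_subset_cball[of h, where ?'n = 'n] box_cutoff_eq_0[of y j] by force
  qed
  then show ?thesis by (simp add: partial_deriv_eq)
qed

private lemma shifted_cutoff_test_function:
  assumes "s \<in> {0..1}" shows "(\<lambda>x. box_cutoff h j (x - (z + s *\<^sub>R w))) \<in> test_functions \<Omega>"
proof -
  let ?S = "{x. box_cutoff h j (x - (z + s *\<^sub>R w)) \<noteq> 0}"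
  have "?S \<subseteq> cball (z + s *\<^sub>R w) (real CARD('n) * h)"
  proof
    fix x assume "x \<in> ?S"
    then have "x - (z + s *\<^sub>R w) \<in> corner_box h" using box_cutoff_eq_0 by blast
    then have "norm (x - (z + s *\<^sub>R w)) \<le> real CARD('n) * h"
      using corner_box_subset_cball by fastforce
    then show "x \<in> cball (z + s *\<^sub>R w) (real CARD('n) * h)"
      by (simp add: dist_norm norm_minus_commute)
  qed
  then have *: "closure ?S \<subseteq> cball (z + s *\<^sub>R w) (real CARD('n) * h)"
    by (simp add: closure_minimal)
  then have "compact (closure ?S)"
    by (meson bounded_cball bounded_subset closed_closure compact_eq_bounded_closed)
  with * tube[OF assms] show ?thesis
    by (auto simp: test_functions_def intro!: C_k_shift C_k_box_cutoff)
qed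

private lemma partial_deriv_bounded:
  obtains M where "\<And>i (x :: real ^ 'n). \<bar>partial_deriv i (box_cutoff h j) x\<bar> \<le> M" "0 \<le> M"
proof -
  have "\<exists>M\<ge>0. \<forall>x :: real ^ 'n. \<bar>partial_deriv i (box_cutoff h j) x\<bar> \<le> M" for i
  proof -
    have "compact (partial_deriv i (box_cutoff h j) ` cball (0 :: real ^ 'n) (real CARD('n) * h))"
      by (intro compact_continuous_image compact_cball continuous_on_subset[OF continuous_on_partial_deriv_box_cutoff]) auto
    then obtain M where "\<And>y. y \<in> partial_deriv i (box_cutoff h j) ` cball (0 :: real ^ 'n) (real CARD('n) * h) \<Longrightarrow> norm y \<le> M"
      by (meson bounded_iff compact_imp_bounded)
    then have M: "\<bar>partial_deriv i (box_cutoff h j) x\<bar> \<le> M" if "x \<in> cball 0 (real CARD('n) * h)" for x :: "real ^ 'n"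
      using that by fastforce
    have "\<bar>partial_deriv i (box_cutoff h j) x\<bar> \<le> max M 0" for x :: "real ^ 'n"
      using M[of x] partial_deriv_eq_0[of x i j] by (cases "x \<in> cball 0 (real CARD('n) * h)") (auto simp: max.coboundedI1)
    then show ?thesis by (intro exI[of _ "max M 0"]) auto
  qed
  then obtain M where M: "\<And>i. 0 \<le> M i" "\<And>i (x :: real ^ 'n). \<bar>partial_deriv i (box_cutoff h j) x\<bar> \<le> M i"
    by metis
  have "M i \<le> (\<Sum>i\<in>UNIV. M i)" for i
    by (rule member_le_sum) (auto simp: M)
  then show ?thesis
    using M by (intro that[of "\<Sum>i\<in>UNIV. M i"]) (metis order_trans, auto intro: sum_nonneg)
qed

text \<open>Fundamental theorem of calculus for the negative of the cut-off, shifted along the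
  segment. The shift acts on the smooth factor and never on \<open>u\<close>, which has no pointwise
  derivative.\<close>

private lemma box_cutoff_increment:
  "(\<integral>s. indicator {0..1} s * (\<Sum>i\<in>UNIV. w $ i * partial_deriv i (box_cutoff h j) (x - (z + s *\<^sub>R w))) \<partial>lborel)
     = box_cutoff h j (x - z) - box_cutoff h j (x - (z + w))"
proof -
  let ?d = "\<lambda>s. \<Sum>i\<in>UNIV. w $ i * partial_deriv i (box_cutoff h j) (x - (z + s *\<^sub>R w))"
  have "((\<lambda>s. - box_cutoff h j (x - (z + s *\<^sub>R w))) has_vector_derivative ?d s) (at s within {0..1})" for s
  proof -
    let ?y = "x - (z + s *\<^sub>R w)"
    have "(box_cutoff h j has_derivative frechet_derivative (box_cutoff h j) (at ?y)) (at ?y)"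
      using differentiable_box_cutoff by (simp add: frechet_derivative_works)
    moreover have "((\<lambda>s. x - (z + s *\<^sub>R w)) has_derivative (\<lambda>t. - (t *\<^sub>R w))) (at s within {0..1})"
      by (auto intro!: derivative_eq_intros)
    ultimately have "((\<lambda>s. box_cutoff h j (x - (z + s *\<^sub>R w))) has_derivative
        (\<lambda>t. frechet_derivative (box_cutoff h j) (at ?y) (- (t *\<^sub>R w)))) (at s within {0..1})"
      by (metis has_derivative_compose)
    then have "((\<lambda>s. - box_cutoff h j (x - (z + s *\<^sub>R w))) has_derivative
        (\<lambda>t. - frechet_derivative (box_cutoff h j) (at ?y) (- (t *\<^sub>R w)))) (at s within {0..1})"
      by (rule has_derivative_minus)
    moreover have "(\<lambda>t. - frechet_derivative (box_cutoff h j) (at ?y) (- (t *\<^sub>R w))) = (\<lambda>t. t *\<^sub>R ?d s)"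
      by (auto simp: frechet_derivative_eq_sum_partial_deriv[OF differentiable_box_cutoff]
          sum_distrib_left sum_negf mult.assoc)
    ultimately show ?thesis by (simp add: has_vector_derivative_def)
  qed
  moreover have "continuous_on {0..1} ?d"
    by (intro continuous_intros continuous_on_compose2[OF continuous_on_partial_deriv_box_cutoff]) auto
  ultimately have "(\<integral>s. indicator {0..1} s *\<^sub>R ?d s \<partial>lborel) =
      - box_cutoff h j (x - (z + 1 *\<^sub>R w)) - (- box_cutoff h j (x - (z + 0 *\<^sub>R w)))"
    by (intro integral_FTC_Icc) auto
  then show ?thesis by simp
qed

private lemma borel_partial_deriv [measurable]:
  "partial_deriv i (box_cutoff h j :: real ^ 'n \<Rightarrow> real) \<in> borel_measurable borel"
  by (intro borel_measurable_continuous_onI continuous_on_partial_deriv_box_cutoff)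

private lemma borel_box_cutoff [measurable]:
  "(box_cutoff h j :: real ^ 'n \<Rightarrow> real) \<in> borel_measurable borel"
  using C_k_box_cutoff[of 0 h j, where ?'a = 'n]
  by (intro borel_measurable_continuous_onI) simp

text \<open>The difference of the two shifted cut-offs is an integral over s of directional
  derivatives. After Fubini, each s contributes \<open>u\<close> integrated against the derivative
  of a single test function, which the weak gradient turns into an integral of w \<bullet> g.
  Cauchy-Schwarz and the bound of the cut-off by the box indicator finish the estimate.\<close>

private lemma cutoff_average_difference:
  "ennreal \<bar>(\<integral>x. u x * box_cutoff h j (x - (z + w)) \<partial>lborel) - (\<integral>x. u x * box_cutoff h j (x - z) \<partial>lborel)\<bar>
     \<le> ennreal (norm w) * (\<integral>\<^sup>+ s. indicator {0..1} s *
         (\<integral>\<^sup>+ x. ennreal (norm (g x)) * indicator (corner_box h) (x - z - s *\<^sub>R w) \<partial>lborel) \<partial>lborel)"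
proof -
  let ?k = "box_cutoff h j :: real ^ 'n \<Rightarrow> real"
  obtain M where M: "\<And>i (x :: real ^ 'n). \<bar>partial_deriv i ?k x\<bar> \<le> M" "0 \<le> M"
    using partial_deriv_bounded by blast
  have int_T: "integrable lborel (\<lambda>x. indicator T x * u x)"
    by (rule u_integrable[OF T_compact T_subset])
  have int_cut: "integrable lborel (\<lambda>x. u x * ?k (x - (z + s *\<^sub>R w)))" if s: "s \<in> {0..1}" for s
  proof (rule Bochner_Integration.integrable_bound[OF int_T])
    show "AE x in lborel. norm (u x * ?k (x - (z + s *\<^sub>R w))) \<le> norm (indicator T x * u x)"
      by (intro AE_I2 norm_mult_box_cutoff_le s)
  qed simp
  let ?F = "\<lambda>(x, s). u x * (indicator {0..1} s * (\<Sum>i\<in>UNIV. w $ i * partial_deriv i ?k (x - (z + s *\<^sub>R w))))"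
  let ?W = "(\<Sum>i\<in>UNIV. \<bar>w $ i\<bar>) * M"
  have W: "\<bar>\<Sum>i\<in>UNIV. w $ i * partial_deriv i ?k y\<bar> \<le> ?W" for y
    unfolding sum_distrib_right
    by (rule order_trans[OF sum_abs]) (auto simp: abs_mult intro!: sum_mono mult_left_mono M)
  \<comment> \<open>Hypothesis of Fubini: the integrand vanishes off T \<times> [0,1], and on it the
    directional derivative of the cut-off is at most \<open>?W\<close>.\<close>
  have integrable_F: "integrable (lborel \<Otimes>\<^sub>M lborel) ?F"
  proof (rule Bochner_Integration.integrable_bound)
    show "integrable (lborel \<Otimes>\<^sub>M lborel) (\<lambda>(x, s :: real). (indicator T x * u x) * (indicator {0..1} s * ?W))"
    proof (rule lborel_pair.Fubini_integrable)
      have "(\<integral>s. norm ((indicator T x * u x) * (indicator {0..1::real} s * ?W)) \<partial>lborel) =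
          norm (indicator T x * u x) * ?W" for x
      proof -
        have "(\<integral>s. norm ((indicator T x * u x) * (indicator {0..1::real} s * ?W)) \<partial>lborel) =
          (\<integral>s. (norm (indicator T x * u x) * ?W) * indicator {0..1::real} s \<partial>lborel)"
          using M(2) by (intro Bochner_Integration.integral_cong) (auto simp: abs_mult sum_nonneg)
        also have "\<dots> = norm (indicator T x * u x) * ?W"
          by simp
        finally show ?thesis .
      qed
      then show "integrable lborel (\<lambda>x. \<integral>s. norm (case (x, s) of (x, s) \<Rightarrow> (indicator T x * u x) * (indicator {0..1::real} s * ?W)) \<partial>lborel)"
        using int_T by simp
      show "AE x in lborel. integrable lborel (\<lambda>s. case (x, s) of (x, s) \<Rightarrow> (indicator T x * u x) * (indicator {0..1::real} s * ?W))"
        by (intro AE_I2) (simp add: integrable_real_mult_indicator)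
    qed measurable
    show "?F \<in> borel_measurable (lborel \<Otimes>\<^sub>M lborel)" by measurable
    show "AE p in lborel \<Otimes>\<^sub>M lborel. norm (?F p) \<le>
        norm (case p of (x, s) \<Rightarrow> (indicator T x * u x) * (indicator {0..1} s * ?W))"
    proof (rule AE_I2, clarify)
      fix x :: "real ^ 'n" and s :: real
      show "norm (u x * (indicator {0..1} s * (\<Sum>i\<in>UNIV. w $ i * partial_deriv i ?k (x - (z + s *\<^sub>R w))))) \<le>
        norm ((indicator T x * u x) * (indicator {0..1} s * ?W))"
      proof (cases "s \<in> {0..1} \<and> x \<in> T")
        case True
        then show ?thesis
          using W M(2) by (auto simp: abs_mult sum_nonneg intro!: mult_left_mono)
      next
        case False
        have "partial_deriv i ?k (x - (z + s *\<^sub>R w)) = 0" if "s \<in> {0..1}" "x \<notin> T" for i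
          using that by (intro partial_deriv_eq_0) (auto simp: T_def dist_norm norm_minus_commute)
        then have "(\<Sum>i\<in>UNIV. w $ i * partial_deriv i ?k (x - (z + s *\<^sub>R w))) = 0" if "s \<in> {0..1}"
          using False that by (intro sum.neutral ballI) simp
        then show ?thesis by (cases "s \<in> {0..1}") simp_all
      qed
    qed
  qed
  have "(\<integral>x. u x * ?k (x - z) \<partial>lborel) - (\<integral>x. u x * ?k (x - (z + w)) \<partial>lborel) =
      (\<integral>x. u x * (?k (x - z) - ?k (x - (z + w))) \<partial>lborel)"
    using int_cut[of 0] int_cut[of 1] by (simp add: right_diff_distrib)
  also have "\<dots> = (\<integral>x. (\<integral>s. ?F (x, s) \<partial>lborel) \<partial>lborel)"
    by (simp add: box_cutoff_increment)
  also have "\<dots> = (\<integral>s. (\<integral>x. ?F (x, s) \<partial>lborel) \<partial>lborel)"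
    using lborel_pair.Fubini_integral[of "\<lambda>x s. ?F (x, s)", symmetric] integrable_F
    by (simp only: case_prod_conv)
  finally have eq: "(\<integral>x. u x * ?k (x - z) \<partial>lborel) - (\<integral>x. u x * ?k (x - (z + w)) \<partial>lborel) =
      (\<integral>s. (\<integral>x. ?F (x, s) \<partial>lborel) \<partial>lborel)" .
  have inner: "ennreal (norm (\<integral>x. ?F (x, s) \<partial>lborel)) \<le> indicator {0..1} s * (ennreal (norm w) *
      (\<integral>\<^sup>+ x. ennreal (norm (g x)) * indicator (corner_box h) (x - z - s *\<^sub>R w) \<partial>lborel))" for s
  proof (cases "s \<in> {0..1}")
    case s: True
    define \<phi> where "\<phi> = (\<lambda>x. ?k (x - (z + s *\<^sub>R w)))"
    have \<phi>: "\<phi> \<in> test_functions \<Omega>"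
      unfolding \<phi>_def by (rule shifted_cutoff_test_function[OF s])
    have d\<phi>: "partial_deriv i \<phi> x = partial_deriv i ?k (x - (z + s *\<^sub>R w))" for i x
      unfolding \<phi>_def by (rule partial_deriv_shift[OF differentiable_box_cutoff])
    have int_d: "integrable lborel (\<lambda>x. u x * partial_deriv i \<phi> x)" for i
    proof (rule Bochner_Integration.integrable_bound)
      show "integrable lborel (\<lambda>x. M * (indicator T x * u x))" using int_T by simp
      show "AE x in lborel. norm (u x * partial_deriv i \<phi> x) \<le> norm (M * (indicator T x * u x))"
      proof (rule AE_I2)
        fix x
        have "partial_deriv i ?k (x - (z + s *\<^sub>R w)) = 0" if "x \<notin> T"
          using that s by (intro partial_deriv_eq_0) (auto simp: T_def dist_norm norm_minus_commute)
        then show "norm (u x * partial_deriv i \<phi> x) \<le> norm (M * (indicator T x * u x))"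
          using M by (cases "x \<in> T") (auto simp: d\<phi> abs_mult mult.commute[of M] intro!: mult_left_mono)
      qed
      show "(\<lambda>x. u x * partial_deriv i \<phi> x) \<in> borel_measurable lborel" unfolding d\<phi> by measurable
    qed
    have int_g: "integrable lborel (\<lambda>x. g x $ i * \<phi> x)" for i
    proof (rule Bochner_Integration.integrable_bound[OF g_integrable[OF T_compact T_subset]])
      show "AE x in lborel. norm (g x $ i * \<phi> x) \<le> norm (indicator T x * norm (g x))"
      proof (rule AE_I2)
        fix x
        have "norm (g x $ i * \<phi> x) \<le> norm (indicator T x * g x $ i)"
          unfolding \<phi>_def by (rule norm_mult_box_cutoff_le[OF s])
        also have "\<dots> \<le> norm (indicator T x * norm (g x))"
          using component_le_norm_cart[of "g x" i] by (simp add: abs_mult mult_left_mono)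
        finally show "norm (g x $ i * \<phi> x) \<le> norm (indicator T x * norm (g x))" .
      qed
      have [measurable]: "(\<lambda>x. g x $ i) \<in> borel_measurable borel"
        by (rule measurable_compose[OF g_borel])
          (intro borel_measurable_continuous_onI continuous_intros)
      show "(\<lambda>x. g x $ i * \<phi> x) \<in> borel_measurable lborel" unfolding \<phi>_def by measurable
    qed
    \<comment> \<open>For fixed s the weak gradient identity is applied to \<phi> in each coordinate
      direction and recombined with the weights \<open>w $ i\<close>.\<close>
    have "(\<integral>x. ?F (x, s) \<partial>lborel) = (\<integral>x. (\<Sum>i\<in>UNIV. w $ i * (u x * partial_deriv i \<phi> x)) \<partial>lborel)"
      using s by (intro Bochner_Integration.integral_cong) (auto simp: d\<phi> sum_distrib_left algebra_simps)
    also have "\<dots> = (\<Sum>i\<in>UNIV. w $ i * (\<integral>x. u x * partial_deriv i \<phi> x \<partial>lborel))"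
      using int_d by (simp add: Bochner_Integration.integral_sum)
    also have "\<dots> = - (\<Sum>i\<in>UNIV. w $ i * (\<integral>x. g x $ i * \<phi> x \<partial>lborel))"
      by (simp add: weak_gradient[OF \<phi>] sum_negf)
    also have "\<dots> = - (\<integral>x. (\<Sum>i\<in>UNIV. w $ i * (g x $ i * \<phi> x)) \<partial>lborel)"
      using int_g by (simp add: Bochner_Integration.integral_sum)
    also have "\<dots> = - (\<integral>x. (w \<bullet> g x) * \<phi> x \<partial>lborel)"
      by (simp add: inner_vec_def sum_distrib_left sum_distrib_right mult.assoc)
    finally have "ennreal (norm (\<integral>x. ?F (x, s) \<partial>lborel)) \<le> (\<integral>\<^sup>+ x. ennreal (norm ((w \<bullet> g x) * \<phi> x)) \<partial>lborel)"
      using norm_integral_le_nn_integral[of lborel "\<lambda>x. (w \<bullet> g x) * \<phi> x"] by simp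
    also have "\<dots> \<le> (\<integral>\<^sup>+ x. ennreal (norm w) * (ennreal (norm (g x)) * indicator (corner_box h) (x - z - s *\<^sub>R w)) \<partial>lborel)"
    proof (rule nn_integral_mono)
      fix x
      have "\<bar>(w \<bullet> g x) * \<phi> x\<bar> \<le> norm w * norm (g x) * indicator (corner_box h) (x - (z + s *\<^sub>R w))"
        unfolding abs_mult \<phi>_def
        using box_cutoff_le[of h j "x - (z + s *\<^sub>R w)"] box_cutoff_nonneg[of h j "x - (z + s *\<^sub>R w)"]
        by (intro mult_mono Cauchy_Schwarz_ineq2) (auto simp: corner_box_def)
      then have "ennreal (norm ((w \<bullet> g x) * \<phi> x)) \<le>
          ennreal (norm w * norm (g x) * indicator (corner_box h) (x - (z + s *\<^sub>R w)))"
        by (auto intro: ennreal_leI)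
      then show "ennreal (norm ((w \<bullet> g x) * \<phi> x)) \<le>
          ennreal (norm w) * (ennreal (norm (g x)) * indicator (corner_box h) (x - z - s *\<^sub>R w))"
        by (auto simp: ennreal_mult indicator_def diff_diff_eq split: if_splits)
    qed
    also have "\<dots> = ennreal (norm w) *
        (\<integral>\<^sup>+ x. ennreal (norm (g x)) * indicator (corner_box h) (x - z - s *\<^sub>R w) \<partial>lborel)"
      by (intro nn_integral_cmult) measurable
    finally show ?thesis using s by simp
  qed simp
  have "ennreal \<bar>(\<integral>x. u x * ?k (x - (z + w)) \<partial>lborel) - (\<integral>x. u x * ?k (x - z) \<partial>lborel)\<bar> =
      ennreal (norm (\<integral>s. (\<integral>x. ?F (x, s) \<partial>lborel) \<partial>lborel))"
    unfolding eq[symmetric] by (simp add: abs_minus_commute)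
  also have "\<dots> \<le> (\<integral>\<^sup>+ s. ennreal (norm (\<integral>x. ?F (x, s) \<partial>lborel)) \<partial>lborel)"
    by (rule norm_integral_le_nn_integral)
  also have "\<dots> \<le> (\<integral>\<^sup>+ s. indicator {0..1} s * (ennreal (norm w) *
      (\<integral>\<^sup>+ x. ennreal (norm (g x)) * indicator (corner_box h) (x - z - s *\<^sub>R w) \<partial>lborel)) \<partial>lborel)"
    by (intro nn_integral_mono inner)
  also have "\<dots> = (\<integral>\<^sup>+ s. ennreal (norm w) * (indicator {0..1} s * 
      (\<integral>\<^sup>+ x. ennreal (norm (g x)) * indicator (corner_box h) (x - z - s *\<^sub>R w) \<partial>lborel)) \<partial>lborel)"
    by (simp add: ac_simps)
  also have "\<dots> = ennreal (norm w) * (\<integral>\<^sup>+ s. indicator {0..1} s *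
      (\<integral>\<^sup>+ x. ennreal (norm (g x)) * indicator (corner_box h) (x - z - s *\<^sub>R w) \<partial>lborel) \<partial>lborel)"
    by (intro nn_integral_cmult) measurable
  finally show ?thesis .
qed

text \<open>Limit of \<open>cutoff_average_difference\<close> as j grows: its right-hand side does
  not involve j, and on the left dominated convergence applies with the majorant supported on
  \<open>T\<close>.\<close>

lemma box_average_difference:
  "ennreal \<bar>(\<integral>x. u x * indicator (corner_box h) (x - (z + w)) \<partial>lborel)
      - (\<integral>x. u x * indicator (corner_box h) (x - z) \<partial>lborel)\<bar>
     \<le> ennreal (norm w) * (\<integral>\<^sup>+ s. indicator {0..1} s *
         (\<integral>\<^sup>+ x. ennreal (norm (g x)) * indicator (corner_box h) (x - z - s *\<^sub>R w) \<partial>lborel) \<partial>lborel)"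
proof -
  have lim: "(\<lambda>j. \<integral>x. u x * box_cutoff h j (x - (z + s *\<^sub>R w)) \<partial>lborel) \<longlonglongrightarrow>
      (\<integral>x. u x * indicator (corner_box h) (x - (z + s *\<^sub>R w)) \<partial>lborel)" if s: "s \<in> {0..1}" for s
  proof (rule integral_dominated_convergence)
    show "integrable lborel (\<lambda>x. norm (indicator T x * u x))"
      using u_integrable[OF T_compact T_subset] by (rule integrable_norm)
    show "AE x in lborel. (\<lambda>j. u x * box_cutoff h j (x - (z + s *\<^sub>R w))) \<longlonglongrightarrow>
        u x * indicator (corner_box h) (x - (z + s *\<^sub>R w))"
      unfolding corner_box_def by (intro AE_I2 tendsto_intros box_cutoff_tendsto)
    show "AE x in lborel. norm (u x * box_cutoff h j (x - (z + s *\<^sub>R w))) \<le> norm (indicator T x * u x)" for j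
      by (intro AE_I2 norm_mult_box_cutoff_le s)
  qed measurable
  have "(\<lambda>j. ennreal \<bar>(\<integral>x. u x * box_cutoff h j (x - (z + w)) \<partial>lborel) - (\<integral>x. u x * box_cutoff h j (x - z) \<partial>lborel)\<bar>)
      \<longlonglongrightarrow> ennreal \<bar>(\<integral>x. u x * indicator (corner_box h) (x - (z + w)) \<partial>lborel)
      - (\<integral>x. u x * indicator (corner_box h) (x - z) \<partial>lborel)\<bar>"
    using lim[of 0] lim[of 1] by (intro tendsto_intros) auto
  then show ?thesis
    by (rule LIMSEQ_le_const2) (auto intro: cutoff_average_difference)
qed

end

end

text \<open>
  Requiring the whole segment, and not only its end points, to lie in \<open>U\<close> makes the quantity controlled by the
  gradient on \<open>U\<close> even when \<open>U\<close> is not convex.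
\<close>

definition total_increment :: "('a::euclidean_space \<Rightarrow> real) \<Rightarrow> 'a set \<Rightarrow> 'a \<Rightarrow> ennreal" where
  "total_increment f U w =
     (\<integral>\<^sup>+ x. ennreal \<bar>f (x + w) - f x\<bar> * indicator {x. closed_segment x (x + w) \<subseteq> U} x \<partial>lborel)"

section \<open>From box averages to increments of the function\<close>

lemma closed_segment_eq_image: "closed_segment x (x + w) = (\<lambda>s. x + s *\<^sub>R w) ` {0..1}"
  unfolding closed_segment_image_interval by (simp add: algebra_simps)

context sobolev_function
begin

text \<open>The differentiation theorem asks for a globally integrable function. It is applied to
  \<open>u\<close> cut off to each compact \<open>C k\<close> of an exhaustion of \<Omega>. At an
  interior point of \<open>C k\<close> all sufficiently small boxes stay in \<open>C k\<close>, so
  the cut-off does not change the averages, and countably many null sets are collected.\<close>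

lemma AE_box_average_tendsto:
  "AE z in lborel. z \<in> \<Omega> \<longrightarrow>
     (\<lambda>m. (\<integral>x. u x * indicator (corner_box (inverse (real (Suc m)))) (x - z) \<partial>lborel)
        / inverse (real (Suc m)) ^ CARD('n)) \<longlonglongrightarrow> u z"
proof -
  obtain C where C: "\<And>n. compact (C n)" "\<And>n. C n \<subseteq> \<Omega>" "\<And>n. C n \<subseteq> interior (C (Suc n))"
      "\<Union>(range C) = \<Omega>"
    using open_Union_compact_subsets[OF open_domain] by metis
  have "AE z in lborel. z \<in> interior (C k) \<longrightarrow>
     (\<lambda>m. (\<integral>x. u x * indicator (corner_box (inverse (real (Suc m)))) (x - z) \<partial>lborel)
        / inverse (real (Suc m)) ^ CARD('n)) \<longlonglongrightarrow> u z" for k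
  proof -
    let ?f = "\<lambda>x. indicator (C k) x * u x"
    have int_f: "integrable lborel ?f" by (rule u_integrable[OF C(1,2)])
    have int_box: "?f integrable_on cbox a b" for a b
      using integrable_on_lborel[OF int_f] integrable_on_subcbox[of ?f UNIV a b] by blast
    obtain N where N: "negligible N" "\<And>x e. x \<notin> N \<Longrightarrow> 0 < e \<Longrightarrow>
        \<exists>d>0. \<forall>h. 0 < h \<and> h < d \<longrightarrow> norm (integral (cbox x (x + h *\<^sub>R One)) ?f /\<^sub>R h ^ DIM(real ^ 'n) - ?f x) < e"
      using integrable_ccontinuous_explicit[of ?f, OF int_box] by blast
    have *: "(\<lambda>m. (\<integral>x. u x * indicator (corner_box (inverse (real (Suc m)))) (x - z) \<partial>lborel)
        / inverse (real (Suc m)) ^ CARD('n)) \<longlonglongrightarrow> u z" if z: "z \<in> interior (C k)" "z \<notin> N" for z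
    proof -
      obtain r where r: "0 < r" "cball z r \<subseteq> C k"
        using z(1) by (meson mem_interior_cball)
      have zC: "z \<in> C k" using z(1) interior_subset by blast
      have eq: "(\<integral>x. u x * indicator (corner_box h) (x - z) \<partial>lborel) = integral (cbox z (z + h *\<^sub>R One)) ?f"
        if h: "0 < h" "real CARD('n) * h < r" for h
      proof -
        have box_eq: "x - z \<in> corner_box h \<longleftrightarrow> x \<in> box z (z + h *\<^sub>R One)" for x
        proof -
          have "(One :: real ^ 'n) $ i = 1" for i
            by (simp add: cart_eq_inner_axis axis_in_Basis_iff)
          then show ?thesis by (auto simp: corner_box_def mem_box_cart algebra_simps)
        qed
        have sub: "box z (z + h *\<^sub>R One) \<subseteq> C k"
        proof
          fix x assume "x \<in> box z (z + h *\<^sub>R One)"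
          then have "x - z \<in> corner_box h" using box_eq by simp
          then have "norm (x - z) \<le> real CARD('n) * h" using corner_box_subset_cball by fastforce
          with h(2) have "x \<in> cball z r" by (simp add: dist_norm norm_minus_commute)
          with r(2) show "x \<in> C k" by blast
        qed
        have "(\<integral>x. u x * indicator (corner_box h) (x - z) \<partial>lborel) =
            (\<integral>x. indicator (box z (z + h *\<^sub>R One)) x *\<^sub>R ?f x \<partial>lborel)"
          using sub by (intro Bochner_Integration.integral_cong)
            (auto simp: indicator_def box_eq)
        also have "\<dots> = integral (box z (z + h *\<^sub>R One)) ?f"
        proof -
          have "set_integrable lborel (box z (z + h *\<^sub>R One)) ?f"
            unfolding set_integrable_def using int_f by (intro integrable_mult_indicator) auto
          then show ?thesis
            unfolding set_lebesgue_integral_def[symmetric] by (rule set_borel_integral_eq_integral)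
        qed
        also have "\<dots> = integral (cbox z (z + h *\<^sub>R One)) ?f"
          by (simp add: integral_open_interval)
        finally show ?thesis .
      qed
      show ?thesis
      proof (rule LIMSEQ_I)
        fix e :: real assume "0 < e"
        then obtain d where d: "0 < d" "\<And>h. 0 < h \<Longrightarrow> h < d \<Longrightarrow>
            norm (integral (cbox z (z + h *\<^sub>R One)) ?f /\<^sub>R h ^ DIM(real ^ 'n) - ?f z) < e"
          using N(2)[OF z(2)] by blast
        have "eventually (\<lambda>m. inverse (real (Suc m)) < min d (r / real CARD('n))) sequentially"
          using LIMSEQ_inverse_real_of_nat by (rule order_tendstoD) (use d r in auto)
        then obtain m0 where m0: "\<And>m. m0 \<le> m \<Longrightarrow> inverse (real (Suc m)) < min d (r / real CARD('n))"
          by (auto simp: eventually_sequentially)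
        show "\<exists>m0. \<forall>m\<ge>m0. norm ((\<integral>x. u x * indicator (corner_box (inverse (real (Suc m)))) (x - z) \<partial>lborel)
            / inverse (real (Suc m)) ^ CARD('n) - u z) < e"
        proof (intro exI allI impI)
          fix m assume "m0 \<le> m"
          let ?h = "inverse (real (Suc m))"
          have h: "0 < ?h" "?h < d" "real CARD('n) * ?h < r"
            using m0[OF \<open>m0 \<le> m\<close>] by (auto simp: field_simps)
          show "norm ((\<integral>x. u x * indicator (corner_box ?h) (x - z) \<partial>lborel) / ?h ^ CARD('n) - u z) < e"
            unfolding eq[OF h(1,3)] using d(2)[OF h(1,2)] zC by (simp add: divide_inverse mult.commute)
        qed
      qed
    qed
    \<comment> \<open>Negligibility refers to the completed measure, so a Borel null superset is
      extracted for \<open>lborel\<close>.\<close>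
    have "AE z in lborel. z \<notin> N"
    proof -
      have "N \<in> null_sets lebesgue" using N(1) by (simp add: negligible_iff_null_sets)
      then obtain N' where "N' \<in> null_sets lborel" "N \<subseteq> N'"
        using null_sets_completionI null_sets_completion_iff2 by metis
      then show ?thesis by (intro AE_I'[of N']) auto
    qed
    then show ?thesis by eventually_elim (use * in auto)
  qed
  then have "AE z in lborel. \<forall>k. z \<in> interior (C k) \<longrightarrow>
     (\<lambda>m. (\<integral>x. u x * indicator (corner_box (inverse (real (Suc m)))) (x - z) \<partial>lborel)
        / inverse (real (Suc m)) ^ CARD('n)) \<longlonglongrightarrow> u z"
    unfolding AE_all_countable by (rule allI)
  then show ?thesis
  proof eventually_elim
    case (elim z)
    show ?case
    proof
      assume "z \<in> \<Omega>"
      then obtain k where "z \<in> interior (C k)" using C(3,4) by blast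
      with elim show "(\<lambda>m. (\<integral>x. u x * indicator (corner_box (inverse (real (Suc m)))) (x - z) \<partial>lborel)
        / inverse (real (Suc m)) ^ CARD('n)) \<longlonglongrightarrow> u z" by blast
    qed
  qed
qed

text \<open>If the segment from z to z + w lies in U, so does a tube around it, and for small boxes
  the increment of the averages is at most \<open>norm w * G m z / h m ^ CARD('n)\<close>.
  Integrating \<open>G m\<close> over z produces exactly the volume \<open>h m ^ CARD('n)\<close> of
  a box times the energy of U, so the normalisation cancels. Fatou's lemma then passes to the
  increment of \<open>u\<close> itself.\<close>

lemma total_increment_le:
  assumes U: "open U" "U \<subseteq> \<Omega>"
  shows "total_increment u U w \<le> ennreal (norm w) * (\<integral>\<^sup>+ x\<in>U. ennreal (norm (g x)) \<partial>lborel)"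
proof -
  have [measurable]: "U \<in> sets borel" using U by simp
  define h where "h m = inverse (real (Suc m))" for m
  have h_pos: "0 < h m" for m by (simp add: h_def)
  define A where "A m z = (\<integral>x. u x * indicator (corner_box (h m)) (x - z) \<partial>lborel)" for m z
  let ?E = "\<integral>\<^sup>+ x\<in>U. ennreal (norm (g x)) \<partial>lborel"
  \<comment> \<open>The factor \<open>indicator U x\<close> makes the integral over z and x yield
    the energy of U. Inside a tube contained in U it changes nothing.\<close>
  define k where "k m x z s = ennreal (norm (g x)) * indicator U x * indicator (corner_box (h m)) (x - z - s *\<^sub>R w)"
    for m x z and s :: real
  define G where "G m z = (\<integral>\<^sup>+ s. indicator {0..1} s * (\<integral>\<^sup>+ x. k m x z s \<partial>lborel) \<partial>lborel)" for m z
  have [measurable]: "G m \<in> borel_measurable borel" for m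
    unfolding G_def k_def by measurable
  have int_k: "(\<integral>\<^sup>+ z. k m x z s \<partial>lborel) = ennreal (norm (g x)) * indicator U x * ennreal (h m ^ CARD('n))" for m x s
  proof -
    have "(\<integral>\<^sup>+ z. k m x z s \<partial>lborel) =
      ennreal (norm (g x)) * indicator U x * (\<integral>\<^sup>+ z. indicator (corner_box (h m)) ((x - s *\<^sub>R w) - z) \<partial>lborel)"
      unfolding k_def by (subst nn_integral_cmult[symmetric]) (auto simp: algebra_simps)
    also have "(\<integral>\<^sup>+ z. indicator (corner_box (h m)) ((x - s *\<^sub>R w) - z) \<partial>lborel) = ennreal (h m ^ CARD('n))"
      using h_pos[of m]
      by (subst nn_integral_lborel_reflect[of "indicator (corner_box (h m))" "x - s *\<^sub>R w"])
        (simp_all add: emeasure_corner_box less_imp_le)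
    finally show ?thesis .
  qed
  have int_G: "(\<integral>\<^sup>+ z. G m z \<partial>lborel) = ennreal (h m ^ CARD('n)) * ?E" for m
  proof -
    have "(\<integral>\<^sup>+ z. G m z \<partial>lborel) =
        (\<integral>\<^sup>+ s. (\<integral>\<^sup>+ z. indicator {0..1} s * (\<integral>\<^sup>+ x. k m x z s \<partial>lborel) \<partial>lborel) \<partial>lborel)"
      unfolding G_def k_def by (rule lborel_pair.Fubini') measurable
    also have "\<dots> = (\<integral>\<^sup>+ s. indicator {0..1::real} s * (ennreal (h m ^ CARD('n)) * ?E) \<partial>lborel)"
    proof (rule nn_integral_cong)
      fix s :: real
      have "(\<integral>\<^sup>+ z. indicator {0..1} s * (\<integral>\<^sup>+ x. k m x z s \<partial>lborel) \<partial>lborel) =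
          indicator {0..1} s * (\<integral>\<^sup>+ z. (\<integral>\<^sup>+ x. k m x z s \<partial>lborel) \<partial>lborel)"
        unfolding k_def by (intro nn_integral_cmult) measurable
      also have "(\<integral>\<^sup>+ z. (\<integral>\<^sup>+ x. k m x z s \<partial>lborel) \<partial>lborel) = (\<integral>\<^sup>+ x. (\<integral>\<^sup>+ z. k m x z s \<partial>lborel) \<partial>lborel)"
        unfolding k_def by (rule lborel_pair.Fubini') measurable
      also have "\<dots> = ennreal (h m ^ CARD('n)) * ?E"
        unfolding int_k by (subst nn_integral_multc) (auto simp: mult.commute)
      finally show "(\<integral>\<^sup>+ z. indicator {0..1} s * (\<integral>\<^sup>+ x. k m x z s \<partial>lborel) \<partial>lborel) =
          indicator {0..1} s * (ennreal (h m ^ CARD('n)) * ?E)" .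
    qed
    also have "\<dots> = ennreal (h m ^ CARD('n)) * ?E"
      by (subst nn_integral_multc) auto
    finally show ?thesis .
  qed
  have conv: "AE z in lborel. z \<in> \<Omega> \<longrightarrow> (\<lambda>m. A m z / h m ^ CARD('n)) \<longlonglongrightarrow> u z"
    using AE_box_average_tendsto unfolding A_def h_def .
  \<comment> \<open>The exceptional set for the end point is a translate of a null set.\<close>
  have conv': "AE z in lborel. z + w \<in> \<Omega> \<longrightarrow> (\<lambda>m. A m (z + w) / h m ^ CARD('n)) \<longlonglongrightarrow> u (z + w)"
  proof -
    from conv obtain N where N: "N \<in> null_sets lborel"
      "{z. \<not> (z \<in> \<Omega> \<longrightarrow> (\<lambda>m. A m z / h m ^ CARD('n)) \<longlonglongrightarrow> u z)} \<subseteq> N"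
      by (auto elim!: AE_E simp: null_sets_def)
    have [measurable]: "N \<in> sets borel" using N by auto
    have "{z. z + w \<in> N} \<in> sets borel"
      using measurable_sets[of "\<lambda>z. z + w" borel borel N] by (simp add: vimage_def)
    then have "emeasure lborel {z. z + w \<in> N} = (\<integral>\<^sup>+ z. indicator {z. z + w \<in> N} z \<partial>lborel)"
      by simp
    also have "\<dots> = (\<integral>\<^sup>+ z. indicator N (z + w) \<partial>lborel)"
      by (intro nn_integral_cong) (simp add: indicator_def)
    also have "\<dots> = 0"
      using N(1) by (subst nn_integral_lborel_shift[of "indicator N"]) auto
    finally have "{z. z + w \<in> N} \<in> null_sets lborel"
      using \<open>{z. z + w \<in> N} \<in> sets borel\<close> by (auto simp: null_sets_def)
    then show ?thesis by (rule AE_I') (use N(2) in auto)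
  qed
  have "AE z in lborel. ennreal \<bar>u (z + w) - u z\<bar> * indicator {x. closed_segment x (x + w) \<subseteq> U} z
      \<le> liminf (\<lambda>m. ennreal (inverse (h m ^ CARD('n))) * (ennreal (norm w) * G m z))"
    using conv conv'
  proof eventually_elim
    case (elim z)
    show ?case
    proof (cases "closed_segment z (z + w) \<subseteq> U")
      case True
      then have zU: "z \<in> \<Omega>" "z + w \<in> \<Omega>" using U by auto
      have lim: "(\<lambda>m. ennreal \<bar>A m (z + w) / h m ^ CARD('n) - A m z / h m ^ CARD('n)\<bar>) \<longlonglongrightarrow> ennreal \<bar>u (z + w) - u z\<bar>"
        using elim zU by (intro tendsto_intros) auto
      obtain r where r: "0 < r" "(\<Union>x\<in>closed_segment z (z + w). ball x r) \<subseteq> U"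
        using compact_subset_open_imp_ball_epsilon_subset[OF compact_segment U(1) True] by blast
      have "eventually (\<lambda>m. h m < r / real CARD('n)) sequentially"
        unfolding h_def using LIMSEQ_inverse_real_of_nat by (rule order_tendstoD) (use r in auto)
      then have ev: "eventually (\<lambda>m. ennreal \<bar>A m (z + w) / h m ^ CARD('n) - A m z / h m ^ CARD('n)\<bar> \<le>
          ennreal (inverse (h m ^ CARD('n))) * (ennreal (norm w) * G m z)) sequentially"
      proof eventually_elim
        case (elim m)
        then have hm: "real CARD('n) * h m < r" by (simp add: field_simps)
        have tube: "cball (z + s *\<^sub>R w) (real CARD('n) * h m) \<subseteq> U" if "s \<in> {0..1}" for s
        proof -
          have "z + s *\<^sub>R w \<in> closed_segment z (z + w)"
            unfolding closed_segment_eq_image using that by (rule imageI)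
          moreover have "cball (z + s *\<^sub>R w) (real CARD('n) * h m) \<subseteq> ball (z + s *\<^sub>R w) r"
            using hm by auto
          ultimately show ?thesis using r(2) by blast
        qed
        have "ennreal \<bar>A m (z + w) - A m z\<bar> \<le> ennreal (norm w) * (\<integral>\<^sup>+ s. indicator {0..1} s *
         (\<integral>\<^sup>+ x. ennreal (norm (g x)) * indicator (corner_box (h m)) (x - z - s *\<^sub>R w) \<partial>lborel) \<partial>lborel)"
          unfolding A_def using tube U by (intro box_average_difference h_pos) blast
        also have "\<dots> = ennreal (norm w) * G m z"
          unfolding G_def k_def
        proof (intro arg_cong[where f = "\<lambda>x. ennreal (norm w) * x"] nn_integral_cong)
          fix s :: real
          show "indicator {0..1} s *
            (\<integral>\<^sup>+ x. ennreal (norm (g x)) * indicator (corner_box (h m)) (x - z - s *\<^sub>R w) \<partial>lborel) =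
            indicator {0..1} s * (\<integral>\<^sup>+ x. ennreal (norm (g x)) * indicator U x * indicator (corner_box (h m)) (x - z - s *\<^sub>R w) \<partial>lborel)"
          proof (cases "s \<in> {0..1}")
            case s: True
            have "x \<in> U" if "x - z - s *\<^sub>R w \<in> corner_box (h m)" for x
            proof -
              have "norm (x - z - s *\<^sub>R w) \<le> real CARD('n) * h m"
                using that corner_box_subset_cball by fastforce
              then have "x \<in> cball (z + s *\<^sub>R w) (real CARD('n) * h m)"
                by (simp add: dist_norm norm_minus_commute algebra_simps)
              then show ?thesis using tube[OF s] by blast
            qed
            then show ?thesis
              by (intro arg_cong[where f = "\<lambda>x. indicator {0..1} s * x"] nn_integral_cong)
                (auto simp: indicator_def)
          qed simp
        qed
        finally have "ennreal \<bar>A m (z + w) - A m z\<bar> \<le> ennreal (norm w) * G m z" .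
        then have "ennreal (inverse (h m ^ CARD('n))) * ennreal \<bar>A m (z + w) - A m z\<bar> \<le>
            ennreal (inverse (h m ^ CARD('n))) * (ennreal (norm w) * G m z)"
          by (rule mult_left_mono) simp
        moreover have "\<bar>A m (z + w) / h m ^ CARD('n) - A m z / h m ^ CARD('n)\<bar> =
            inverse (h m ^ CARD('n)) * \<bar>A m (z + w) - A m z\<bar>"
        proof -
          have "A m (z + w) / h m ^ CARD('n) - A m z / h m ^ CARD('n) =
              inverse (h m ^ CARD('n)) * (A m (z + w) - A m z)"
            by (simp add: divide_inverse right_diff_distrib mult.commute)
          then show ?thesis using h_pos[of m] by (simp only: abs_mult) simp
        qed
        ultimately show ?case
          using h_pos[of m] by (simp add: ennreal_mult)
      qed
      have "ennreal \<bar>u (z + w) - u z\<bar> = liminf (\<lambda>m. ennreal \<bar>A m (z + w) / h m ^ CARD('n) - A m z / h m ^ CARD('n)\<bar>)"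
        by (rule lim_imp_Liminf[OF sequentially_bot lim, symmetric])
      also have "\<dots> \<le> liminf (\<lambda>m. ennreal (inverse (h m ^ CARD('n))) * (ennreal (norm w) * G m z))"
        by (rule Liminf_mono[OF ev])
      finally show ?thesis using True by simp
    qed simp
  qed
  then have "total_increment u U w \<le>
      (\<integral>\<^sup>+ z. liminf (\<lambda>m. ennreal (inverse (h m ^ CARD('n))) * (ennreal (norm w) * G m z)) \<partial>lborel)"
    unfolding total_increment_def by (rule nn_integral_mono_AE)
  also have "\<dots> \<le> liminf (\<lambda>m. \<integral>\<^sup>+ z. ennreal (inverse (h m ^ CARD('n))) * (ennreal (norm w) * G m z) \<partial>lborel)"
    by (intro nn_integral_liminf) measurable
  also have "\<dots> = liminf (\<lambda>m. ennreal (norm w) * ?E)"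
  proof (intro arg_cong[where f = liminf] ext)
    fix m
    have "(\<integral>\<^sup>+ z. ennreal (inverse (h m ^ CARD('n))) * (ennreal (norm w) * G m z) \<partial>lborel) =
        ennreal (inverse (h m ^ CARD('n))) * (ennreal (norm w) * (ennreal (h m ^ CARD('n)) * ?E))"
      by (simp add: nn_integral_cmult int_G)
    also have "\<dots> = (ennreal (inverse (h m ^ CARD('n))) * ennreal (h m ^ CARD('n))) * (ennreal (norm w) * ?E)"
      by (simp add: ac_simps)
    also have "ennreal (inverse (h m ^ CARD('n))) * ennreal (h m ^ CARD('n)) = 1"
      using h_pos[of m] by (simp add: ennreal_mult[symmetric])
    finally show "(\<integral>\<^sup>+ z. ennreal (inverse (h m ^ CARD('n))) * (ennreal (norm w) * G m z) \<partial>lborel) =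
        ennreal (norm w) * ?E" by simp
  qed
  also have "\<dots> = ennreal (norm w) * ?E"
    by (simp add: Liminf_const)
  finally show ?thesis .
qed

end

subsection \<open>A difference-quotient perimeter\<close>

text \<open>The condition on the segment, viewed as a function of the pair, so that joint
  measurability allows Fubini in x and w.\<close>

definition segment_indicator :: "'a::euclidean_space set \<Rightarrow> 'a \<times> 'a \<Rightarrow> ennreal" where
  "segment_indicator U = indicator {(x, w). closed_segment x (x + w) \<subseteq> U}"

text \<open>A compact segment in U has an e-neighbourhood in U, and changing x and w by less than
  e/2 each moves every point x + s w with s in [0,1] by less than e.\<close>

lemma open_segment_set:
  fixes U :: "'a::euclidean_space set"
  assumes "open U" shows "open {(x, w). closed_segment x (x + w) \<subseteq> U}"
proof (rule topological_space_class.openI)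
  fix p assume "p \<in> {(x, w). closed_segment x (x + w) \<subseteq> U}"
  then obtain x w where p: "p = (x, w)" and sub: "closed_segment x (x + w) \<subseteq> U"
    by blast
  obtain e where e: "0 < e" "(\<Union>y\<in>closed_segment x (x + w). ball y e) \<subseteq> U"
    using compact_subset_open_imp_ball_epsilon_subset[OF compact_segment assms sub] by blast
  have "ball x (e / 2) \<times> ball w (e / 2) \<subseteq> {(x, w). closed_segment x (x + w) \<subseteq> U}"
  proof -
    have "y \<in> U" if *: "x' \<in> ball x (e / 2)" "w' \<in> ball w (e / 2)" "y \<in> closed_segment x' (x' + w')" for x' w' y
    proof -
    from * obtain s where s: "s \<in> {0..1}" "y = x' + s *\<^sub>R w'"
      by (auto simp: closed_segment_eq_image)
    have "dist (x + s *\<^sub>R w) y \<le> norm (x - x') + norm (s *\<^sub>R (w - w'))"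
      using norm_triangle_ineq[of "x - x'" "s *\<^sub>R (w - w')"]
      by (simp add: s dist_norm algebra_simps)
    also have "norm (s *\<^sub>R (w - w')) \<le> norm (w - w')"
      using s(1) by (simp add: mult_left_le_one_le)
    also have "norm (x - x') + norm (w - w') < e"
      using * by (simp add: dist_norm)
    finally have "y \<in> ball (x + s *\<^sub>R w) e" by simp
    moreover have "x + s *\<^sub>R w \<in> closed_segment x (x + w)"
      unfolding closed_segment_eq_image using s(1) by (rule imageI)
    ultimately show "y \<in> U" using e(2) by blast
    qed
    then show ?thesis by blast
  qed
  moreover have "open (ball x (e / 2) \<times> ball w (e / 2))" by (intro open_Times open_ball)
  ultimately show "\<exists>T. open T \<and> p \<in> T \<and> T \<subseteq> {(x, w). closed_segment x (x + w) \<subseteq> U}"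
    using e(1) by (intro exI[of _ "ball x (e / 2) \<times> ball w (e / 2)"]) (auto simp: p)
qed

lemma borel_measurable_segment_indicator:
  fixes U :: "'a::euclidean_space set"
  assumes "open U" shows "segment_indicator U \<in> borel_measurable (borel \<Otimes>\<^sub>M borel)"
  unfolding segment_indicator_def borel_prod
  using open_segment_set[OF assms] by (intro borel_measurable_indicator) auto

lemma total_increment_alt:
  "total_increment f U w = (\<integral>\<^sup>+ x. ennreal \<bar>f (x + w) - f x\<bar> * segment_indicator U (x, w) \<partial>lborel)"
  unfolding total_increment_def segment_indicator_def
  by (intro nn_integral_cong) (simp add: indicator_def)

lemma borel_measurable_total_increment:
  assumes [measurable]: "f \<in> borel_measurable borel" and "open U"
  shows "total_increment f U \<in> borel_measurable borel"
proof -
  note borel_measurable_segment_indicator[OF assms(2), measurable]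
  show ?thesis unfolding total_increment_alt[abs_def] by measurable
qed

section \<open>Subdivision, superadditivity and the isoperimetric inequality\<close>

lemma ball_borel [measurable]: "ball (x :: 'a::euclidean_space) r \<in> sets borel"
  by simp

text \<open>The increment over \<open>w\<close> telescopes over N steps of length
  \<open>norm w / N\<close>. The partial segments lie in the full one, so the condition on U is
  inherited, and by translation invariance all N steps have the same integral.\<close>

lemma total_increment_subdivide:
  fixes f :: "'a::euclidean_space \<Rightarrow> real"
  assumes [measurable]: "f \<in> borel_measurable borel" and "open U" "0 < N"
  shows "total_increment f U w \<le> of_nat N * total_increment f U (w /\<^sub>R real N)"
proof -
  note borel_measurable_segment_indicator[OF assms(2), measurable]
  define v where "v = w /\<^sub>R real N"
  define T where "T y = ennreal \<bar>f (y + v) - f y\<bar> * segment_indicator U (y, v)" for y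
  have [measurable]: "T \<in> borel_measurable borel" unfolding T_def by measurable
  have w: "w = real N *\<^sub>R v" using assms(3) by (simp add: v_def)
  have "ennreal \<bar>f (x + w) - f x\<bar> * segment_indicator U (x, w) \<le> (\<Sum>j<N. T (x + real j *\<^sub>R v))" for x
  proof (cases "closed_segment x (x + w) \<subseteq> U")
    case True
    have seg: "segment_indicator U (x + real j *\<^sub>R v, v) = 1" if "j < N" for j
    proof -
      have "closed_segment (x + real j *\<^sub>R v) (x + real j *\<^sub>R v + v) \<subseteq> closed_segment x (x + w)"
      proof (rule subset_closed_segment[THEN iffD2], intro conjI)
        have "x + real j *\<^sub>R v = x + (real j / real N) *\<^sub>R w"
          using assms(3) by (simp add: w)
        then show "x + real j *\<^sub>R v \<in> closed_segment x (x + w)"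
          unfolding closed_segment_eq_image using that by (auto intro!: image_eqI[of _ _ "real j / real N"])
        have "x + real j *\<^sub>R v + v = x + ((real j + 1) / real N) *\<^sub>R w"
          using assms(3) by (simp add: w algebra_simps add_divide_distrib)
        then show "x + real j *\<^sub>R v + v \<in> closed_segment x (x + w)"
          unfolding closed_segment_eq_image using that by (auto intro!: image_eqI[of _ _ "(real j + 1) / real N"])
      qed
      with True show ?thesis by (auto simp: segment_indicator_def)
    qed
    have "f (x + w) - f x = (\<Sum>j<N. f (x + real (Suc j) *\<^sub>R v) - f (x + real j *\<^sub>R v))"
      by (subst sum_lessThan_telescope) (simp add: w)
    then have "\<bar>f (x + w) - f x\<bar> \<le> (\<Sum>j<N. \<bar>f (x + real (Suc j) *\<^sub>R v) - f (x + real j *\<^sub>R v)\<bar>)"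
      by (simp only: sum_abs)
    then have "ennreal \<bar>f (x + w) - f x\<bar> \<le> (\<Sum>j<N. ennreal \<bar>f (x + real (Suc j) *\<^sub>R v) - f (x + real j *\<^sub>R v)\<bar>)"
      by (subst sum_ennreal) (auto intro: ennreal_leI)
    also have "\<dots> = (\<Sum>j<N. T (x + real j *\<^sub>R v))"
      by (intro sum.cong) (auto simp: T_def seg algebra_simps)
    finally show ?thesis using True by (simp add: segment_indicator_def)
  qed (simp add: segment_indicator_def)
  then have "total_increment f U w \<le> (\<integral>\<^sup>+ x. (\<Sum>j<N. T (x + real j *\<^sub>R v)) \<partial>lborel)"
    unfolding total_increment_alt by (rule nn_integral_mono)
  also have "\<dots> = (\<Sum>j<N. (\<integral>\<^sup>+ x. T (x + real j *\<^sub>R v) \<partial>lborel))"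
    by (rule nn_integral_sum) measurable
  also have "\<dots> = (\<Sum>j<N. (\<integral>\<^sup>+ x. T x \<partial>lborel))"
    by (intro sum.cong refl nn_integral_lborel_shift) measurable
  also have "\<dots> = of_nat N * total_increment f U v"
    by (simp add: T_def total_increment_alt)
  finally show ?thesis by (simp add: v_def)
qed

text \<open>In the normalisation \<open>h ^ Suc DIM('a)\<close>, the power h^n is the order of the
  volume of the ball of all w, and one further h is the size of an increment of a function with
  bounded derivative.\<close>

definition increment_energy :: "('a::euclidean_space \<Rightarrow> real) \<Rightarrow> 'a set \<Rightarrow> real \<Rightarrow> ennreal" where
  "increment_energy f U h =
     ennreal (1 / h ^ Suc DIM('a)) * (\<integral>\<^sup>+ w\<in>ball 0 h. total_increment f U w \<partial>lborel)"

text \<open>Increments at the large scale d are controlled by those at any smaller scale h, with a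
  constant independent of h. Subdividing into N = ceiling of d/h steps costs a factor N, rescaling w
  by N costs N^n, and N \<le> d/h + 1 \<le> 2 d/h because h \<le> d.\<close>

lemma nn_integral_total_increment_le_energy:
  fixes f :: "'a::euclidean_space \<Rightarrow> real"
  assumes [measurable]: "f \<in> borel_measurable borel" and "open U" and h: "0 < h" "h \<le> d"
  shows "(\<integral>\<^sup>+ w\<in>ball 0 d. total_increment f U w \<partial>lborel) \<le>
    ennreal ((2 * d) ^ Suc DIM('a)) * increment_energy f U h"
proof -
  note borel_measurable_total_increment[OF assms(1,2), measurable]
  define N where "N = nat \<lceil>d / h\<rceil>"
  have d: "0 < d" using h by simp
  have "1 \<le> d / h" using h by simp
  have N: "0 < N" "d \<le> real N * h" "real N \<le> 2 * d / h"
  proof -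
    have "real N = of_int \<lceil>d / h\<rceil>" unfolding N_def using \<open>1 \<le> d / h\<close> by simp
    then have *: "d / h \<le> real N" "real N \<le> d / h + 1" by linarith+
    then show "d \<le> real N * h" "0 < N" using h \<open>1 \<le> d / h\<close> by (auto simp: field_simps intro: gr0I)
    show "real N \<le> 2 * d / h" using * \<open>1 \<le> d / h\<close> by simp
  qed
  have "(\<integral>\<^sup>+ w\<in>ball 0 d. total_increment f U w \<partial>lborel) \<le>
      (\<integral>\<^sup>+ w. of_nat N * total_increment f U (w /\<^sub>R real N) * indicator (ball 0 d) w \<partial>lborel)"
    by (intro nn_integral_mono mult_right_mono total_increment_subdivide assms N) simp
  also have "\<dots> = ennreal (real N ^ DIM('a)) *
      (\<integral>\<^sup>+ w. of_nat N * total_increment f U w * indicator (ball 0 d) (real N *\<^sub>R w) \<partial>lborel)"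
  proof -
    have "(\<lambda>w. of_nat N * total_increment f U (w /\<^sub>R real N) * indicator (ball 0 d) w) \<in> borel_measurable borel"
      by measurable
    from nn_integral_lborel_affine[OF this, of "real N" 0] N(1) show ?thesis by simp
  qed
  also have "\<dots> \<le> ennreal (real N ^ DIM('a)) *
      (\<integral>\<^sup>+ w. of_nat N * (total_increment f U w * indicator (ball 0 h) w) \<partial>lborel)"
  proof (intro mult_left_mono nn_integral_mono)
    fix w :: 'a
    have "norm w < h" if "real N * norm w < d"
      using that N(1,2) by (metis (full_types) mult_less_cancel_left_pos of_nat_0_less_iff order_less_le_trans)
    then show "of_nat N * total_increment f U w * indicator (ball 0 d) (real N *\<^sub>R w) \<le>
        of_nat N * (total_increment f U w * indicator (ball 0 h) w)"
      by (auto simp: indicator_def mult.assoc)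
  qed simp
  also have "\<dots> = ennreal (real N ^ Suc DIM('a)) * (\<integral>\<^sup>+ w\<in>ball 0 h. total_increment f U w \<partial>lborel)"
    by (subst nn_integral_cmult) (auto simp: ennreal_mult ennreal_of_nat_eq_real_of_nat ac_simps)
  also have "\<dots> \<le> ennreal ((2 * d / h) ^ Suc DIM('a)) * (\<integral>\<^sup>+ w\<in>ball 0 h. total_increment f U w \<partial>lborel)"
    by (intro mult_right_mono ennreal_leI power_mono N) auto
  also have "ennreal ((2 * d / h) ^ Suc DIM('a)) = ennreal ((2 * d) ^ Suc DIM('a)) * ennreal (1 / h ^ Suc DIM('a))"
    using d h by (subst ennreal_mult[symmetric]) (auto simp: power_divide)
  finally show ?thesis by (simp add: increment_energy_def mult.assoc)
qed

text \<open>Substitute z = x + w. Convexity puts the segment into D whenever both end points are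
  there, and the bound on distances in D restricts w to the ball of radius d.\<close>

lemma double_integral_le_total_increment:
  fixes f :: "'a::euclidean_space \<Rightarrow> real"
  assumes [measurable]: "f \<in> borel_measurable borel" and D: "open D" "convex D"
    and diam: "\<And>x z. x \<in> D \<Longrightarrow> z \<in> D \<Longrightarrow> dist x z < d"
  shows "(\<integral>\<^sup>+ x\<in>D. (\<integral>\<^sup>+ z\<in>D. ennreal \<bar>f z - f x\<bar> \<partial>lborel) \<partial>lborel) \<le>
    (\<integral>\<^sup>+ w\<in>ball 0 d. total_increment f D w \<partial>lborel)"
proof -
  note borel_measurable_segment_indicator[OF D(1), measurable]
  have [measurable]: "D \<in> sets borel" using D by simp
  have "(\<integral>\<^sup>+ x\<in>D. (\<integral>\<^sup>+ z\<in>D. ennreal \<bar>f z - f x\<bar> \<partial>lborel) \<partial>lborel) =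
      (\<integral>\<^sup>+ x\<in>D. (\<integral>\<^sup>+ w. ennreal \<bar>f (x + w) - f x\<bar> * indicator D (x + w) \<partial>lborel) \<partial>lborel)"
  proof (rule nn_integral_cong)
    fix x
    have "(\<integral>\<^sup>+ z\<in>D. ennreal \<bar>f z - f x\<bar> \<partial>lborel) =
        (\<integral>\<^sup>+ w. ennreal \<bar>f (x + w) - f x\<bar> * indicator D (x + w) \<partial>lborel)"
      using nn_integral_lborel_shift[of "\<lambda>z. ennreal \<bar>f z - f x\<bar> * indicator D z" x]
      by (simp add: add.commute)
    then show "(\<integral>\<^sup>+ z\<in>D. ennreal \<bar>f z - f x\<bar> \<partial>lborel) * indicator D x =
        (\<integral>\<^sup>+ w. ennreal \<bar>f (x + w) - f x\<bar> * indicator D (x + w) \<partial>lborel) * indicator D x"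
      by simp
  qed
  also have "\<dots> \<le> (\<integral>\<^sup>+ x. (\<integral>\<^sup>+ w. ennreal \<bar>f (x + w) - f x\<bar> * segment_indicator D (x, w) * indicator (ball 0 d) w \<partial>lborel) \<partial>lborel)"
  proof (rule nn_integral_mono)
    fix x
    show "(\<integral>\<^sup>+ w. ennreal \<bar>f (x + w) - f x\<bar> * indicator D (x + w) \<partial>lborel) * indicator D x \<le>
      (\<integral>\<^sup>+ w. ennreal \<bar>f (x + w) - f x\<bar> * segment_indicator D (x, w) * indicator (ball 0 d) w \<partial>lborel)"
    proof (cases "x \<in> D")
      case True
      have "indicator D (x + w) \<le> segment_indicator D (x, w) * indicator (ball 0 d) w" for w
      proof (cases "x + w \<in> D")
        case xw: True
        then have "closed_segment x (x + w) \<subseteq> D" by (intro closed_segment_subset True D(2))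
        moreover have "norm w < d" using diam[OF True xw] by (simp add: dist_norm)
        ultimately show ?thesis by (auto simp: segment_indicator_def indicator_def)
      qed simp
      then show ?thesis
        using True by (auto simp: mult.assoc intro!: nn_integral_mono mult_left_mono)
    qed simp
  qed
  also have "\<dots> = (\<integral>\<^sup>+ w. (\<integral>\<^sup>+ x. ennreal \<bar>f (x + w) - f x\<bar> * segment_indicator D (x, w) * indicator (ball 0 d) w \<partial>lborel) \<partial>lborel)"
    by (rule lborel_pair.Fubini') measurable
  also have "\<dots> = (\<integral>\<^sup>+ w\<in>ball 0 d. total_increment f D w \<partial>lborel)"
    unfolding total_increment_alt by (intro nn_integral_cong nn_integral_multc) measurable
  finally show ?thesis .
qed

text \<open>Disjointness means that a segment lies in at most one \<open>D j\<close>, namely the one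
  containing its initial point. The segment indicators therefore add up to at most that of
  U.\<close>

lemma increment_energy_superadditive:
  fixes f :: "'a::euclidean_space \<Rightarrow> real"
  assumes [measurable]: "f \<in> borel_measurable borel" and U: "open U"
    and J: "finite J" "\<And>j. j \<in> J \<Longrightarrow> open (D j)" "\<And>j. j \<in> J \<Longrightarrow> D j \<subseteq> U" "disjoint_family_on D J"
  shows "(\<Sum>j\<in>J. increment_energy f (D j) h) \<le> increment_energy f U h"
proof -
  note borel_measurable_total_increment[OF assms(1), measurable]
  note borel_measurable_segment_indicator[measurable]
  have "(\<Sum>j\<in>J. total_increment f (D j) w) \<le> total_increment f U w" for w
  proof -
    have "(\<Sum>j\<in>J. total_increment f (D j) w) =
        (\<integral>\<^sup>+ x. (\<Sum>j\<in>J. ennreal \<bar>f (x + w) - f x\<bar> * segment_indicator (D j) (x, w)) \<partial>lborel)"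
      unfolding total_increment_alt using J(2) by (intro nn_integral_sum[symmetric]) measurable
    also have "\<dots> \<le> total_increment f U w"
      unfolding total_increment_alt
    proof (rule nn_integral_mono)
      fix x
      have "(\<Sum>j\<in>J. segment_indicator (D j) (x, w)) \<le> segment_indicator U (x, w)"
      proof (cases "\<exists>j\<in>J. closed_segment x (x + w) \<subseteq> D j")
        case True
        then obtain j where j: "j \<in> J" "closed_segment x (x + w) \<subseteq> D j" by blast
        have "segment_indicator (D i) (x, w) = 0" if "i \<in> J - {j}" for i
        proof -
          have "x \<in> D j" using j(2) by auto
          then have "x \<notin> D i" using J(4) j(1) that by (auto simp: disjoint_family_on_def)
          then have "\<not> closed_segment x (x + w) \<subseteq> D i" by auto
          then show ?thesis by (simp add: segment_indicator_def)
        qed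
        then have "(\<Sum>j\<in>J. segment_indicator (D j) (x, w)) = segment_indicator (D j) (x, w)"
          using J(1) j(1) by (subst sum.remove[of J j]) auto
        also have "\<dots> \<le> segment_indicator U (x, w)"
          using J(3)[OF j(1)] by (auto simp: segment_indicator_def indicator_def)
        finally show ?thesis .
      qed (auto simp: segment_indicator_def)
      then show "(\<Sum>j\<in>J. ennreal \<bar>f (x + w) - f x\<bar> * segment_indicator (D j) (x, w)) \<le>
          ennreal \<bar>f (x + w) - f x\<bar> * segment_indicator U (x, w)"
        unfolding sum_distrib_left[symmetric] by (rule mult_left_mono) simp
    qed
    finally show ?thesis .
  qed
  then have "(\<integral>\<^sup>+ w. (\<Sum>j\<in>J. total_increment f (D j) w * indicator (ball 0 h) w) \<partial>lborel) \<le>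
      (\<integral>\<^sup>+ w\<in>ball 0 h. total_increment f U w \<partial>lborel)"
    unfolding sum_distrib_right[symmetric] by (intro nn_integral_mono mult_right_mono) auto
  moreover have "(\<integral>\<^sup>+ w. (\<Sum>j\<in>J. total_increment f (D j) w * indicator (ball 0 h) w) \<partial>lborel) =
      (\<Sum>j\<in>J. (\<integral>\<^sup>+ w\<in>ball 0 h. total_increment f (D j) w \<partial>lborel))"
    using J(2) by (intro nn_integral_sum) measurable
  ultimately show ?thesis
    unfolding increment_energy_def sum_distrib_left[symmetric] by (simp add: mult_left_mono)
qed

text \<open>The product on the left is the measure of the pairs with x in E and z outside E, on
  which the indicator of E has increment of modulus one. It is at most the double integral of all
  increments in D.\<close>

lemma isoperimetric_increment_energy:
  fixes D :: "'a::euclidean_space set"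
  assumes [measurable]: "E \<in> sets borel" and D: "open D" "convex D"
    and diam: "\<And>x z. x \<in> D \<Longrightarrow> z \<in> D \<Longrightarrow> dist x z < d" and h: "0 < h" "h \<le> d"
  shows "emeasure lborel (D \<inter> E) * emeasure lborel (D - E) \<le>
    ennreal ((2 * d) ^ Suc DIM('a)) * increment_energy (indicator E) D h"
proof -
  have [measurable]: "D \<in> sets borel" using D by simp
  have "emeasure lborel (D \<inter> E) * emeasure lborel (D - E) =
      (\<integral>\<^sup>+ x. emeasure lborel (D - E) * indicator (D \<inter> E) x \<partial>lborel)"
    by (subst nn_integral_cmult_indicator) (auto simp: mult.commute)
  also have "\<dots> = (\<integral>\<^sup>+ x. (\<integral>\<^sup>+ z. indicator (D - E) z \<partial>lborel) * indicator (D \<inter> E) x \<partial>lborel)"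
    by (subst nn_integral_indicator) auto
  also have "\<dots> \<le> (\<integral>\<^sup>+ x\<in>D. (\<integral>\<^sup>+ z\<in>D. ennreal \<bar>indicator E z - indicator E x\<bar> \<partial>lborel) \<partial>lborel)"
  proof (rule nn_integral_mono)
    fix x
    have "(\<integral>\<^sup>+ z. indicator (D - E) z \<partial>lborel) \<le> (\<integral>\<^sup>+ z\<in>D. ennreal \<bar>indicator E z - indicator E x\<bar> \<partial>lborel)" if "x \<in> E"
      using that by (intro nn_integral_mono) (auto simp: indicator_def)
    then show "(\<integral>\<^sup>+ z. indicator (D - E) z \<partial>lborel) * indicator (D \<inter> E) x \<le>
        (\<integral>\<^sup>+ z\<in>D. ennreal \<bar>indicator E z - indicator E x\<bar> \<partial>lborel) * indicator D x"
      by (simp add: indicator_def)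
  qed
  also have "\<dots> \<le> (\<integral>\<^sup>+ w\<in>ball 0 d. total_increment (indicator E) D w \<partial>lborel)"
    by (rule double_integral_le_total_increment[OF _ D diam]) measurable
  also have "\<dots> \<le> ennreal ((2 * d) ^ Suc DIM('a)) * increment_energy (indicator E) D h"
    by (rule nn_integral_total_increment_le_energy[OF _ D(1) h]) measurable
  finally show ?thesis .
qed

section \<open>Layer cake formula and coarea inequality\<close>

lemma nn_integral_superlevel_indicator:
  "(\<integral>\<^sup>+ t. ennreal \<bar>indicator {x. t < u x} y - indicator {x. t < u x} z\<bar> \<partial>lborel) = ennreal \<bar>u y - u z\<bar>"
proof -
  have "(\<integral>\<^sup>+ t. ennreal \<bar>indicator {x. t < u x} y - indicator {x. t < u x} z\<bar> \<partial>lborel) =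
      (\<integral>\<^sup>+ t. indicator {min (u y) (u z)..<max (u y) (u z)} t \<partial>lborel)"
    by (intro nn_integral_cong) (auto simp: indicator_def)
  also have "\<dots> = ennreal \<bar>u y - u z\<bar>"
    by (simp add: min_def max_def abs_if)
  finally show ?thesis .
qed

text \<open>Tonelli reduces this to the layer cake formula for a single pair of points. At each
  fixed h it is an equality; an inequality arises only when h tends to 0.\<close>

lemma nn_integral_superlevel_increment_energy:
  fixes u :: "'a::euclidean_space \<Rightarrow> real"
  assumes [measurable]: "u \<in> borel_measurable borel" and "open U"
  shows "(\<integral>\<^sup>+ t. increment_energy (indicator {x. t < u x}) U h \<partial>lborel) = increment_energy u U h"
    and "(\<lambda>t. increment_energy (indicator {x. t < u x}) U h) \<in> borel_measurable borel"
proof -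
  note borel_measurable_segment_indicator[OF assms(2), measurable]
  \<comment> \<open>Written as a comparison of t with a Borel function, the indicator is visibly
    measurable jointly in t, w and x.\<close>
  have ind: "(indicator {x. t < u x} y :: real) = (if t < u y then 1 else 0)" for t y
    by simp
  have m[measurable]: "(\<lambda>(t, w). total_increment (indicator {x. t < u x}) U w) \<in> borel_measurable (borel \<Otimes>\<^sub>M borel)"
    unfolding total_increment_alt ind by measurable
  have [measurable]: "ball (0 :: 'a) h \<in> sets borel" by simp
  show "(\<lambda>t. increment_energy (indicator {x. t < u x}) U h) \<in> borel_measurable borel"
    unfolding increment_energy_def by measurable
  have *: "(\<integral>\<^sup>+ t. total_increment (indicator {x. t < u x}) U w \<partial>lborel) = total_increment u U w" for w
  proof -
    have "(\<integral>\<^sup>+ t. total_increment (indicator {x. t < u x}) U w \<partial>lborel) =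
      (\<integral>\<^sup>+ x. (\<integral>\<^sup>+ t. ennreal \<bar>indicator {x. t < u x} (x + w) - indicator {x. t < u x} x\<bar> * segment_indicator U (x, w) \<partial>lborel) \<partial>lborel)"
      unfolding total_increment_alt ind by (rule lborel_pair.Fubini') measurable
    also have "\<dots> = (\<integral>\<^sup>+ x. (\<integral>\<^sup>+ t. ennreal \<bar>indicator {x. t < u x} (x + w) - indicator {x. t < u x} x\<bar> \<partial>lborel) * segment_indicator U (x, w) \<partial>lborel)"
      unfolding ind by (intro nn_integral_cong nn_integral_multc) measurable
    also have "\<dots> = total_increment u U w"
      unfolding nn_integral_superlevel_indicator total_increment_alt ..
    finally show ?thesis .
  qed
  have "(\<integral>\<^sup>+ t. increment_energy (indicator {x. t < u x}) U h \<partial>lborel) =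
      ennreal (1 / h ^ Suc DIM('a)) * (\<integral>\<^sup>+ t. (\<integral>\<^sup>+ w\<in>ball 0 h. total_increment (indicator {x. t < u x}) U w \<partial>lborel) \<partial>lborel)"
    unfolding increment_energy_def by (intro nn_integral_cmult) measurable
  also have "(\<integral>\<^sup>+ t. (\<integral>\<^sup>+ w\<in>ball 0 h. total_increment (indicator {x. t < u x}) U w \<partial>lborel) \<partial>lborel) =
      (\<integral>\<^sup>+ w. (\<integral>\<^sup>+ t. total_increment (indicator {x. t < u x}) U w * indicator (ball 0 h) w \<partial>lborel) \<partial>lborel)"
    by (rule lborel_pair.Fubini') measurable
  also have "\<dots> = (\<integral>\<^sup>+ w\<in>ball 0 h. total_increment u U w \<partial>lborel)"
    unfolding *[symmetric] by (intro nn_integral_cong nn_integral_multc) measurable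
  finally show "(\<integral>\<^sup>+ t. increment_energy (indicator {x. t < u x}) U h \<partial>lborel) = increment_energy u U h"
    by (simp add: increment_energy_def)
qed

text \<open>On the ball of radius h the factor \<open>norm w\<close> is at most h, and the volume of
  this ball is \<open>unit_ball_vol\<close> times h^n. Together they cancel the normalisation, so
  the bound is uniform in h.\<close>

lemma increment_energy_le:
  fixes U :: "'a::euclidean_space set"
  assumes "0 < h" and le: "\<And>w. total_increment f U w \<le> ennreal (norm w) * X"
  shows "increment_energy f U h \<le> ennreal (unit_ball_vol (real DIM('a))) * X"
proof -
  have "(\<integral>\<^sup>+ w\<in>ball 0 h. total_increment f U w \<partial>lborel) \<le> (\<integral>\<^sup>+ w. (ennreal h * X) * indicator (ball (0 :: 'a) h) w \<partial>lborel)"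
  proof (rule nn_integral_mono)
    fix w :: 'a
    have "ennreal (norm w) * X \<le> ennreal h * X" if "norm w < h"
      using that by (intro mult_right_mono ennreal_leI) auto
    then show "total_increment f U w * indicator (ball 0 h) w \<le> (ennreal h * X) * indicator (ball 0 h) w"
      using le[of w] by (auto simp: indicator_def)
  qed
  also have "\<dots> = ennreal h * X * ennreal (unit_ball_vol (real DIM('a)) * h ^ DIM('a))"
    using assms(1) by (subst nn_integral_cmult_indicator) (auto simp: emeasure_ball)
  finally have "increment_energy f U h \<le> ennreal (1 / h ^ Suc DIM('a)) * (ennreal h * X * ennreal (unit_ball_vol (real DIM('a)) * h ^ DIM('a)))"
    unfolding increment_energy_def by (rule mult_left_mono) simp
  also have "\<dots> = (ennreal (1 / h ^ Suc DIM('a)) * (ennreal h * ennreal (unit_ball_vol (real DIM('a)) * h ^ DIM('a)))) * X"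
    by (simp only: ac_simps)
  also have "ennreal (1 / h ^ Suc DIM('a)) * (ennreal h * ennreal (unit_ball_vol (real DIM('a)) * h ^ DIM('a))) =
      ennreal (unit_ball_vol (real DIM('a)))"
    using assms(1) by (simp add: ennreal_mult[symmetric])
  finally show ?thesis .
qed

text \<open>The lower limit runs along a sequence, so that Fatou's lemma gives the coarea inequality
  and measurability in the level, while any lower bound valid for all large k passes to the
  limit.\<close>

definition perimeter :: "'a::euclidean_space set \<Rightarrow> 'a set \<Rightarrow> ennreal" where
  "perimeter E U = liminf (\<lambda>k. increment_energy (indicator E) U (inverse (real (Suc k))))"

lemma perimeter_coarea:
  fixes u :: "'a::euclidean_space \<Rightarrow> real"
  assumes [measurable]: "u \<in> borel_measurable borel" and "open U"
    and le: "\<And>w. total_increment u U w \<le> ennreal (norm w) * X"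
  shows "(\<integral>\<^sup>+ t. perimeter {x. t < u x} U \<partial>lborel) \<le> ennreal (unit_ball_vol (real DIM('a))) * X"
    and "(\<lambda>t. perimeter {x. t < u x} U) \<in> borel_measurable borel"
proof -
  note nn_integral_superlevel_increment_energy(2)[OF assms(1,2), measurable]
  show "(\<lambda>t. perimeter {x. t < u x} U) \<in> borel_measurable borel"
    unfolding perimeter_def by measurable
  have "(\<integral>\<^sup>+ t. perimeter {x. t < u x} U \<partial>lborel) \<le>
      liminf (\<lambda>k. \<integral>\<^sup>+ t. increment_energy (indicator {x. t < u x}) U (inverse (real (Suc k))) \<partial>lborel)"
    unfolding perimeter_def by (intro nn_integral_liminf) measurable
  also have "\<dots> \<le> liminf (\<lambda>k. ennreal (unit_ball_vol (real DIM('a))) * X)"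
    unfolding nn_integral_superlevel_increment_energy(1)[OF assms(1,2)]
    by (intro Liminf_mono always_eventually allI increment_energy_le le) simp
  finally show "(\<integral>\<^sup>+ t. perimeter {x. t < u x} U \<partial>lborel) \<le> ennreal (unit_ball_vol (real DIM('a))) * X"
    by (simp add: Liminf_const)
qed

subsection \<open>Hausdorff content and coverings\<close>

lemma hausdorff_content_mono: "A \<subseteq> B \<Longrightarrow> hausdorff_content \<beta> A \<le> hausdorff_content \<beta> B"
  unfolding hausdorff_content_def by (intro INF_superset_mono) auto

abbreviation ball_weight :: "real \<Rightarrow> real \<Rightarrow> ennreal" where
  "ball_weight \<beta> r \<equiv> ennreal (unit_ball_vol \<beta> * r powr \<beta>)"

lemma hausdorff_content_le_covering:
  fixes x :: "nat \<Rightarrow> real ^ 'n"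
  assumes "\<And>i. 0 < r i" "E \<subseteq> (\<Union>i. ball (x i) (r i))"
  shows "hausdorff_content \<beta> E \<le> (\<Sum>i. ball_weight \<beta> (r i))"
  unfolding hausdorff_content_def by (rule INF_lower2[of "(x, r)"]) (use assms in auto)

lemma hausdorff_content_le_countable_covering:
  fixes a :: "'i \<Rightarrow> real ^ 'n"
  assumes \<beta>: "0 < \<beta>" and C: "countable C" "\<And>c. c \<in> C \<Longrightarrow> 0 < r c"
    and cover: "E \<subseteq> (\<Union>c\<in>C. ball (a c) (r c))"
    and bound: "\<And>F. finite F \<Longrightarrow> F \<subseteq> C \<Longrightarrow> (\<Sum>c\<in>F. ball_weight \<beta> (r c)) \<le> T"
  shows "hausdorff_content \<beta> E \<le> T"
proof (rule ennreal_le_epsilon)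
  fix e :: real assume "0 < e"
  have \<omega>: "0 < unit_ball_vol \<beta>" using \<beta> by simp
  define I where "I = to_nat_on C ` C"
  define x where "x i = (if i \<in> I then a (from_nat_into C i) else 0)" for i
  \<comment> \<open>The second radius solves
    \<open>unit_ball_vol \<beta> * x powr \<beta> = e * (1 / 2) ^ Suc i\<close>.\<close>
  define \<rho> where "\<rho> i = (if i \<in> I then r (from_nat_into C i)
      else (e / unit_ball_vol \<beta> * (1 / 2) ^ Suc i) powr (1 / \<beta>))" for i
  have inI: "from_nat_into C i \<in> C" "to_nat_on C (from_nat_into C i) = i" if "i \<in> I" for i
    using that C(1) by (auto simp: I_def)
  have "0 < \<rho> i" for i
    using C(2) inI \<open>0 < e\<close> \<omega> by (auto simp: \<rho>_def)
  moreover have "E \<subseteq> (\<Union>i. ball (x i) (\<rho> i))"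
  proof
    fix y assume "y \<in> E"
    then obtain c where "c \<in> C" "y \<in> ball (a c) (r c)" using cover by blast
    moreover have "to_nat_on C c \<in> I" "from_nat_into C (to_nat_on C c) = c"
      using \<open>c \<in> C\<close> C(1) by (auto simp: I_def)
    ultimately have "y \<in> ball (x (to_nat_on C c)) (\<rho> (to_nat_on C c))"
      by (simp add: x_def \<rho>_def)
    then show "y \<in> (\<Union>i. ball (x i) (\<rho> i))" by blast
  qed
  ultimately have "hausdorff_content \<beta> E \<le> (\<Sum>i. ball_weight \<beta> (\<rho> i))"
    by (rule hausdorff_content_le_covering)
  also have "\<dots> \<le> T + ennreal e"
  proof (rule suminf_le_const)
    fix k :: nat
    have "(\<Sum>i<k. ball_weight \<beta> (\<rho> i)) =
        (\<Sum>i\<in>{..<k} \<inter> I. ball_weight \<beta> (\<rho> i)) +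
        (\<Sum>i\<in>{..<k} - I. ball_weight \<beta> (\<rho> i))"
      by (subst sum.union_disjoint[symmetric]) (auto intro!: sum.cong)
    also have "\<dots> \<le> T + ennreal e"
    proof (rule add_mono)
      have "inj_on (from_nat_into C) ({..<k} \<inter> I)"
        using inI(2) by (metis Int_iff inj_on_def)
      then have "(\<Sum>i\<in>{..<k} \<inter> I. ball_weight \<beta> (\<rho> i)) =
          (\<Sum>c\<in>from_nat_into C ` ({..<k} \<inter> I). ball_weight \<beta> (r c))"
        by (subst sum.reindex) (auto simp: \<rho>_def)
      also have "\<dots> \<le> T" using inI(1) by (intro bound) auto
      finally show "(\<Sum>i\<in>{..<k} \<inter> I. ball_weight \<beta> (\<rho> i)) \<le> T" .
      have "(\<Sum>i\<in>{..<k} - I. ball_weight \<beta> (\<rho> i)) =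
          (\<Sum>i\<in>{..<k} - I. ennreal (e * (1 / 2) ^ Suc i))"
        using \<beta> \<omega>[THEN less_imp_neq] \<open>0 < e\<close> by (intro sum.cong) (auto simp: \<rho>_def powr_powr)
      also have "\<dots> = ennreal (\<Sum>i\<in>{..<k} - I. e * (1 / 2) ^ Suc i)"
        using \<open>0 < e\<close> by (intro sum_ennreal) auto
      also have "\<dots> \<le> ennreal e"
      proof (rule ennreal_leI)
        have "(\<Sum>i\<in>{..<k} - I. e * (1 / 2) ^ Suc i) \<le> (\<Sum>i<k. e * (1 / 2) ^ Suc i)"
          using \<open>0 < e\<close> by (intro sum_mono2) auto
        also have "\<dots> = e * (1 - (1 / 2) ^ k)"
          by (induction k) (auto simp: algebra_simps)
        also have "\<dots> \<le> e" using \<open>0 < e\<close> by simp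
        finally show "(\<Sum>i\<in>{..<k} - I. e * (1 / 2) ^ Suc i) \<le> e" .
      qed
      finally show "(\<Sum>i\<in>{..<k} - I. ball_weight \<beta> (\<rho> i)) \<le> ennreal e" .
    qed
    finally show "(\<Sum>i<k. ball_weight \<beta> (\<rho> i)) \<le> T + ennreal e" .
  qed simp
  finally show "hausdorff_content \<beta> E \<le> T + ennreal e" .
qed

lemma hausdorff_content_empty: "0 < \<beta> \<Longrightarrow> hausdorff_content \<beta> ({} :: (real ^ 'n) set) = 0"
  using hausdorff_content_le_countable_covering[of \<beta> "{}" "\<lambda>_. 1" "{}" "\<lambda>_ :: nat. 0" 0] by simp

lemma hausdorff_content_UN_le:
  fixes S :: "nat \<Rightarrow> (real ^ 'n) set"
  assumes \<beta>: "0 < \<beta>"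
  shows "hausdorff_content \<beta> (\<Union>k. S k) \<le> (\<Sum>k. hausdorff_content \<beta> (S k))"
proof (cases "\<exists>k. hausdorff_content \<beta> (S k) = \<infinity>")
  case True
  then obtain k where "hausdorff_content \<beta> (S k) = \<infinity>" by blast
  then have "\<infinity> \<le> (\<Sum>k. hausdorff_content \<beta> (S k))"
    using sum_le_suminf[of "\<lambda>k. hausdorff_content \<beta> (S k)" "{k}"] by simp
  then show ?thesis by (simp add: top_unique)
next
  case False
  show ?thesis
  proof (rule ennreal_le_epsilon)
    fix e :: real assume "0 < e"
    have "\<exists>x r. (\<forall>i. 0 < r i) \<and> S k \<subseteq> (\<Union>i. ball (x i) (r i)) \<and>
        (\<Sum>i. ball_weight \<beta> (r i)) \<le> hausdorff_content \<beta> (S k) + ennreal (e * (1 / 2) ^ Suc k)" for k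
    proof -
      have "hausdorff_content \<beta> (S k) < hausdorff_content \<beta> (S k) + ennreal (e * (1 / 2) ^ Suc k)"
        using False \<open>0 < e\<close> by (auto simp: ennreal_add_left_cancel_less less_top)
      then show ?thesis
        unfolding hausdorff_content_def[of \<beta> "S k"] INF_less_iff by (force intro: less_imp_le)
    qed
    then have "\<forall>k. \<exists>p. (\<forall>i. 0 < snd p i) \<and> S k \<subseteq> (\<Union>i. ball (fst p i) (snd p i)) \<and>
        (\<Sum>i. ball_weight \<beta> (snd p i)) \<le> hausdorff_content \<beta> (S k) + ennreal (e * (1 / 2) ^ Suc k)"
      by simp
    then obtain p where p: "\<forall>k. (\<forall>i. 0 < snd (p k) i) \<and> S k \<subseteq> (\<Union>i. ball (fst (p k) i) (snd (p k) i)) \<and>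
        (\<Sum>i. ball_weight \<beta> (snd (p k) i)) \<le> hausdorff_content \<beta> (S k) + ennreal (e * (1 / 2) ^ Suc k)"
      by (rule choice[THEN exE])
    define x where "x k = fst (p k)" for k
    define r where "r k = snd (p k)" for k
    have xr: "\<And>k i. 0 < r k i" "\<And>k. S k \<subseteq> (\<Union>i. ball (x k i) (r k i))"
      "\<And>k. (\<Sum>i. ball_weight \<beta> (r k i)) \<le> hausdorff_content \<beta> (S k) + ennreal (e * (1 / 2) ^ Suc k)"
      using p unfolding x_def r_def by blast+
    have "hausdorff_content \<beta> (\<Union>k. S k) \<le> (\<Sum>k. hausdorff_content \<beta> (S k) + ennreal (e * (1 / 2) ^ Suc k))"
    proof (rule hausdorff_content_le_countable_covering[OF \<beta>, of UNIV "\<lambda>(k, i). r k i" _ "\<lambda>(k, i). x k i"])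
      show "(\<Union>k. S k) \<subseteq> (\<Union>c\<in>UNIV. ball (case c of (k, i) \<Rightarrow> x k i) (case c of (k, i) \<Rightarrow> r k i))"
      proof
        fix y assume "y \<in> (\<Union>k. S k)"
        then obtain k i where "y \<in> ball (x k i) (r k i)" using xr(2) by blast
        then show "y \<in> (\<Union>c\<in>UNIV. ball (case c of (k, i) \<Rightarrow> x k i) (case c of (k, i) \<Rightarrow> r k i))"
          by (intro UN_I[of "(k, i)"]) auto
      qed
      fix F :: "(nat \<times> nat) set" assume F: "finite F"
      then obtain N where N: "F \<subseteq> {..<N} \<times> {..<N}"
      proof -
        have "finite (fst ` F \<union> snd ` F)" using F by simp
        then obtain N where "fst ` F \<union> snd ` F \<subseteq> {..<N}"
          using finite_nat_iff_bounded by blast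
        then show ?thesis by (intro that[of N]) force
      qed
      have "(\<Sum>c\<in>F. ennreal (unit_ball_vol \<beta> * (case c of (k, i) \<Rightarrow> r k i) powr \<beta>)) \<le>
          (\<Sum>c\<in>{..<N} \<times> {..<N}. ennreal (unit_ball_vol \<beta> * (case c of (k, i) \<Rightarrow> r k i) powr \<beta>))"
        using N by (intro sum_mono2) auto
      also have "\<dots> = (\<Sum>k<N. \<Sum>i<N. ball_weight \<beta> (r k i))"
        by (subst sum.cartesian_product) (auto intro!: sum.cong)
      also have "\<dots> \<le> (\<Sum>k<N. hausdorff_content \<beta> (S k) + ennreal (e * (1 / 2) ^ Suc k))"
        by (intro sum_mono order_trans[OF sum_le_suminf xr(3)]) auto
      also have "\<dots> \<le> (\<Sum>k. hausdorff_content \<beta> (S k) + ennreal (e * (1 / 2) ^ Suc k))"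
        by (intro sum_le_suminf) auto
      finally show "(\<Sum>c\<in>F. ennreal (unit_ball_vol \<beta> * (case c of (k, i) \<Rightarrow> r k i) powr \<beta>)) \<le>
        (\<Sum>k. hausdorff_content \<beta> (S k) + ennreal (e * (1 / 2) ^ Suc k))" .
    qed (use xr(1) in auto)
    also have "\<dots> = (\<Sum>k. hausdorff_content \<beta> (S k)) + (\<Sum>k. ennreal (e * (1 / 2) ^ Suc k))"
      by (intro suminf_add[symmetric]) auto
    also have "(\<Sum>k. ennreal (e * (1 / 2) ^ Suc k)) = ennreal e"
      using sums_mult[OF power_half_series, of e] \<open>0 < e\<close>
      by (intro suminf_ennreal_eq) auto
    finally show "hausdorff_content \<beta> (\<Union>k. S k) \<le> (\<Sum>k. hausdorff_content \<beta> (S k)) + ennreal e" .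
  qed
qed

lemma hausdorff_content_UN_null:
  fixes S :: "'i \<Rightarrow> (real ^ 'n) set"
  assumes \<beta>: "0 < \<beta>" and "countable I" and null: "\<And>i. i \<in> I \<Longrightarrow> hausdorff_content \<beta> (S i) = 0"
  shows "hausdorff_content \<beta> (\<Union>i\<in>I. S i) = 0"
proof (cases "I = {}")
  case False
  then have "(\<Union>i\<in>I. S i) = (\<Union>k. S (from_nat_into I k))"
    using assms(2) by (metis UN_simps(10) range_from_nat_into)
  moreover have "hausdorff_content \<beta> (\<Union>k. S (from_nat_into I k)) \<le> (\<Sum>k. hausdorff_content \<beta> (S (from_nat_into I k)))"
    by (rule hausdorff_content_UN_le[OF \<beta>])
  ultimately show ?thesis using null False by (simp add: from_nat_into)
qed (simp add: hausdorff_content_empty \<beta>)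

lemma hausdorff_content_Un_le:
  fixes A B :: "(real ^ 'n) set"
  assumes \<beta>: "0 < \<beta>"
  shows "hausdorff_content \<beta> (A \<union> B) \<le> hausdorff_content \<beta> A + hausdorff_content \<beta> B"
proof -
  define S where "S k = (if k = 0 then A else if k = Suc 0 then B else {})" for k :: nat
  have "(\<Union>k. S k) = A \<union> B" by (auto simp: S_def split: if_splits)
  moreover have "(\<Sum>k. hausdorff_content \<beta> (S k)) = (\<Sum>k<2. hausdorff_content \<beta> (S k))"
    by (rule suminf_finite) (auto simp: S_def hausdorff_content_empty[OF \<beta>])
  ultimately show ?thesis
    using hausdorff_content_UN_le[OF \<beta>, of S] by (simp add: S_def numeral_2_eq_2)
qed

text \<open>Vitali's covering lemma reduces a bound for the content to one for finite disjoint
  subfamilies. The five-fold enlarged closed balls cover \<open>S\<close>; the factor 6 makes them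
  open, as the content requires.\<close>

lemma hausdorff_content_le_disjoint_balls:
  fixes S :: "(real ^ 'n) set"
  assumes \<beta>: "0 < \<beta>" and R: "\<And>y. y \<in> S \<Longrightarrow> 0 < R y \<and> R y \<le> B"
    and bound: "\<And>F. finite F \<Longrightarrow> F \<subseteq> S \<Longrightarrow> disjoint_family_on (\<lambda>y. cball y (R y)) F \<Longrightarrow>
        (\<Sum>y\<in>F. ennreal (R y powr \<beta>)) \<le> T"
  shows "hausdorff_content \<beta> S \<le> ennreal (unit_ball_vol \<beta> * 6 powr \<beta>) * T"
proof -
  have "y \<in> cball y (R y)" if "y \<in> S" for y using R[OF that] by simp
  then have "S \<subseteq> (\<Union>y\<in>S. cball y (R y))" by blast
  then obtain C where C: "countable C" "C \<subseteq> S"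
    "pairwise (\<lambda>i j. disjnt (cball i (R i)) (cball j (R j))) C" "S \<subseteq> (\<Union>y\<in>C. cball y (5 * R y))"
    using Vitali_covering_lemma_cballs[where S = S and K = S and a = "\<lambda>y. y" and r = R and B = B] R by blast
  show ?thesis
  proof (rule hausdorff_content_le_countable_covering[OF \<beta> C(1), of "\<lambda>y. 6 * R y" _ "\<lambda>y. y"])
    show "0 < 6 * R c" if "c \<in> C" for c using that C(2) R by auto
    have "cball y (5 * R y) \<subseteq> ball y (6 * R y)" if "y \<in> C" for y
    proof -
      have "0 < R y" using that C(2) R by blast
      then show ?thesis by (auto simp: subset_iff)
    qed
    then show "S \<subseteq> (\<Union>y\<in>C. ball y (6 * R y))" using C(4) by blast
    fix F assume F: "finite F" "F \<subseteq> C"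
    have "disjoint_family_on (\<lambda>y. cball y (R y)) F"
      using C(3) F(2) by (auto simp: disjoint_family_on_def pairwise_def disjnt_def) 
    then have *: "(\<Sum>y\<in>F. ennreal (R y powr \<beta>)) \<le> T" using bound F C(2) by blast
    have "(\<Sum>y\<in>F. ennreal (unit_ball_vol \<beta> * (6 * R y) powr \<beta>)) =
        ennreal (unit_ball_vol \<beta> * 6 powr \<beta>) * (\<Sum>y\<in>F. ennreal (R y powr \<beta>))"
      unfolding sum_distrib_left
    proof (rule sum.cong)
      fix y assume "y \<in> F"
      then have "0 < R y" using F C(2) R by blast
      then show "ennreal (unit_ball_vol \<beta> * (6 * R y) powr \<beta>) = ennreal (unit_ball_vol \<beta> * 6 powr \<beta>) * ennreal (R y powr \<beta>)"
        using \<beta> by (simp add: ennreal_mult[symmetric] powr_mult mult.assoc)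
    qed simp
    also have "\<dots> \<le> ennreal (unit_ball_vol \<beta> * 6 powr \<beta>) * T"
      by (rule mult_left_mono[OF *]) simp
    finally show "(\<Sum>y\<in>F. ennreal (unit_ball_vol \<beta> * (6 * R y) powr \<beta>)) \<le> ennreal (unit_ball_vol \<beta> * 6 powr \<beta>) * T" .
  qed
qed

section \<open>Criteria for content zero in codimension one\<close>

lemma null_set_if_hausdorff_content_0:
  fixes S :: "(real ^ 'n) set"
  assumes "hausdorff_content (real CARD('n)) S = 0"
  obtains N where "N \<in> null_sets lborel" "S \<subseteq> N"
proof -
  have "\<exists>M\<in>sets borel. S \<subseteq> M \<and> emeasure lborel M \<le> ennreal (inverse (real (Suc k)))" for k
  proof -
    have "hausdorff_content (real CARD('n)) S < ennreal (inverse (real (Suc k)))"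
      using assms by (simp del: of_nat_Suc)
    then obtain x r where xr: "\<And>i :: nat. 0 < r i" "S \<subseteq> (\<Union>i. ball (x i) (r i))"
        "(\<Sum>i. ennreal (unit_ball_vol (real CARD('n)) * r i powr real CARD('n))) < ennreal (inverse (real (Suc k)))"
      unfolding hausdorff_content_def INF_less_iff by auto
    have "emeasure lborel (\<Union>i. ball (x i) (r i)) \<le> (\<Sum>i. emeasure lborel (ball (x i) (r i)))"
      by (rule emeasure_subadditive_countably) auto
    also have "\<dots> = (\<Sum>i. ennreal (unit_ball_vol (real CARD('n)) * r i powr real CARD('n)))"
      using xr(1) by (simp add: emeasure_ball less_imp_le powr_realpow)
    finally show ?thesis
      using xr(2,3) by (intro bexI[of _ "\<Union>i. ball (x i) (r i)"]) auto
  qed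
  then obtain M where M: "\<And>k. M k \<in> sets borel" "\<And>k. S \<subseteq> M k"
    "\<And>k. emeasure lborel (M k) \<le> ennreal (inverse (real (Suc k)))"
    by metis
  have "emeasure lborel (\<Inter>k. M k) \<le> 0"
  proof (rule LIMSEQ_le_const)
    show "(\<lambda>k. ennreal (inverse (real (Suc k)))) \<longlonglongrightarrow> 0"
      using tendsto_ennrealI[OF LIMSEQ_inverse_real_of_nat] by simp
    show "\<exists>N. \<forall>k\<ge>N. emeasure lborel (\<Inter>k. M k) \<le> ennreal (inverse (real (Suc k)))"
    proof (intro exI allI impI)
      fix k
      have "emeasure lborel (\<Inter>k. M k) \<le> emeasure lborel (M k)"
        by (rule emeasure_mono) (use M(1) in auto)
      then show "emeasure lborel (\<Inter>k. M k) \<le> ennreal (inverse (real (Suc k)))"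
        using M(3) by (rule order_trans)
    qed
  qed
  then have "(\<Inter>k. M k) \<in> null_sets lborel"
    using M(1) by (intro null_setsI) auto
  then show ?thesis using M(2) by (intro that[of "\<Inter>k. M k"]) auto
qed

text \<open>Outer regularity of the finite measure with density \<gamma> on D, which gives measure
  zero to the Lebesgue null set N.\<close>

lemma open_superset_small_integral:
  fixes D :: "'a::euclidean_space set" and \<gamma> :: "'a \<Rightarrow> ennreal"
  assumes N: "N \<in> null_sets lborel" "S \<subseteq> N" and D: "open D" "S \<subseteq> D"
    and [measurable]: "\<gamma> \<in> borel_measurable borel" and fin: "(\<integral>\<^sup>+ x\<in>D. \<gamma> x \<partial>lborel) < \<infinity>"
    and e: "(0 :: ennreal) < e"
  obtains U where "open U" "S \<subseteq> U" "U \<subseteq> D" "(\<integral>\<^sup>+ x\<in>U. \<gamma> x \<partial>lborel) < e"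
proof -
  have [measurable]: "D \<in> sets borel" using D by simp
  define \<nu> where "\<nu> = density lborel (\<lambda>x. \<gamma> x * indicator D x)"
  have \<nu>: "emeasure \<nu> A = (\<integral>\<^sup>+ x\<in>A. \<gamma> x * indicator D x \<partial>lborel)" if "A \<in> sets borel" for A
    using that unfolding \<nu>_def by (subst emeasure_density) auto
  have "N \<in> sets borel" using N by auto
  have "emeasure \<nu> N = (INF U \<in> {U. N \<subseteq> U \<and> open U}. emeasure \<nu> U)"
  proof (rule outer_regular)
    show "sets \<nu> = sets borel" by (simp add: \<nu>_def)
    have "emeasure \<nu> (space \<nu>) = (\<integral>\<^sup>+ x\<in>D. \<gamma> x \<partial>lborel)"
      by (simp add: \<nu>_def emeasure_density)
    then show "emeasure \<nu> (space \<nu>) \<noteq> \<infinity>" using fin by auto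
  qed fact
  moreover have "emeasure \<nu> N = 0"
  proof -
    have "absolutely_continuous lborel \<nu>"
      unfolding \<nu>_def by (intro absolutely_continuousI_density) measurable
    then show ?thesis using N(1) by (auto simp: absolutely_continuous_def)
  qed
  ultimately have "(INF U \<in> {U. N \<subseteq> U \<and> open U}. emeasure \<nu> U) < e" using e by simp
  then obtain V where V: "N \<subseteq> V" "open V" "emeasure \<nu> V < e"
    by (auto simp: INF_less_iff)
  show ?thesis
  proof (rule that[of "V \<inter> D"])
    have "(\<integral>\<^sup>+ x\<in>V \<inter> D. \<gamma> x \<partial>lborel) = emeasure \<nu> V"
      using V(2) by (subst \<nu>) (auto simp: indicator_def intro!: nn_integral_cong)
    with V(3) show "(\<integral>\<^sup>+ x\<in>V \<inter> D. \<gamma> x \<partial>lborel) < e" by simp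
  qed (use V N D in auto)
qed

abbreviation radius_sum :: "(real ^ 'n \<Rightarrow> real) \<Rightarrow> (real ^ 'n) set \<Rightarrow> ennreal" where
  "radius_sum R F \<equiv> \<Sum>y\<in>F. ennreal (R y powr (real CARD('n) - 1))"

text \<open>The hypothesis is used twice: with small radii it shows that \<open>S\<close> is Lebesgue null, and then
  \<open>U\<close> can be chosen with an arbitrarily small integral.\<close>

lemma hausdorff_content_codim1_null:
  fixes S D :: "(real ^ 'n) set" and \<gamma> :: "real ^ 'n \<Rightarrow> ennreal"
  assumes n: "CARD('n) \<ge> 2" and D: "open D" "S \<subseteq> D" and \<gamma>: "\<gamma> \<in> borel_measurable borel"
    and fin: "(\<integral>\<^sup>+ x\<in>D. \<gamma> x \<partial>lborel) < \<infinity>" and c: "0 < c"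
    and radii: "\<And>U \<eta> \<epsilon>. open U \<Longrightarrow> S \<subseteq> U \<Longrightarrow> U \<subseteq> D \<Longrightarrow> 0 < \<eta> \<Longrightarrow> 0 < \<epsilon> \<Longrightarrow>
      \<exists>R. (\<forall>y\<in>S. 0 < R y \<and> R y \<le> \<eta>) \<and>
        (\<forall>F. finite F \<longrightarrow> F \<subseteq> S \<longrightarrow> disjoint_family_on (\<lambda>y. cball y (R y)) F \<longrightarrow>
          radius_sum R F \<le> ennreal c * ((\<integral>\<^sup>+ x\<in>U. \<gamma> x \<partial>lborel) + ennreal \<epsilon>))"
  shows "hausdorff_content (real CARD('n) - 1) S = 0"
proof -
  let ?b = "real CARD('n) - 1"
  have b: "0 < ?b" using n by simp
  obtain X where X: "(\<integral>\<^sup>+ x\<in>D. \<gamma> x \<partial>lborel) = ennreal X" "0 \<le> X"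
    using fin by (cases "\<integral>\<^sup>+ x\<in>D. \<gamma> x \<partial>lborel") auto
  define A where "A = unit_ball_vol (real CARD('n)) * 6 powr real CARD('n)"
  have A: "0 < A" by (simp add: A_def)
  have null_n: "hausdorff_content (real CARD('n)) S \<le> 0 + ennreal e" if e: "0 < e" for e
  proof -
    \<comment> \<open>Radii at most \<eta> give R^n \<le> \<eta> R^(n-1), so the n-dimensional
      content is at most \<eta> A c (X + 1), where X + 1 comes from applying the hypothesis with U =
      D and \<epsilon> = 1. This \<eta> makes the bound equal to e.\<close>
    define \<eta> where "\<eta> = e / (A * c * (X + 1))"
    have \<eta>: "0 < \<eta>" using e A c X by (simp add: \<eta>_def)
    obtain R where R: "\<forall>y\<in>S. 0 < R y \<and> R y \<le> \<eta>" and sum_R: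
        "\<And>F. finite F \<Longrightarrow> F \<subseteq> S \<Longrightarrow> disjoint_family_on (\<lambda>y. cball y (R y)) F \<Longrightarrow>
          radius_sum R F \<le> ennreal c * ((\<integral>\<^sup>+ x\<in>D. \<gamma> x \<partial>lborel) + ennreal 1)"
      using radii[OF D(1,2) order_refl \<eta> zero_less_one] by blast
    have "hausdorff_content (real CARD('n)) S \<le> ennreal A * ennreal (\<eta> * c * (X + 1))"
      unfolding A_def
    proof (rule hausdorff_content_le_disjoint_balls[where R = R and B = \<eta>])
      show "0 < real CARD('n)" using n by simp
      fix F assume F: "finite F" "F \<subseteq> S" "disjoint_family_on (\<lambda>y. cball y (R y)) F"
      have "(\<Sum>y\<in>F. ennreal (R y powr real CARD('n))) \<le> (\<Sum>y\<in>F. ennreal \<eta> * ennreal (R y powr ?b))"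
      proof (rule sum_mono)
        fix y assume "y \<in> F"
        then have y: "0 < R y" "R y \<le> \<eta>" using F R by auto
        have "R y powr real CARD('n) = R y * R y powr ?b"
          using y(1) by (simp add: powr_mult_base)
        also have "\<dots> \<le> \<eta> * R y powr ?b" using y by (intro mult_right_mono) auto
        finally show "ennreal (R y powr real CARD('n)) \<le> ennreal \<eta> * ennreal (R y powr ?b)"
          using \<eta> by (simp add: ennreal_mult[symmetric] ennreal_leI)
      qed
      also have "\<dots> \<le> ennreal \<eta> * (ennreal c * (ennreal X + ennreal 1))"
        unfolding sum_distrib_left[symmetric] using sum_R[OF F] X(1) by (intro mult_left_mono) auto
      also have "\<dots> = ennreal (\<eta> * c * (X + 1))"
      proof -
        have "ennreal X + ennreal 1 = ennreal (X + 1)"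
          using X(2) by (intro ennreal_plus[symmetric]) auto
        then show ?thesis
          using \<eta> c X(2) by (simp only: ennreal_mult[symmetric] mult.assoc) (simp add: ennreal_mult[symmetric])
      qed
      finally show "(\<Sum>y\<in>F. ennreal (R y powr real CARD('n))) \<le> ennreal (\<eta> * c * (X + 1))" .
    qed (use R in auto)
    also have "\<dots> = ennreal e"
    proof -
      have "A * (\<eta> * c * (X + 1)) = e"
        using A c X(2) by (simp add: \<eta>_def)
      then show ?thesis using A c X(2) \<eta> by (subst ennreal_mult[symmetric]) auto
    qed
    finally show ?thesis by simp
  qed
  have "hausdorff_content (real CARD('n)) S \<le> 0"
    by (rule ennreal_le_epsilon) (rule null_n)
  then have "hausdorff_content (real CARD('n)) S = 0" by simp
  then obtain N where N: "N \<in> null_sets lborel" "S \<subseteq> N"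
    by (rule null_set_if_hausdorff_content_0)
  define B where "B = unit_ball_vol ?b * 6 powr ?b"
  have B: "0 < B" using b by (simp add: B_def)
  have null_b: "hausdorff_content ?b S \<le> 0 + ennreal e" if e: "0 < e" for e
  proof -
    \<comment> \<open>The content will be at most B c (\<epsilon> + \<epsilon>), one \<epsilon> from
      the integral over U and one from the hypothesis on the radii.\<close>
    define \<epsilon> where "\<epsilon> = e / (2 * B * c)"
    have \<epsilon>: "0 < \<epsilon>" using e B c by (simp add: \<epsilon>_def)
    obtain U where U: "open U" "S \<subseteq> U" "U \<subseteq> D" "(\<integral>\<^sup>+ x\<in>U. \<gamma> x \<partial>lborel) < ennreal \<epsilon>"
      using open_superset_small_integral[OF N D \<gamma> fin, of "ennreal \<epsilon>"] \<epsilon> by auto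
    obtain R where R: "\<forall>y\<in>S. 0 < R y \<and> R y \<le> 1" and sum_R:
        "\<And>F. finite F \<Longrightarrow> F \<subseteq> S \<Longrightarrow> disjoint_family_on (\<lambda>y. cball y (R y)) F \<Longrightarrow>
          radius_sum R F \<le> ennreal c * ((\<integral>\<^sup>+ x\<in>U. \<gamma> x \<partial>lborel) + ennreal \<epsilon>)"
      using radii[OF U(1-3) zero_less_one \<epsilon>] by blast
    have "hausdorff_content ?b S \<le> ennreal B * (ennreal c * ((\<integral>\<^sup>+ x\<in>U. \<gamma> x \<partial>lborel) + ennreal \<epsilon>))"
      unfolding B_def
      by (rule hausdorff_content_le_disjoint_balls[where R = R and B = 1, OF b]) (use R sum_R in auto)
    also have "\<dots> \<le> ennreal B * (ennreal c * (ennreal \<epsilon> + ennreal \<epsilon>))"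
      using U(4) by (intro mult_left_mono add_right_mono) auto
    also have "\<dots> = ennreal e"
    proof -
      have "ennreal \<epsilon> + ennreal \<epsilon> = ennreal (2 * \<epsilon>)"
        using \<epsilon> by (subst ennreal_plus[symmetric]) auto
      moreover have "B * (c * (2 * \<epsilon>)) = e"
        using B c by (simp add: \<epsilon>_def)
      ultimately show ?thesis using B c \<epsilon> by (simp only: ennreal_mult[symmetric])
          (metis ennreal_mult less_imp_le mult_pos_pos zero_less_numeral)
    qed
    finally show ?thesis by simp
  qed
  have "hausdorff_content ?b S \<le> 0"
    by (rule ennreal_le_epsilon) (rule null_b)
  then show ?thesis by simp
qed

subsection \<open>Sets of finite perimeter at points of intermediate density\<close>

text \<open>Halve the scale, starting from \<open>s0\<close>, until the density first reaches
  2^-(n+1). One scale earlier the density was below that value. Since f is monotone, halving the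
  scale can multiply the density by at most 2^n, so it is still at most 1/2. Starting immediately is
  covered by \<open>upper\<close>. No continuity of f is used.\<close>

lemma exists_intermediate_density_scale:
  fixes f :: "real \<Rightarrow> real" and n :: nat
  assumes mono: "\<And>s s'. 0 < s \<Longrightarrow> s \<le> s' \<Longrightarrow> s' \<le> s0 \<Longrightarrow> f s \<le> f s'"
    and s: "0 < s1" "s1 \<le> s0" and V: "0 < V"
    and upper: "f s0 \<le> V * s0 ^ n / 2" and lower: "V * s1 ^ n / 2 \<le> f s1"
  shows "\<exists>s. 0 < s \<and> s \<le> s0 \<and> (1 / 2) ^ Suc n * (V * s ^ n) \<le> f s \<and> f s \<le> V * s ^ n / 2"
proof -
  define \<sigma> where "\<sigma> j = s0 * (1 / 2) ^ j" for j :: nat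
  have s0: "0 < s0" using s by simp
  have \<sigma>: "0 < \<sigma> j" "\<sigma> j \<le> s0" "\<sigma> (Suc j) = \<sigma> j / 2" for j
    using s0 power_le_one[of "1 / 2 :: real" j] by (auto simp: \<sigma>_def)
  define P where "P j \<longleftrightarrow> (1 / 2) ^ Suc n * (V * \<sigma> j ^ n) \<le> f (\<sigma> j)" for j
  have "\<exists>k. P k"
  proof -
    have "\<exists>k. \<sigma> (Suc k) < s1"
    proof -
      obtain k where "(1 / 2 :: real) ^ k < s1 / s0"
        using real_arch_pow_inv[of "s1 / s0" "1 / 2"] s s0 by auto
      then have "\<sigma> k < s1" using s0 by (simp add: \<sigma>_def field_simps)
      then have "\<sigma> (Suc k) < s1" using \<sigma>(1)[of k] by (simp add: \<sigma>(3))
      then show ?thesis by blast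
    qed
    then obtain k where k: "\<sigma> (Suc k) < s1" "\<And>i. i < k \<Longrightarrow> \<not> \<sigma> (Suc i) < s1"
      by (meson exists_least_iff)
    \<comment> \<open>This dyadic scale satisfies s1 \<le> \<sigma> k < 2 s1, so density 1/2 at
      \<open>s1\<close> leaves density at least 2^-(n+1) at \<sigma> k.\<close>
    have "s1 \<le> \<sigma> k"
      using k(2)[of "k - 1"] s(2) by (cases k) (auto simp: \<sigma>_def)
    have "(1 / 2) ^ Suc n * (V * \<sigma> k ^ n) = V * \<sigma> (Suc k) ^ n / 2"
      by (simp add: \<sigma>(3) power_divide)
    also have "\<dots> \<le> V * s1 ^ n / 2"
      using k(1) V \<sigma>(1)[of "Suc k"] by (intro divide_right_mono mult_left_mono power_mono) auto
    also have "\<dots> \<le> f s1" by (rule lower)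
    also have "\<dots> \<le> f (\<sigma> k)" using s \<sigma> \<open>s1 \<le> \<sigma> k\<close> by (intro mono) auto
    finally show ?thesis unfolding P_def by blast
  qed
  then obtain j where j: "P j" "\<And>i. i < j \<Longrightarrow> \<not> P i"
    by (meson exists_least_iff)
  have "f (\<sigma> j) \<le> V * \<sigma> j ^ n / 2"
  proof (cases j)
    case 0
    then show ?thesis using upper by (simp add: \<sigma>_def)
  next
    case (Suc i)
    have "f (\<sigma> j) \<le> f (\<sigma> i)" using \<sigma>[of i] \<sigma>(1)[of j] by (intro mono) (auto simp: Suc \<sigma>(3))
    also have "\<dots> \<le> (1 / 2) ^ Suc n * (V * \<sigma> i ^ n)"
      using j(2)[of i] Suc by (simp add: P_def)
    also have "\<dots> = V * \<sigma> j ^ n / 2"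
      by (simp add: Suc \<sigma>(3) power_divide)
    finally show ?thesis .
  qed
  then show ?thesis using j(1) \<sigma>[of j] unfolding P_def by blast
qed

text \<open>The upper bound leaves at least half of D outside E, so both factors in the
  isoperimetric inequality are comparable to the measure of D.\<close>

definition intermediate_density :: "real \<Rightarrow> 'a::euclidean_space set \<Rightarrow> 'a set \<Rightarrow> bool" where
  "intermediate_density \<theta> E D \<longleftrightarrow> \<theta> * measure lborel D \<le> measure lborel (D \<inter> E) \<and>
     measure lborel (D \<inter> E) \<le> measure lborel D / 2"

text \<open>The isoperimetric product is at least \<theta> \<kappa>^2 R^(2n) / 2, and it is at most
  (6 R)^(n+1) times the energy. Dividing leaves R^(n-1). The bound holds for every h \<le> R, before
  any limit.\<close>

lemma radius_power_le_increment_energy: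
  fixes D :: "(real ^ 'n) set"
  assumes E: "E \<in> sets borel" and D: "open D" "convex D" "D \<subseteq> cball y R"
    and R: "0 < R" and \<kappa>: "0 < \<kappa>" "\<kappa> * R ^ CARD('n) \<le> measure lborel D"
    and \<theta>: "0 < \<theta>" "intermediate_density \<theta> E D" and h: "0 < h" "h \<le> R"
  shows "ennreal (\<theta> * \<kappa>\<^sup>2 / (2 * 6 ^ Suc CARD('n)) * R powr (real CARD('n) - 1)) \<le> increment_energy (indicator E) D h"
proof -
  let ?n = "CARD('n)"
  have [measurable]: "E \<in> sets borel" "D \<in> sets borel" using E D by auto
  have fin: "emeasure lborel D < \<infinity>"
  proof -
    have "emeasure lborel D \<le> emeasure lborel (cball y R)"
      using D by (intro emeasure_mono) auto
    also have "\<dots> < \<infinity>" using R by (simp add: emeasure_cball)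
    finally show ?thesis .
  qed
  have fins: "emeasure lborel (D \<inter> E) \<noteq> \<infinity>" "emeasure lborel (D - E) \<noteq> \<infinity>"
  proof -
    have "emeasure lborel (D \<inter> E) \<le> emeasure lborel D" "emeasure lborel (D - E) \<le> emeasure lborel D"
      by (intro emeasure_mono; auto)+
    with fin show "emeasure lborel (D \<inter> E) \<noteq> \<infinity>" "emeasure lborel (D - E) \<noteq> \<infinity>" by auto
  qed
  let ?m = "measure lborel D"
  have m: "0 \<le> ?m" "\<kappa> * R ^ ?n \<le> ?m" by (auto simp: \<kappa>)
  have diff: "measure lborel (D - E) = ?m - measure lborel (D \<inter> E)"
  proof -
    have "measure lborel D = measure lborel ((D \<inter> E) \<union> (D - E))" by (intro arg_cong[where f = "measure lborel"]) auto
    also have "\<dots> = measure lborel (D \<inter> E) + measure lborel (D - E)"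
      using fins by (intro measure_Union) auto
    finally show ?thesis by simp
  qed
  have "(\<theta> * ?m) * (?m / 2) \<le> measure lborel (D \<inter> E) * measure lborel (D - E)"
    using \<theta> unfolding intermediate_density_def diff by (intro mult_mono) auto
  moreover have "\<theta> * \<kappa>\<^sup>2 / 2 * (R ^ ?n * R ^ ?n) \<le> (\<theta> * ?m) * (?m / 2)"
  proof -
    have "(\<kappa> * R ^ ?n) * (\<kappa> * R ^ ?n) \<le> ?m * ?m"
      using m \<kappa> R by (intro mult_mono) auto
    then have "\<theta> / 2 * ((\<kappa> * R ^ ?n) * (\<kappa> * R ^ ?n)) \<le> \<theta> / 2 * (?m * ?m)"
      using \<theta> by (intro mult_left_mono) auto
    then show ?thesis by (simp add: power2_eq_square algebra_simps)
  qed
  ultimately have "\<theta> * \<kappa>\<^sup>2 / 2 * (R ^ ?n * R ^ ?n) \<le> measure lborel (D \<inter> E) * measure lborel (D - E)"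
    by linarith
  then have "ennreal (\<theta> * \<kappa>\<^sup>2 / 2 * (R ^ ?n * R ^ ?n)) \<le> emeasure lborel (D \<inter> E) * emeasure lborel (D - E)"
    using fins by (simp add: emeasure_eq_ennreal_measure ennreal_mult[symmetric] ennreal_leI)
  \<comment> \<open>The isoperimetric lemma asks for a strict bound on distances. In a closed ball
    of radius R they are at most 2 R, so d = 3 R is a safe choice.\<close>
  also have "\<dots> \<le> ennreal ((2 * (3 * R)) ^ Suc DIM(real ^ 'n)) * increment_energy (indicator E) D h"
  proof (rule isoperimetric_increment_energy[OF E D(1,2)])
    fix x z assume "x \<in> D" "z \<in> D"
    then have "dist y x \<le> R" "dist y z \<le> R" using D(3) by auto
    then have "dist x z \<le> 2 * R" using dist_triangle3[of x z y] by simp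
    then show "dist x z < 3 * R" using R by simp
  qed (use h R in auto)
  finally have le: "ennreal (\<theta> * \<kappa>\<^sup>2 / 2 * (R ^ ?n * R ^ ?n)) \<le> ennreal ((6 * R) ^ Suc ?n) * increment_energy (indicator E) D h"
    by simp
  let ?A = "(6 * R) ^ Suc ?n"
  have A: "0 < ?A" using R by simp
  have "ennreal (1 / ?A) * ennreal (\<theta> * \<kappa>\<^sup>2 / 2 * (R ^ ?n * R ^ ?n)) \<le>
      ennreal (1 / ?A) * (ennreal ?A * increment_energy (indicator E) D h)"
    by (rule mult_left_mono[OF le]) simp
  also have "\<dots> = (ennreal (1 / ?A) * ennreal ?A) * increment_energy (indicator E) D h"
    by (simp add: mult.assoc)
  also have "ennreal (1 / ?A) * ennreal ?A = 1"
    using A by (subst ennreal_mult[symmetric]) auto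
  also have "ennreal (1 / ?A) * ennreal (\<theta> * \<kappa>\<^sup>2 / 2 * (R ^ ?n * R ^ ?n)) =
      ennreal (1 / ?A * (\<theta> * \<kappa>\<^sup>2 / 2 * (R ^ ?n * R ^ ?n)))"
    using A \<theta> \<kappa> R by (intro ennreal_mult[symmetric]) auto
  also have "1 / ?A * (\<theta> * \<kappa>\<^sup>2 / 2 * (R ^ ?n * R ^ ?n)) = \<theta> * \<kappa>\<^sup>2 / (2 * 6 ^ Suc ?n) * R powr (real ?n - 1)"
  proof -
    have "R powr (real ?n - 1) = R ^ ?n / R"
      using R by (simp add: powr_diff powr_realpow)
    then show ?thesis using R by (simp add: power_mult_distrib divide_simps)
  qed
  finally show ?thesis by simp
qed

text \<open>As F is finite, all h below the smallest radius are admissible for every set at once.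
  The single estimates are added by superadditivity at such an h, and the sum, which does not depend
  on h, bounds the lower limit from below.\<close>

lemma sum_radius_power_le_perimeter:
  fixes D :: "real ^ 'n \<Rightarrow> (real ^ 'n) set"
  assumes E: "E \<in> sets borel" and U: "open U" and F: "finite F"
    and disj: "disjoint_family_on (\<lambda>y. cball y (R y)) F"
    and D: "\<And>y. y \<in> F \<Longrightarrow> open (D y)" "\<And>y. y \<in> F \<Longrightarrow> convex (D y)"
      "\<And>y. y \<in> F \<Longrightarrow> D y \<subseteq> cball y (R y)" "\<And>y. y \<in> F \<Longrightarrow> D y \<subseteq> U"
    and R: "\<And>y. y \<in> F \<Longrightarrow> 0 < R y"
    and \<kappa>: "0 < \<kappa>" "\<And>y. y \<in> F \<Longrightarrow> \<kappa> * R y ^ CARD('n) \<le> measure lborel (D y)"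
    and \<theta>: "0 < \<theta>" "\<And>y. y \<in> F \<Longrightarrow> intermediate_density \<theta> E (D y)"
  shows "radius_sum R F \<le>
    ennreal (2 * 6 ^ Suc CARD('n) / (\<theta> * \<kappa>\<^sup>2)) * perimeter E U"
proof -
  let ?c = "\<theta> * \<kappa>\<^sup>2 / (2 * 6 ^ Suc CARD('n))"
  have c: "0 < ?c" using \<theta> \<kappa> by simp
  have "ennreal ?c * radius_sum R F \<le> perimeter E U"
    unfolding perimeter_def
  proof (rule Liminf_bounded)
    have "eventually (\<lambda>k. \<forall>y\<in>F. inverse (real (Suc k)) < R y) sequentially"
      using F R LIMSEQ_inverse_real_of_nat
      by (intro eventually_ball_finite ballI order_tendstoD(2)) auto
    then show "eventually (\<lambda>k. ennreal ?c * radius_sum R F \<le>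
        increment_energy (indicator E) U (inverse (real (Suc k)))) sequentially"
    proof eventually_elim
      case (elim k)
      have "ennreal ?c * radius_sum R F =
          (\<Sum>y\<in>F. ennreal (?c * R y powr (real CARD('n) - 1)))"
        unfolding sum_distrib_left using c by (intro sum.cong refl ennreal_mult[symmetric]) auto
      also have "\<dots> \<le> (\<Sum>y\<in>F. increment_energy (indicator E) (D y) (inverse (real (Suc k))))"
        using elim by (intro sum_mono radius_power_le_increment_energy[OF E D(1-3) R \<kappa>(1,2) \<theta>(1,2)]) (auto intro: less_imp_le)
      also have "\<dots> \<le> increment_energy (indicator E) U (inverse (real (Suc k)))"
      proof (rule increment_energy_superadditive)
        show "disjoint_family_on D F"
          using disj D(3) unfolding disjoint_family_on_def by blast
      qed (use E U F D in auto)
      finally show ?case .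
    qed
  qed
  then have "ennreal (1 / ?c) * (ennreal ?c * radius_sum R F) \<le> ennreal (1 / ?c) * perimeter E U"
    by (rule mult_left_mono) simp
  moreover have "ennreal (1 / ?c) * ennreal ?c = 1"
    using \<theta>(1) \<kappa>(1) by (subst ennreal_mult[symmetric]) auto
  ultimately show ?thesis by (simp add: mult.assoc[symmetric])
qed

section \<open>Points of full density and homothetic copies\<close>

definition full_density :: "'a::euclidean_space set \<Rightarrow> 'a \<Rightarrow> bool" where
  "full_density E y \<longleftrightarrow> ((\<lambda>r. measure lborel (ball y r - E) / r ^ DIM('a)) \<longlongrightarrow> 0) (at_right 0)"

text \<open>The homothety with centre y and ratio s. For y in a convex D these copies increase with
  s and end at D itself, so they can replace balls at points y near the boundary.\<close>

definition shrink :: "'a::real_vector set \<Rightarrow> 'a \<Rightarrow> real \<Rightarrow> 'a set" where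
  "shrink D y s = (\<lambda>x. (1 - s) *\<^sub>R y + s *\<^sub>R x) ` D"

lemma shrink_properties:
  fixes D :: "'a::euclidean_space set"
  assumes D: "open D" "convex D" "y \<in> D" and s: "0 < s"
  shows "open (shrink D y s)" "convex (shrink D y s)"
    and "s \<le> s' \<Longrightarrow> shrink D y s \<subseteq> shrink D y s'"
    and "shrink D y 1 = D"
    and "measure lborel (shrink D y s) = s ^ DIM('a) * measure lborel D"
    and "D \<subseteq> ball y \<rho> \<Longrightarrow> shrink D y s \<subseteq> ball y (s * \<rho>)"
proof -
  have eq: "shrink D y s = (+) ((1 - s) *\<^sub>R y) ` ((*\<^sub>R) s ` D)"
    by (auto simp: shrink_def image_image)
  show "open (shrink D y s)"
    unfolding eq using D s by (intro open_translation open_scaling) auto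
  show "convex (shrink D y s)"
    unfolding eq using D by (intro convex_translation convex_scaling)
  show "shrink D y 1 = D" by (simp add: shrink_def)
  show "shrink D y s \<subseteq> shrink D y s'" if "s \<le> s'"
  proof
    fix z assume "z \<in> shrink D y s"
    then obtain x where x: "x \<in> D" "z = (1 - s) *\<^sub>R y + s *\<^sub>R x" by (auto simp: shrink_def)
    \<comment> \<open>A homothety of ratio s is one of ratio s' after one of ratio s/s', and the
      latter maps D into itself by convexity.\<close>
    have "(1 - s / s') *\<^sub>R y + (s / s') *\<^sub>R x \<in> D"
      using D(2,3) x(1) s that by (intro convexD) auto
    moreover have "(1 - s') *\<^sub>R y + s' *\<^sub>R ((1 - s / s') *\<^sub>R y + (s / s') *\<^sub>R x) = z"
      using s that by (simp add: x algebra_simps)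
    ultimately show "z \<in> shrink D y s'" by (force simp: shrink_def)
  qed
  show "measure lborel (shrink D y s) = s ^ DIM('a) * measure lborel D"
  proof -
    have [measurable]: "D \<in> sets borel" "shrink D y s \<in> sets borel"
      using D(1) \<open>open (shrink D y s)\<close> by auto
    have mem: "(1 - s) *\<^sub>R y + s *\<^sub>R x \<in> shrink D y s \<longleftrightarrow> x \<in> D" for x
      using s by (auto simp: shrink_def)
    have "emeasure lborel (shrink D y s) = (\<integral>\<^sup>+ x. indicator (shrink D y s) x \<partial>lborel)"
      by simp
    also have "\<dots> = ennreal (\<bar>s\<bar> ^ DIM('a)) * (\<integral>\<^sup>+ x. indicator (shrink D y s) ((1 - s) *\<^sub>R y + s *\<^sub>R x) \<partial>lborel)"
      using s by (intro nn_integral_lborel_affine) auto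
    also have "(\<integral>\<^sup>+ x. indicator (shrink D y s) ((1 - s) *\<^sub>R y + s *\<^sub>R x) \<partial>lborel) = (\<integral>\<^sup>+ x. indicator D x \<partial>lborel)"
      by (intro nn_integral_cong) (simp add: indicator_def mem)
    finally show ?thesis using s by (simp add: measure_def enn2real_mult)
  qed
  show "shrink D y s \<subseteq> ball y (s * \<rho>)" if "D \<subseteq> ball y \<rho>"
  proof
    fix z assume "z \<in> shrink D y s"
    then obtain x where x: "x \<in> D" "z = (1 - s) *\<^sub>R y + s *\<^sub>R x" by (auto simp: shrink_def)
    have "y - z = s *\<^sub>R (y - x)" by (simp add: x algebra_simps)
    then have "dist y z = s * dist y x" using s by (simp add: dist_norm)
    moreover have "dist y x < \<rho>" using that x(1) by auto
    ultimately show "z \<in> ball y (s * \<rho>)" using s by simp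
  qed
qed

text \<open>Along the copies \<open>shrink D y s\<close> the density of E is at most 1/2 at s = 1,
  by \<open>half\<close>, and at least 1/2 for small s, by full density, so an intermediate scale
  exists for each y. The balls of radius \<open>s y * \<rho>\<close> around y contain these copies
  and have comparable volume, which makes the Vitali argument applicable.\<close>

lemma content_full_density_le_perimeter:
  fixes D :: "(real ^ 'n) set"
  assumes n: "CARD('n) \<ge> 2" and E: "E \<in> sets borel"
    and D: "open D" "convex D" "ball x0 r \<subseteq> D" "D \<subseteq> ball x0 (K * r)" and r: "0 < r" and K: "1 \<le> K"
    and half: "measure lborel (D \<inter> E) \<le> measure lborel D / 2"
    and S: "S \<subseteq> D" "\<And>y. y \<in> S \<Longrightarrow> full_density E y"
    and \<kappa>: "\<kappa> = unit_ball_vol (real CARD('n)) / (2 * K) ^ CARD('n)"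
  shows "hausdorff_content (real CARD('n) - 1) S \<le>
    ennreal (unit_ball_vol (real CARD('n) - 1) * 6 powr (real CARD('n) - 1) *
      (2 * 6 ^ Suc CARD('n) / ((1 / 2) ^ Suc CARD('n) * \<kappa>\<^sup>2))) * perimeter E D"
proof -
  let ?n = "CARD('n)"
  \<comment> \<open>Two points of D are closer than 2 K r, so D lies in the ball of radius \<rho>
    around each of its points. In terms of \<rho> the inner ball has volume
    \<open>\<kappa> * \<rho> ^ CARD('n)\<close>, which is the origin of \<kappa>.\<close>
  define \<rho> where "\<rho> = 2 * K * r"
  define V where "V = measure lborel D"
  define \<theta> where "\<theta> = (1 / 2 :: real) ^ Suc ?n"
  have \<rho>: "0 < \<rho>" using r K by (simp add: \<rho>_def)
  have [measurable]: "D \<in> sets borel" "E \<in> sets borel" using D E by auto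
  have fmD: "D \<in> fmeasurable lborel"
  proof (rule fmeasurableI)
    have "emeasure lborel D \<le> emeasure lborel (ball x0 (K * r))"
      using D(4) by (intro emeasure_mono) auto
    also have "\<dots> < \<infinity>" using r K by (simp add: emeasure_ball)
    finally show "emeasure lborel D < \<infinity>" .
  qed simp
  have \<kappa>_pos: "0 < \<kappa>" using K by (simp add: \<kappa>)
  have V: "\<kappa> * \<rho> ^ ?n \<le> V" "0 < V"
  proof -
    have "\<kappa> * \<rho> ^ ?n = measure lborel (ball x0 r)"
      using r K by (simp add: \<kappa> \<rho>_def content_ball power_mult_distrib)
    also have "\<dots> \<le> V" unfolding V_def using D(3) fmD by (intro measure_mono_fmeasurable) auto
    finally show "\<kappa> * \<rho> ^ ?n \<le> V" .
    moreover have "0 < \<kappa> * \<rho> ^ ?n" using \<kappa>_pos \<rho> by simp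
    ultimately show "0 < V" by linarith
  qed
  have sub: "D \<subseteq> ball y \<rho>" if "y \<in> D" for y
  proof
    fix x assume "x \<in> D"
    then have "dist x0 x < K * r" "dist x0 y < K * r" using D(4) that by auto
    then show "x \<in> ball y \<rho>" using dist_triangle3[of y x x0] by (simp add: \<rho>_def)
  qed
  have "\<exists>s. 0 < s \<and> s \<le> 1 \<and> intermediate_density \<theta> E (shrink D y s)" if y: "y \<in> S" for y
  proof -
    have yD: "y \<in> D" using y S by blast
    note sh = shrink_properties[OF D(1,2) yD]
    have fm: "shrink D y s \<in> fmeasurable lborel" "shrink D y s \<inter> E \<in> fmeasurable lborel" if "0 < s" "s \<le> 1" for s
    proof -
      have "shrink D y s \<subseteq> D" using sh(3)[OF that] sh(4)[OF that(1)] by simp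
      moreover have "shrink D y s \<in> sets lborel" using sh(1)[OF that(1)] by simp
      ultimately show "shrink D y s \<in> fmeasurable lborel" using fmD by (auto intro: fmeasurableI2)
      then show "shrink D y s \<inter> E \<in> fmeasurable lborel" using E by (auto intro: fmeasurable_Int_fmeasurable fmeasurableI2)
    qed
    define f where "f s = measure lborel (shrink D y s \<inter> E)" for s
    have "((\<lambda>r. measure lborel (ball y r - E) / r ^ ?n) \<longlongrightarrow> 0) (at_right 0)"
      using S(2)[OF y] by (simp add: full_density_def)
    \<comment> \<open>With this threshold the part of the copy of ratio s outside E has measure at
      most V s^n / 2, half of the copy, as soon as s \<rho> is small.\<close>
    moreover have "0 < V / (2 * \<rho> ^ ?n)" using V \<rho> by simp
    ultimately have "eventually (\<lambda>r. measure lborel (ball y r - E) / r ^ ?n < V / (2 * \<rho> ^ ?n)) (at_right 0)"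
      by (rule order_tendstoD(2))
    then obtain b where b: "0 < b" "\<And>r. 0 < r \<Longrightarrow> r < b \<Longrightarrow> measure lborel (ball y r - E) / r ^ ?n < V / (2 * \<rho> ^ ?n)"
      by (auto simp: eventually_at_right_field)
    \<comment> \<open>The factor 2 makes \<open>s1 * \<rho>\<close> strictly smaller than b.\<close>
    define s1 where "s1 = min 1 (b / (2 * \<rho>))"
    have s1: "0 < s1" "s1 \<le> 1" "s1 * \<rho> < b"
      using b(1) \<rho> by (auto simp: s1_def min_def field_simps)
    have "V * s1 ^ ?n / 2 \<le> f s1"
    proof -
      have "measure lborel (shrink D y s1 - E) \<le> measure lborel (ball y (s1 * \<rho>) - E)"
      proof (rule measure_mono_fmeasurable)
        show "ball y (s1 * \<rho>) - E \<in> fmeasurable lborel"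
          using E s1 \<rho> by (intro fmeasurable_Diff) (auto simp: fmeasurable_def emeasure_ball)
        show "shrink D y s1 - E \<in> sets lborel" using sh(1)[OF s1(1)] E by auto
      qed (use sh(6)[OF s1(1) sub[OF yD]] in auto)
      also have "\<dots> \<le> V / (2 * \<rho> ^ ?n) * (s1 * \<rho>) ^ ?n"
        using b(2)[of "s1 * \<rho>"] s1 \<rho> by (simp add: pos_divide_less_eq less_imp_le)
      also have "\<dots> = V * s1 ^ ?n / 2"
        using \<rho> by (simp add: power_mult_distrib)
      finally have "measure lborel (shrink D y s1 - E) \<le> V * s1 ^ ?n / 2" .
      moreover have "measure lborel (shrink D y s1) = measure lborel (shrink D y s1 \<inter> E) + measure lborel (shrink D y s1 - E)"
      proof -
        have "shrink D y s1 - E = shrink D y s1 - (shrink D y s1 \<inter> E)" by auto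
        then show ?thesis
          using fm[OF s1(1,2)] by (simp add: measurable_measure_Diff)
      qed
      moreover have "measure lborel (shrink D y s1) = s1 ^ ?n * V"
        using sh(5)[OF s1(1)] by (simp add: V_def)
      ultimately show ?thesis by (simp add: f_def mult.commute)
    qed
    moreover have "f 1 \<le> V * 1 ^ ?n / 2"
      using half sh(4)[OF zero_less_one] by (simp add: f_def V_def)
    moreover have "f s \<le> f s'" if "0 < s" "s \<le> s'" "s' \<le> 1" for s s'
      unfolding f_def using sh(3)[OF that(1,2)] fm[of s] fm[of s'] that
      by (intro measure_mono_fmeasurable) auto
    ultimately obtain s where s: "0 < s" "s \<le> 1" "\<theta> * (V * s ^ ?n) \<le> f s" "f s \<le> V * s ^ ?n / 2"
      using exists_intermediate_density_scale[of 1 f s1 V ?n] s1 V unfolding \<theta>_def by blast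
    then have "intermediate_density \<theta> E (shrink D y s)"
      using sh(5)[OF s(1)] by (simp add: intermediate_density_def f_def V_def mult.commute)
    with s show ?thesis by blast
  qed
  then obtain s where s: "\<And>y. y \<in> S \<Longrightarrow> 0 < s y \<and> s y \<le> 1 \<and> intermediate_density \<theta> E (shrink D y (s y))"
    by metis
  have "hausdorff_content (real ?n - 1) S \<le> ennreal (unit_ball_vol (real ?n - 1) * 6 powr (real ?n - 1)) *
     (ennreal (2 * 6 ^ Suc ?n / (\<theta> * \<kappa>\<^sup>2)) * perimeter E D)"
  proof (rule hausdorff_content_le_disjoint_balls[where R = "\<lambda>y. s y * \<rho>" and B = \<rho>])
    show "0 < real ?n - 1" using n by simp
    show "0 < s y * \<rho> \<and> s y * \<rho> \<le> \<rho>" if "y \<in> S" for y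
      using s[OF that] \<rho> by simp
    fix F assume F: "finite F" "F \<subseteq> S" "disjoint_family_on (\<lambda>y. cball y (s y * \<rho>)) F"
    show "(\<Sum>y\<in>F. ennreal ((s y * \<rho>) powr (real ?n - 1))) \<le> ennreal (2 * 6 ^ Suc ?n / (\<theta> * \<kappa>\<^sup>2)) * perimeter E D"
    proof (rule sum_radius_power_le_perimeter[where D = "\<lambda>y. shrink D y (s y)" and \<theta> = \<theta> and \<kappa> = \<kappa>, OF E D(1) F(1,3)])
      fix y assume "y \<in> F"
      then have y: "y \<in> D" "y \<in> S" using F(2) S(1) by auto
      note sh = shrink_properties[OF D(1,2) y(1)]
      have sy: "0 < s y" "s y \<le> 1" using s[OF y(2)] by auto
      show "open (shrink D y (s y))" "convex (shrink D y (s y))" by (fact sh(1,2)[OF sy(1)])+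
      show "shrink D y (s y) \<subseteq> cball y (s y * \<rho>)"
        using sh(6)[OF sy(1) sub[OF y(1)]] by (meson ball_subset_cball order_trans)
      show "shrink D y (s y) \<subseteq> D"
        using sh(3)[OF sy] sh(4)[OF sy(1)] by simp
      show "0 < s y * \<rho>" using sy \<rho> by simp
      have "\<kappa> * (s y * \<rho>) ^ ?n = s y ^ ?n * (\<kappa> * \<rho> ^ ?n)"
        by (simp add: power_mult_distrib)
      also have "\<dots> \<le> s y ^ ?n * V" using V(1) sy by (intro mult_left_mono) auto
      finally show "\<kappa> * (s y * \<rho>) ^ ?n \<le> measure lborel (shrink D y (s y))"
        using sh(5)[OF sy(1)] by (simp add: V_def)
      show "intermediate_density \<theta> E (shrink D y (s y))" using s[OF y(2)] by blast
    qed (use \<kappa>_pos in \<open>auto simp: \<theta>_def\<close>)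
  qed
  also have "\<dots> = ennreal (unit_ball_vol (real ?n - 1) * 6 powr (real ?n - 1) * (2 * 6 ^ Suc ?n / (\<theta> * \<kappa>\<^sup>2))) * perimeter E D"
    using n \<kappa>_pos by (subst ennreal_mult) (auto simp: \<theta>_def mult.assoc)
  finally show ?thesis unfolding \<theta>_def .
qed

subsection \<open>Points without a Lebesgue value\<close>

lemma unit_ball_vol_nonzero [simp]: "0 \<le> x \<Longrightarrow> unit_ball_vol x \<noteq> 0"
  using unit_ball_vol_pos[of x] by linarith

text \<open>Of the Sobolev function only the bound of increments by an energy density survives, on
  every open subset of D. This property is invariant under u -> -u, which reduces lower level sets
  to upper ones.\<close>

locale increment_bounded =
  fixes D :: "(real ^ 'n) set" and u :: "real ^ 'n \<Rightarrow> real" and \<gamma> :: "real ^ 'n \<Rightarrow> ennreal"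
  assumes dim: "CARD('n) \<ge> 2"
    and D_open: "open D"
    and u_borel [measurable]: "u \<in> borel_measurable borel"
    and \<gamma>_borel [measurable]: "\<gamma> \<in> borel_measurable borel"
    and finite_energy: "(\<integral>\<^sup>+ x\<in>D. \<gamma> x \<partial>lborel) < \<infinity>"
    and u_integrable: "\<And>K. compact K \<Longrightarrow> K \<subseteq> D \<Longrightarrow> integrable lborel (\<lambda>x. indicator K x * u x)"
    and increment: "\<And>U w. open U \<Longrightarrow> U \<subseteq> D \<Longrightarrow>
      total_increment u U w \<le> ennreal (norm w) * (\<integral>\<^sup>+ x\<in>U. \<gamma> x \<partial>lborel)"
begin

abbreviation energy :: "(real ^ 'n) set \<Rightarrow> ennreal" where
  "energy U \<equiv> \<integral>\<^sup>+ x\<in>U. \<gamma> x \<partial>lborel"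

lemma uminus: "increment_bounded D (\<lambda>x. - u x) \<gamma>"
proof
  show "total_increment (\<lambda>x. - u x) U w \<le> ennreal (norm w) * energy U"
    if "open U" "U \<subseteq> D" for U w
    using increment[OF that, of w] by (simp add: total_increment_def abs_minus_commute)
  show "integrable lborel (\<lambda>x. indicator K x * - u x)" if "compact K" "K \<subseteq> D" for K
    using u_integrable[OF that] by simp
qed (use dim D_open finite_energy in auto)

text \<open>Otherwise the perimeter exceeds the stated bound on the whole interval, and integrating
  over it contradicts the coarea inequality. The positive \<epsilon> yields the contradiction even
  for energy zero, and finiteness of the energy allows the cancellation.\<close>

lemma exists_level_small_perimeter:
  assumes U: "open U" "U \<subseteq> D" and ab: "a < b" and \<epsilon>: "0 < \<epsilon>"
  obtains (level) t where "a < t" "t < b"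
    "perimeter {x. t < u x} U \<le> ennreal (unit_ball_vol (real CARD('n)) / (b - a)) * (energy U + ennreal \<epsilon>)"
proof (rule ccontr)
  assume "\<not> thesis"
  let ?X = "energy U"
  let ?K = "ennreal (unit_ball_vol (real CARD('n)) / (b - a)) * (?X + ennreal \<epsilon>)"
  have K: "?K \<le> perimeter {x. t < u x} U" if t: "a < t" "t < b" for t
  proof (rule ccontr)
    assume "\<not> ?K \<le> perimeter {x. t < u x} U"
    then have "perimeter {x. t < u x} U \<le> ?K" by simp
    with t have thesis by (rule level)
    with \<open>\<not> thesis\<close> show False by simp
  qed
  have "?X \<le> energy D"
    using U by (intro nn_integral_mono) (auto simp: indicator_def)
  then have fin: "?X < \<infinity>" using finite_energy by (rule order_le_less_trans)
  have "?X * ennreal (unit_ball_vol (real CARD('n))) + ennreal \<epsilon> * ennreal (unit_ball_vol (real CARD('n))) = ?K * ennreal (b - a)"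
  proof -
    have "?K * ennreal (b - a) = (ennreal (unit_ball_vol (real CARD('n)) / (b - a)) * ennreal (b - a)) * (?X + ennreal \<epsilon>)"
      by (simp add: ac_simps)
    also have "ennreal (unit_ball_vol (real CARD('n)) / (b - a)) * ennreal (b - a) = ennreal (unit_ball_vol (real CARD('n)))"
      using ab by (subst ennreal_mult[symmetric]) auto
    finally show ?thesis by (simp add: distrib_left mult.commute)
  qed
  also have "\<dots> = (\<integral>\<^sup>+ t. ?K * indicator {a<..<b} t \<partial>lborel)"
    using ab by (subst nn_integral_cmult_indicator) auto
  also have "\<dots> \<le> (\<integral>\<^sup>+ t. perimeter {x. t < u x} U \<partial>lborel)"
    using K by (intro nn_integral_mono) (auto simp: indicator_def)
  also have "\<dots> \<le> ennreal (unit_ball_vol (real DIM(real ^ 'n))) * ?X"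
    by (rule perimeter_coarea(1)[OF u_borel U(1) increment[OF U]])
  finally have "?X * ennreal (unit_ball_vol (real CARD('n))) + ennreal \<epsilon> * ennreal (unit_ball_vol (real CARD('n))) \<le> ?X * ennreal (unit_ball_vol (real CARD('n))) + 0"
    by (simp add: mult.commute)
  moreover have "?X * ennreal (unit_ball_vol (real CARD('n))) \<noteq> \<infinity>" using fin by (simp add: ennreal_mult_eq_top_iff)
  ultimately have "ennreal \<epsilon> * ennreal (unit_ball_vol (real CARD('n))) \<le> 0" by (simp add: ennreal_add_left_cancel_le)
  moreover have "0 < \<epsilon> * unit_ball_vol (real CARD('n))" using \<epsilon> by simp
  ultimately show False using \<epsilon> by (simp add: ennreal_mult[symmetric] ennreal_eq_0_iff not_le del: zero_less_mult_iff)
qed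

definition avg :: "(real ^ 'n \<Rightarrow> real) \<Rightarrow> real ^ 'n \<Rightarrow> real \<Rightarrow> real" where
  "avg f y r = (\<integral>x. indicator (ball y r) x * f x \<partial>lborel) / (unit_ball_vol (real CARD('n)) * r ^ CARD('n))"

text \<open>The deviation is taken from the average at the same radius. Its convergence to 0 says
  nothing about convergence of the averages, which is why unsettled, oscillating and divergent
  points are separate cases.\<close>

definition osc :: "real ^ 'n \<Rightarrow> real \<Rightarrow> real" where
  "osc y r = avg (\<lambda>x. \<bar>u x - avg u y r\<bar>) y r"

abbreviation unsettled_points :: "(real ^ 'n) set" where
  "unsettled_points \<equiv> {y \<in> D. \<not> (osc y \<longlongrightarrow> 0) (at_right 0)}"

abbreviation oscillating_points :: "real \<Rightarrow> real \<Rightarrow> (real ^ 'n) set" where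
  "oscillating_points a b \<equiv> {y \<in> D. (osc y \<longlongrightarrow> 0) (at_right 0) \<and>
     (\<exists>\<^sub>F r in at_right 0. avg u y r < a) \<and> (\<exists>\<^sub>F r in at_right 0. b < avg u y r)}"

abbreviation divergent_points :: "real filter \<Rightarrow> (real ^ 'n) set" where
  "divergent_points F \<equiv> {y \<in> D. (osc y \<longlongrightarrow> 0) (at_right 0) \<and> filterlim (avg u y) F (at_right 0)}"

context
  fixes y :: "real ^ 'n" and r :: real
  assumes r: "0 < r" and sub: "cball y r \<subseteq> D"
begin

lemma measure_ball: "measure lborel (ball y r) = unit_ball_vol (real CARD('n)) * r ^ CARD('n)"
  using r by (simp add: content_ball)

lemma emeasure_ball_finite: "emeasure lborel (ball y r) < \<infinity>"
  using r by (simp add: emeasure_ball)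

lemma integrable_indicator_ball: "integrable lborel (\<lambda>x. indicator (ball y r) x * c :: real)"
  using emeasure_ball_finite by (simp add: integrable_mult_left)

lemma integrable_u: "integrable lborel (\<lambda>x. indicator (ball y r) x * u x)"
  by (rule Bochner_Integration.integrable_bound[OF u_integrable[OF compact_cball sub]])
    (auto simp: indicator_def)

lemma integrable_abs_diff: "integrable lborel (\<lambda>x. indicator (ball y r) x * \<bar>u x - c\<bar>)"
proof -
  have "integrable lborel (\<lambda>x. norm (indicator (ball y r) x * u x - indicator (ball y r) x * c))"
    by (intro integrable_norm Bochner_Integration.integrable_diff integrable_u integrable_indicator_ball)
  moreover have "norm (indicator (ball y r) x * u x - indicator (ball y r) x * c) = indicator (ball y r) x * \<bar>u x - c\<bar>" for x
    by (simp add: indicator_def)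
  ultimately show ?thesis by simp
qed

lemma integral_abs_diff: "(\<integral>x. indicator (ball y r) x * \<bar>u x - c\<bar> \<partial>lborel) = unit_ball_vol (real CARD('n)) * r ^ CARD('n) * avg (\<lambda>x. \<bar>u x - c\<bar>) y r"
  using r by (simp add: avg_def)

lemma nn_integral_abs_diff: "(\<integral>\<^sup>+ x\<in>ball y r. ennreal \<bar>u x - c\<bar> \<partial>lborel) = ennreal (unit_ball_vol (real CARD('n)) * r ^ CARD('n) * avg (\<lambda>x. \<bar>u x - c\<bar>) y r)"
  unfolding integral_abs_diff[symmetric]
  by (subst nn_integral_eq_integral[OF integrable_abs_diff, symmetric])
    (auto simp: indicator_def intro!: nn_integral_cong)

lemma markov:
  assumes S: "S \<in> sets borel" "S \<subseteq> ball y r" and le: "\<And>x. x \<in> S \<Longrightarrow> d \<le> \<bar>u x - c\<bar>"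
  shows "d * measure lborel S \<le> unit_ball_vol (real CARD('n)) * r ^ CARD('n) * avg (\<lambda>x. \<bar>u x - c\<bar>) y r"
proof -
  have "emeasure lborel S < \<infinity>"
    using emeasure_mono[OF S(2), of lborel] emeasure_ball_finite by (auto intro: order_le_less_trans)
  then have "d * measure lborel S = (\<integral>x. indicator S x * d \<partial>lborel)"
    using S(1) by simp
  also have "\<dots> \<le> (\<integral>x. indicator (ball y r) x * \<bar>u x - c\<bar> \<partial>lborel)"
  proof (rule integral_mono)
    show "integrable lborel (\<lambda>x. indicator S x * d)"
      using \<open>emeasure lborel S < \<infinity>\<close> S(1) by (simp add: integrable_mult_left)
    show "integrable lborel (\<lambda>x. indicator (ball y r) x * \<bar>u x - c\<bar>)" by (rule integrable_abs_diff)
    show "indicator S x * d \<le> indicator (ball y r) x * \<bar>u x - c\<bar>" for x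
      using S(2) le[of x] by (cases "x \<in> S") (auto simp: indicator_def)
  qed
  finally show ?thesis unfolding integral_abs_diff .
qed

text \<open>Chebyshev's inequality; \<delta> is the resulting bound on the density of the level set
  in the ball.\<close>

lemma superlevel_small:
  assumes "c < t" and osc: "avg (\<lambda>x. \<bar>u x - c\<bar>) y r \<le> (t - c) * \<delta>"
  shows "measure lborel (ball y r \<inter> {x. t < u x}) \<le> unit_ball_vol (real CARD('n)) * r ^ CARD('n) * \<delta>"
proof -
  have "(t - c) * measure lborel (ball y r \<inter> {x. t < u x}) \<le> unit_ball_vol (real CARD('n)) * r ^ CARD('n) * avg (\<lambda>x. \<bar>u x - c\<bar>) y r"
    by (rule markov) (use assms in auto)
  also have "\<dots> \<le> unit_ball_vol (real CARD('n)) * r ^ CARD('n) * ((t - c) * \<delta>)"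
    using r by (intro mult_left_mono[OF osc]) auto
  finally show ?thesis using assms(1) by (simp add: mult.left_commute)
qed

lemma sublevel_small:
  assumes "t < c" and osc: "avg (\<lambda>x. \<bar>u x - c\<bar>) y r \<le> (c - t) * \<delta>"
  shows "measure lborel (ball y r - {x. t < u x}) \<le> unit_ball_vol (real CARD('n)) * r ^ CARD('n) * \<delta>"
proof -
  have "(c - t) * measure lborel (ball y r - {x. t < u x}) \<le> unit_ball_vol (real CARD('n)) * r ^ CARD('n) * avg (\<lambda>x. \<bar>u x - c\<bar>) y r"
    by (rule markov) (use assms in auto)
  also have "\<dots> \<le> unit_ball_vol (real CARD('n)) * r ^ CARD('n) * ((c - t) * \<delta>)"
    using r by (intro mult_left_mono[OF osc]) auto
  finally show ?thesis using assms(1) by (simp add: mult.left_commute)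
qed

lemma avg_nonneg: "(\<And>x. 0 \<le> f x) \<Longrightarrow> 0 \<le> avg f y r"
  unfolding avg_def using r by (intro divide_nonneg_nonneg integral_nonneg) auto

lemma abs_avg_diff_le: "\<bar>avg u y r - c\<bar> \<le> avg (\<lambda>x. \<bar>u x - c\<bar>) y r"
proof -
  let ?m = "unit_ball_vol (real CARD('n)) * r ^ CARD('n)"
  have m: "0 < ?m" using r by simp
  have "?m * (avg u y r - c) = (\<integral>x. indicator (ball y r) x * u x \<partial>lborel) - (\<integral>x. indicator (ball y r) x * c \<partial>lborel)"
    using r measure_ball by (simp add: avg_def right_diff_distrib)
  also have "\<dots> = (\<integral>x. indicator (ball y r) x * (u x - c) \<partial>lborel)"
    using integrable_u integrable_indicator_ball
    by (subst Bochner_Integration.integral_diff[symmetric]) (auto simp: right_diff_distrib)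
  finally have "\<bar>?m * (avg u y r - c)\<bar> = \<bar>\<integral>x. indicator (ball y r) x * (u x - c) \<partial>lborel\<bar>" by simp
  also have "\<dots> \<le> (\<integral>x. \<bar>indicator (ball y r) x * (u x - c)\<bar> \<partial>lborel)"
    by (rule integral_abs_bound)
  also have "\<dots> = (\<integral>x. indicator (ball y r) x * \<bar>u x - c\<bar> \<partial>lborel)"
    by (simp add: abs_mult)
  finally have "?m * \<bar>avg u y r - c\<bar> \<le> ?m * avg (\<lambda>x. \<bar>u x - c\<bar>) y r"
    unfolding integral_abs_diff by (subst (asm) abs_mult) (simp only: abs_of_pos[OF m])
  then show ?thesis using m by (simp only: mult_le_cancel_left_pos)
qed

lemma avg_abs_diff_triangle: "avg (\<lambda>x. \<bar>u x - c\<bar>) y r \<le> osc y r + \<bar>avg u y r - c\<bar>"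
proof -
  let ?a = "avg u y r" and ?m = "unit_ball_vol (real CARD('n)) * r ^ CARD('n)"
  have m: "0 < ?m" using r by simp
  have "?m * avg (\<lambda>x. \<bar>u x - c\<bar>) y r \<le>
      (\<integral>x. indicator (ball y r) x * \<bar>u x - ?a\<bar> + indicator (ball y r) x * \<bar>?a - c\<bar> \<partial>lborel)"
    unfolding integral_abs_diff[symmetric]
    by (intro integral_mono Bochner_Integration.integrable_add integrable_abs_diff integrable_indicator_ball)
      (auto simp: indicator_def)
  also have "\<dots> = ?m * osc y r + ?m * \<bar>?a - c\<bar>"
    using measure_ball
    by (subst Bochner_Integration.integral_add[OF integrable_abs_diff integrable_indicator_ball])
      (simp add: integral_abs_diff osc_def)
  finally have "?m * avg (\<lambda>x. \<bar>u x - c\<bar>) y r \<le> ?m * (osc y r + \<bar>?a - c\<bar>)"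
    by (simp add: distrib_left)
  then show ?thesis using m by (simp only: mult_le_cancel_left_pos)
qed

text \<open>The distance of u(x) from its average is at most the average over z of |u(z) - u(x)|, so
  \<open>osc\<close> is bounded by a double integral of increments. Here w ranges over a ball of
  radius 2 r, and each increment costs at most 2 r times the energy. Dividing (2 r) \<delta> r^(n-1)
  times the volume of that ball by the square of the volume of the ball of radius r gives the
  constant.\<close>

lemma poincare_ball:
  assumes \<delta>: "0 \<le> \<delta>" and le: "energy (ball y r) \<le> ennreal (\<delta> * r powr (real CARD('n) - 1))"
  shows "osc y r \<le> 2 ^ Suc CARD('n) / unit_ball_vol (real CARD('n)) * \<delta>"
proof -
  let ?n = "CARD('n)" and ?B = "ball y r"
  let ?a = "avg u y r" and ?m = "unit_ball_vol (real CARD('n)) * r ^ ?n"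
  have m: "0 < ?m" using r by simp
  have Bsub: "?B \<subseteq> D" using sub ball_subset_cball by blast
  have pt: "ennreal ?m * ennreal \<bar>u x - ?a\<bar> \<le> (\<integral>\<^sup>+ z\<in>?B. ennreal \<bar>u z - u x\<bar> \<partial>lborel)" for x
  proof -
    have "?m * \<bar>u x - ?a\<bar> \<le> ?m * avg (\<lambda>z. \<bar>u z - u x\<bar>) y r"
      using abs_avg_diff_le[of "u x"] m by (intro mult_left_mono) (auto simp: abs_minus_commute)
    moreover have "ennreal ?m * ennreal \<bar>u x - ?a\<bar> = ennreal (?m * \<bar>u x - ?a\<bar>)"
      using m by (intro ennreal_mult[symmetric]) auto
    ultimately show ?thesis unfolding nn_integral_abs_diff by (simp only: ennreal_leI)
  qed
  have "ennreal ?m * ennreal (?m * osc y r) = ennreal ?m * (\<integral>\<^sup>+ x\<in>?B. ennreal \<bar>u x - ?a\<bar> \<partial>lborel)"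
    by (simp add: nn_integral_abs_diff osc_def)
  also have "\<dots> = (\<integral>\<^sup>+ x\<in>?B. ennreal ?m * ennreal \<bar>u x - ?a\<bar> \<partial>lborel)"
    by (subst nn_integral_cmult[symmetric]) (auto simp: mult.assoc)
  also have "\<dots> \<le> (\<integral>\<^sup>+ x\<in>?B. (\<integral>\<^sup>+ z\<in>?B. ennreal \<bar>u z - u x\<bar> \<partial>lborel) \<partial>lborel)"
    by (intro nn_integral_mono mult_right_mono pt) simp
  also have "\<dots> \<le> (\<integral>\<^sup>+ w\<in>ball 0 (2 * r). total_increment u ?B w \<partial>lborel)"
  proof (rule double_integral_le_total_increment[OF u_borel open_ball convex_ball])
    show "dist x z < 2 * r" if "x \<in> ?B" "z \<in> ?B" for x z
      using that dist_triangle3[of x z y] by simp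
  qed
  also have "\<dots> \<le> (\<integral>\<^sup>+ w. (ennreal (2 * r) * ennreal (\<delta> * r powr (real ?n - 1))) * indicator (ball (0 :: real ^ 'n) (2 * r)) w \<partial>lborel)"
  proof (rule nn_integral_mono)
    fix w :: "real ^ 'n"
    have "total_increment u ?B w \<le> ennreal (2 * r) * ennreal (\<delta> * r powr (real ?n - 1))" if "norm w < 2 * r"
    proof -
      have "total_increment u ?B w \<le> ennreal (norm w) * energy ?B"
        by (rule increment[OF open_ball Bsub])
      also have "\<dots> \<le> ennreal (2 * r) * ennreal (\<delta> * r powr (real ?n - 1))"
        using that le by (intro mult_mono ennreal_leI) auto
      finally show ?thesis .
    qed
    then show "total_increment u ?B w * indicator (ball 0 (2 * r)) w \<le>
        (ennreal (2 * r) * ennreal (\<delta> * r powr (real ?n - 1))) * indicator (ball 0 (2 * r)) w"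
      by (auto simp: indicator_def)
  qed
  also have "\<dots> = (ennreal (2 * r) * ennreal (\<delta> * r powr (real ?n - 1))) * ennreal (unit_ball_vol (real CARD('n)) * (2 * r) ^ ?n)"
    using r by (subst nn_integral_cmult_indicator) (auto simp: emeasure_ball)
  also have "\<dots> = ennreal ((2 * r * (\<delta> * r powr (real ?n - 1))) * (unit_ball_vol (real CARD('n)) * (2 * r) ^ ?n))"
    using r \<delta> by (simp add: ennreal_mult)
  finally have "ennreal (?m * (?m * osc y r)) \<le> ennreal ((2 * r * (\<delta> * r powr (real ?n - 1))) * (unit_ball_vol (real CARD('n)) * (2 * r) ^ ?n))"
    using m by (subst ennreal_mult') auto
  then have "?m * (?m * osc y r) \<le> (2 * r * (\<delta> * r powr (real ?n - 1))) * (unit_ball_vol (real CARD('n)) * (2 * r) ^ ?n)"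
    using r \<delta> by (subst (asm) ennreal_le_iff) auto
  also have "\<dots> = ?m * (?m * (2 ^ Suc ?n / unit_ball_vol (real CARD('n)) * \<delta>))"
  proof -
    have "r powr (real ?n - 1) = r ^ ?n / r"
      using r by (simp add: powr_diff powr_realpow)
    then show ?thesis using r by (simp add: power_mult_distrib)
  qed
  finally show ?thesis using m by (simp only: mult_le_cancel_left_pos)
qed

end

section \<open>Exceptional sets of content zero\<close>

lemma eventually_cball_subset:
  assumes "open U" "y \<in> U" shows "eventually (\<lambda>r. cball y r \<subseteq> U) (at_right 0)"
proof -
  obtain e where e: "0 < e" "cball y e \<subseteq> U" using assms by (meson open_contains_cball)
  then show ?thesis
    by (auto simp: eventually_at_right_field intro!: exI[of _ e])
qed

lemma eventually_at_right_pos: "eventually (\<lambda>r. 0 < (r :: real)) (at_right 0)"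
  by (simp add: eventually_at_right_less)

text \<open>Each point has arbitrarily small balls in U whose energy exceeds \<delta> R^(n-1). For
  disjoint balls the energies add up to at most the energy of U, hence the factor
  1/\<delta>.\<close>

lemma content_concentration_points:
  assumes "0 < \<delta>"
  shows "hausdorff_content (real CARD('n) - 1)
    {y \<in> D. \<exists>\<^sub>F r in at_right 0. ennreal (\<delta> * r powr (real CARD('n) - 1)) < energy (ball y r)} = 0"
    (is "hausdorff_content _ ?S = 0")
proof (rule hausdorff_content_codim1_null[OF dim D_open _ \<gamma>_borel finite_energy, of _ "1 / \<delta>"])
  fix U and \<eta> \<epsilon> :: real assume U: "open U" "?S \<subseteq> U" "U \<subseteq> D" and \<eta>: "0 < \<eta>" and \<epsilon>: "0 < \<epsilon>"
  have "\<exists>r. 0 < r \<and> r \<le> \<eta> \<and> ball y r \<subseteq> U \<and> ennreal (\<delta> * r powr (real CARD('n) - 1)) \<le> energy (ball y r)"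
    if y: "y \<in> ?S" for y
  proof -
    have "eventually (\<lambda>r. 0 < r \<and> r < \<eta> \<and> cball y r \<subseteq> U) (at_right 0)"
      using \<eta> y U by (intro eventually_conj eventually_at_right_pos eventually_cball_subset)
        (auto simp: eventually_at_right_field)
    moreover have "\<exists>\<^sub>F r in at_right 0. ennreal (\<delta> * r powr (real CARD('n) - 1)) < energy (ball y r)"
      using y by simp
    ultimately have "\<exists>\<^sub>F r in at_right 0. ennreal (\<delta> * r powr (real CARD('n) - 1)) < energy (ball y r) \<and>
        (0 < r \<and> r < \<eta> \<and> cball y r \<subseteq> U)"
      by (rule frequently_eventually_frequently[rotated])
    from frequently_ex[OF this] obtain r where "ennreal (\<delta> * r powr (real CARD('n) - 1)) < energy (ball y r)"
        "0 < r" "r < \<eta>" "cball y r \<subseteq> U"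
      by blast
    then show ?thesis using ball_subset_cball[of y r] by (intro exI[of _ r]) auto
  qed
  then have "\<forall>y\<in>?S. \<exists>r. 0 < r \<and> r \<le> \<eta> \<and> ball y r \<subseteq> U \<and> ennreal (\<delta> * r powr (real CARD('n) - 1)) \<le> energy (ball y r)"
    by (rule ballI)
  then obtain R where R: "\<forall>y\<in>?S. 0 < R y \<and> R y \<le> \<eta> \<and> ball y (R y) \<subseteq> U \<and>
      ennreal (\<delta> * R y powr (real CARD('n) - 1)) \<le> energy (ball y (R y))"
    by (rule bchoice[THEN exE])
  show "\<exists>R. (\<forall>y\<in>?S. 0 < R y \<and> R y \<le> \<eta>) \<and>
        (\<forall>F. finite F \<longrightarrow> F \<subseteq> ?S \<longrightarrow> disjoint_family_on (\<lambda>y. cball y (R y)) F \<longrightarrow>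
          radius_sum R F \<le> ennreal (1 / \<delta>) * (energy U + ennreal \<epsilon>))"
  proof (intro exI[of _ R] conjI ballI allI impI)
    fix F assume F: "finite F" "F \<subseteq> ?S" "disjoint_family_on (\<lambda>y. cball y (R y)) F"
    have "radius_sum R F \<le> (\<Sum>y\<in>F. ennreal (1 / \<delta>) * energy (ball y (R y)))"
    proof (rule sum_mono)
      fix y assume "y \<in> F"
      then have "ennreal (\<delta> * R y powr (real CARD('n) - 1)) \<le> energy (ball y (R y))"
        using R F(2) by blast
      then have "ennreal (1 / \<delta>) * ennreal (\<delta> * R y powr (real CARD('n) - 1)) \<le> ennreal (1 / \<delta>) * energy (ball y (R y))"
        by (rule mult_left_mono) simp
      moreover have "ennreal (1 / \<delta>) * ennreal (\<delta> * R y powr (real CARD('n) - 1)) = ennreal (R y powr (real CARD('n) - 1))"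
        using assms by (subst ennreal_mult[symmetric]) auto
      ultimately show "ennreal (R y powr (real CARD('n) - 1)) \<le> ennreal (1 / \<delta>) * energy (ball y (R y))"
        by simp
    qed
    also have "\<dots> = ennreal (1 / \<delta>) * (\<integral>\<^sup>+ x. (\<Sum>y\<in>F. \<gamma> x * indicator (ball y (R y)) x) \<partial>lborel)"
      by (subst nn_integral_sum) (auto simp: sum_distrib_left)
    also have "\<dots> \<le> ennreal (1 / \<delta>) * energy U"
    proof (intro mult_left_mono nn_integral_mono)
      fix x
      have "(\<Sum>y\<in>F. indicator (ball y (R y)) x :: ennreal) = indicator (\<Union>y\<in>F. ball y (R y)) x"
      proof (rule indicator_UN_disjoint[symmetric, OF F(1)])
        show "disjoint_family_on (\<lambda>y. ball y (R y)) F"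
          using F(3) ball_subset_cball unfolding disjoint_family_on_def by blast
      qed
      also have "\<dots> \<le> indicator U x"
      proof -
        have "(\<Union>y\<in>F. ball y (R y)) \<subseteq> U" using R F(2) by blast
        then show ?thesis unfolding indicator_def by (cases "x \<in> U") (auto simp del: mem_ball)
      qed
      finally show "(\<Sum>y\<in>F. \<gamma> x * indicator (ball y (R y)) x) \<le> \<gamma> x * indicator U x"
        unfolding sum_distrib_left[symmetric] by (rule mult_left_mono) simp
    qed simp
    also have "\<dots> \<le> ennreal (1 / \<delta>) * (energy U + ennreal \<epsilon>)"
      by (intro mult_left_mono) auto
    finally show "radius_sum R F \<le> ennreal (1 / \<delta>) * (energy U + ennreal \<epsilon>)" .
  qed (use R in auto)
qed (use assms in auto)

text \<open>If the energy of small balls is eventually at most \<delta> r^(n-1) for every \<delta> >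
  0, the Poincare inequality forces \<open>osc\<close> to 0. The values \<delta> = 1/(m + 1)
  suffice, so countably many concentration sets cover the unsettled points.\<close>

lemma content_not_osc_tendsto_0:
  "hausdorff_content (real CARD('n) - 1) unsettled_points = 0"
proof -
  define S where "S m = {y \<in> D. \<exists>\<^sub>F r in at_right 0. ennreal (inverse (real (Suc m)) * r powr (real CARD('n) - 1)) <
      energy (ball y r)}" for m
  have "unsettled_points \<subseteq> (\<Union>m. S m)"
  proof (rule subsetI, rule ccontr)
    fix y assume y: "y \<in> unsettled_points" "y \<notin> (\<Union>m. S m)"
    have "(osc y \<longlongrightarrow> 0) (at_right 0)"
    proof (rule tendstoI)
      fix e :: real assume "0 < e"
      let ?K = "2 ^ Suc CARD('n) / unit_ball_vol (real CARD('n))"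
      have K: "0 < ?K" by simp
      obtain m where m: "inverse (real (Suc m)) < e / ?K"
        using reals_Archimedean[of "e / ?K"] \<open>0 < e\<close> K by auto
      have "\<not> (\<exists>\<^sub>F r in at_right 0. ennreal (inverse (real (Suc m)) * r powr (real CARD('n) - 1)) <
          energy (ball y r))"
        using y by (auto simp: S_def)
      then have "eventually (\<lambda>r. energy (ball y r) \<le> ennreal (inverse (real (Suc m)) * r powr (real CARD('n) - 1))) (at_right 0)"
        by (simp add: frequently_def not_less)
      moreover have "eventually (\<lambda>r. cball y r \<subseteq> D) (at_right 0)"
        using y by (intro eventually_cball_subset D_open) auto
      ultimately show "eventually (\<lambda>r. dist (osc y r) 0 < e) (at_right 0)"
        using eventually_at_right_pos
      proof eventually_elim
        case (elim r)
        have "osc y r \<le> ?K * inverse (real (Suc m))"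
          by (rule poincare_ball[OF elim(3,2) _ elim(1)]) simp
        also have "\<dots> < e" using m K by (simp only: pos_less_divide_eq mult.commute)
        finally show ?case
          using avg_nonneg[OF elim(3,2), of "\<lambda>x. \<bar>u x - avg u y r\<bar>"] by (simp add: osc_def)
      qed
    qed
    with y show False by simp
  qed
  then have "hausdorff_content (real CARD('n) - 1) unsettled_points \<le>
      hausdorff_content (real CARD('n) - 1) (\<Union>m. S m)"
    by (rule hausdorff_content_mono)
  also have "\<dots> = 0"
    unfolding S_def using dim by (intro hausdorff_content_UN_null content_concentration_points) auto
  finally show ?thesis by simp
qed

text \<open>One level t between a and b must serve all points of the set; it is chosen for the given
  U by averaging. Since \<open>osc\<close> is small, an average below a gives
  \<open>{x. t < u x}\<close> density at most 1/2 in that ball, and an average above b gives density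
  at least 1/2. A scale of intermediate density lies in between, below any prescribed
  radius.\<close>

lemma content_oscillating_averages:
  assumes ab: "a < b"
  shows "hausdorff_content (real CARD('n) - 1)
    (oscillating_points a b) = 0"
    (is "hausdorff_content _ ?S = 0")
proof -
  define \<theta> where "\<theta> = (1 / 2 :: real) ^ Suc CARD('n)"
  define K where "K = 2 * 6 ^ Suc CARD('n) / (\<theta> * (unit_ball_vol (real CARD('n)))\<^sup>2)"
  have K: "0 < K" by (simp add: K_def \<theta>_def)
  show ?thesis
  proof (rule hausdorff_content_codim1_null[OF dim D_open _ \<gamma>_borel finite_energy, of _ "K * (unit_ball_vol (real CARD('n)) / (b - a))"])
    fix U and \<eta> \<epsilon> :: real assume U: "open U" "?S \<subseteq> U" "U \<subseteq> D" and \<eta>: "0 < \<eta>" and \<epsilon>: "0 < \<epsilon>"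
    obtain t where t: "a < t" "t < b"
      "perimeter {x. t < u x} U \<le> ennreal (unit_ball_vol (real CARD('n)) / (b - a)) * (energy U + ennreal \<epsilon>)"
      using exists_level_small_perimeter[OF U(1,3) ab \<epsilon>] by blast
    let ?E = "{x. t < u x}"
    have [measurable]: "?E \<in> sets borel" by measurable
    have "\<exists>r. 0 < r \<and> r \<le> \<eta> \<and> ball y r \<subseteq> U \<and> intermediate_density \<theta> ?E (ball y r)" if y: "y \<in> ?S" for y
    proof -
      \<comment> \<open>The distance from t to an average below a or above b exceeds the minimum, so
        with half of it Chebyshev's inequality gives densities of at most 1/2.\<close>
      have "(osc y \<longlongrightarrow> 0) (at_right 0)" "0 < min (t - a) (b - t) / 2" using y t by auto
      then have "eventually (\<lambda>r. osc y r < min (t - a) (b - t) / 2) (at_right 0)"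
        by (rule order_tendstoD(2))
      then have "eventually (\<lambda>r. r < \<eta> \<and> cball y r \<subseteq> U \<and> osc y r < min (t - a) (b - t) / 2) (at_right 0)"
        using \<eta> y U by (intro eventually_conj eventually_cball_subset) (auto simp: eventually_at_right_field)
      then obtain c where c: "0 < c" "\<And>r. 0 < r \<Longrightarrow> r < c \<Longrightarrow> r < \<eta> \<and> cball y r \<subseteq> U \<and> osc y r < min (t - a) (b - t) / 2"
        by (auto simp: eventually_at_right_field)
      have freq: "\<exists>r. 0 < r \<and> r < d \<and> P r" if "\<exists>\<^sub>F r in at_right 0. P r" "0 < d" for P :: "real \<Rightarrow> bool" and d
      proof (rule ccontr)
        assume "\<not> ?thesis"
        then have "eventually (\<lambda>r. \<not> P r) (at_right 0)"
          using that(2) by (auto simp: eventually_at_right_field intro!: exI[of _ d])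
        then show False using that(1) by (simp add: frequently_def)
      qed
      \<comment> \<open>The radius with small average is found first and the one with large average
        below it, as the scale lemma wants the small density at the larger scale.\<close>
      obtain r0 where r0: "0 < r0" "r0 < c" "avg u y r0 < a" using freq[OF _ c(1)] y by blast
      obtain r1 where r1: "0 < r1" "r1 < r0" "b < avg u y r1" using freq[OF _ r0(1)] y by blast
      have fm: "ball y s \<in> fmeasurable lborel" for s
        using emeasure_lborel_ball_finite[of y s] by (intro fmeasurableI) auto
      have upper: "measure lborel (ball y r0 \<inter> ?E) \<le> unit_ball_vol (real CARD('n)) * r0 ^ CARD('n) / 2"
      proof -
        have "avg (\<lambda>x. \<bar>u x - avg u y r0\<bar>) y r0 \<le> (t - avg u y r0) * (1 / 2)"
          using c(2)[OF r0(1,2)] r0(3) by (simp add: osc_def)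
        moreover have "cball y r0 \<subseteq> D" using c(2)[OF r0(1,2)] U(3) by blast
        ultimately have "measure lborel (ball y r0 \<inter> ?E) \<le> unit_ball_vol (real CARD('n)) * r0 ^ CARD('n) * (1 / 2)"
          using r0 t by (intro superlevel_small[where c = "avg u y r0"]) auto
        then show ?thesis by simp
      qed
      have lower: "unit_ball_vol (real CARD('n)) * r1 ^ CARD('n) / 2 \<le> measure lborel (ball y r1 \<inter> ?E)"
      proof -
        have r1c: "r1 < c" using r0 r1 by simp
        have "avg (\<lambda>x. \<bar>u x - avg u y r1\<bar>) y r1 \<le> (avg u y r1 - t) * (1 / 2)"
          using c(2)[OF r1(1) r1c] r1(3) by (simp add: osc_def)
        moreover have "cball y r1 \<subseteq> D" using c(2)[OF r1(1) r1c] U(3) by blast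
        ultimately have "measure lborel (ball y r1 - ?E) \<le> unit_ball_vol (real CARD('n)) * r1 ^ CARD('n) * (1 / 2)"
          using r1 t by (intro sublevel_small[where c = "avg u y r1"]) auto
        moreover have "measure lborel (ball y r1 - ?E) = measure lborel (ball y r1) - measure lborel (ball y r1 \<inter> ?E)"
        proof -
          have "ball y r1 - ?E = ball y r1 - (ball y r1 \<inter> ?E)" by auto
          moreover have "ball y r1 \<inter> ?E \<in> fmeasurable lborel"
            using fm by (rule fmeasurable_Int_fmeasurable) simp
          ultimately show ?thesis using fm[of r1] by (simp add: measurable_measure_Diff)
        qed
        ultimately show ?thesis using r1(1) by (simp add: content_ball)
      qed
      obtain s where s: "0 < s" "s \<le> r0" "\<theta> * (unit_ball_vol (real CARD('n)) * s ^ CARD('n)) \<le> measure lborel (ball y s \<inter> ?E)"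
          "measure lborel (ball y s \<inter> ?E) \<le> unit_ball_vol (real CARD('n)) * s ^ CARD('n) / 2"
      proof -
        have "measure lborel (ball y s \<inter> ?E) \<le> measure lborel (ball y s' \<inter> ?E)" if "s \<le> s'" for s s'
        proof (rule measure_mono_fmeasurable)
          show "ball y s' \<inter> ?E \<in> fmeasurable lborel" using fm by (rule fmeasurable_Int_fmeasurable) simp
        qed (use that in auto)
        then show ?thesis
          using exists_intermediate_density_scale[of r0 "\<lambda>s. measure lborel (ball y s \<inter> ?E)" r1 "unit_ball_vol (real CARD('n))" "CARD('n)"] that
            r0 r1 upper lower unfolding \<theta>_def by auto
      qed
      then have "intermediate_density \<theta> ?E (ball y s)"
        by (simp add: intermediate_density_def content_ball)
      moreover have "s < c" using s r0 by simp
      ultimately show ?thesis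
        using s(1) c(2)[of s] ball_subset_cball[of y s] by (intro exI[of _ s]) auto
    qed
    then have "\<forall>y\<in>?S. \<exists>r. 0 < r \<and> r \<le> \<eta> \<and> ball y r \<subseteq> U \<and> intermediate_density \<theta> ?E (ball y r)"
      by (rule ballI)
    then obtain R where R: "\<forall>y\<in>?S. 0 < R y \<and> R y \<le> \<eta> \<and> ball y (R y) \<subseteq> U \<and> intermediate_density \<theta> ?E (ball y (R y))"
      by (rule bchoice[THEN exE])
    show "\<exists>R. (\<forall>y\<in>?S. 0 < R y \<and> R y \<le> \<eta>) \<and>
        (\<forall>F. finite F \<longrightarrow> F \<subseteq> ?S \<longrightarrow> disjoint_family_on (\<lambda>y. cball y (R y)) F \<longrightarrow>
          radius_sum R F \<le> ennreal (K * (unit_ball_vol (real CARD('n)) / (b - a))) * (energy U + ennreal \<epsilon>))"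
    proof (intro exI[of _ R] conjI ballI allI impI)
      fix F assume F: "finite F" "F \<subseteq> ?S" "disjoint_family_on (\<lambda>y. cball y (R y)) F"
      have RF: "0 < R y" "R y \<le> \<eta>" "ball y (R y) \<subseteq> U" "intermediate_density \<theta> ?E (ball y (R y))" if "y \<in> F" for y
        using R F(2) that by blast+
      have "radius_sum R F \<le> ennreal K * perimeter ?E U"
        unfolding K_def
      proof (rule sum_radius_power_le_perimeter[where D = "\<lambda>y. ball y (R y)", OF _ U(1) F(1,3)])
        show "unit_ball_vol (real CARD('n)) * R y ^ CARD('n) \<le> measure lborel (ball y (R y))" if "y \<in> F" for y
          using RF(1)[OF that] by (simp add: content_ball)
      qed (use RF in \<open>auto simp: \<theta>_def\<close>)
      also have "\<dots> \<le> ennreal K * (ennreal (unit_ball_vol (real CARD('n)) / (b - a)) * (energy U + ennreal \<epsilon>))"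
        by (rule mult_left_mono[OF t(3)]) simp
      also have "\<dots> = ennreal (K * (unit_ball_vol (real CARD('n)) / (b - a))) * (energy U + ennreal \<epsilon>)"
        using K ab by (subst ennreal_mult) (auto simp: mult.assoc)
      finally show "radius_sum R F \<le> ennreal (K * (unit_ball_vol (real CARD('n)) / (b - a))) * (energy U + ennreal \<epsilon>)" .
    qed (use R in auto)
  qed (use K ab in auto)
qed

end

text \<open>Take the infimum of the levels t at which \<open>{x. t < u x}\<close> fills at most half
  of D. Both conclusions concern strict inequalities, so the level set {u = m}, possibly of positive
  measure, is excluded from both, and each follows from continuity of the measure along increasing
  unions.\<close>

lemma exists_median:
  fixes u :: "'a::euclidean_space \<Rightarrow> real"
  assumes [measurable]: "u \<in> borel_measurable borel" and D: "D \<in> sets borel" and fin: "emeasure lborel D < \<infinity>"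
    and pos: "0 < measure lborel D"
  obtains m where "measure lborel (D \<inter> {x. m < u x}) \<le> measure lborel D / 2"
    "measure lborel (D \<inter> {x. u x < m}) \<le> measure lborel D / 2"
proof -
  have [measurable]: "D \<in> sets borel" by fact
  let ?V = "measure lborel D"
  define G where "G t = measure lborel (D \<inter> {x. t < u x})" for t
  have finD: "emeasure lborel (D \<inter> A) \<noteq> \<infinity>" for A
  proof (cases "D \<inter> A \<in> sets lborel")
    case True
    have "emeasure lborel (D \<inter> A) \<le> emeasure lborel D" by (rule emeasure_mono) auto
    then show ?thesis using fin by auto
  qed (simp add: emeasure_notin_sets)
  have D_fm: "D \<in> fmeasurable lborel" using fin by (intro fmeasurableI) auto
  have compl: "measure lborel (D \<inter> {x. u x \<le> t}) = ?V - G t" for t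
  proof -
    have "D \<inter> {x. u x \<le> t} = D - (D \<inter> {x. t < u x})" by auto
    moreover have "D \<inter> {x. t < u x} \<in> fmeasurable lborel"
      using finD by (intro fmeasurableI) (auto simp: less_top)
    ultimately show ?thesis using D_fm by (simp add: G_def measurable_measure_Diff)
  qed
  have "(\<lambda>k. G (real k)) \<longlonglongrightarrow> measure lborel (\<Inter>k. D \<inter> {x. real k < u x})"
    unfolding G_def
    by (rule Lim_measure_decseq) (use finD in \<open>auto simp: decseq_def\<close>)
  moreover have "(\<Inter>k. D \<inter> {x. real k < u x}) = {}"
  proof -
    have "\<exists>k. \<not> real k < u x" for x using real_arch_simple[of "u x"] by (auto simp: not_less)
    then show ?thesis by blast
  qed
  ultimately have "(\<lambda>k. G (real k)) \<longlonglongrightarrow> 0" by simp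
  then have "eventually (\<lambda>k. G (real k) < ?V / 2) sequentially"
    using pos by (intro order_tendstoD) auto
  then obtain k1 where k1: "G (real k1) < ?V / 2" by (auto simp: eventually_sequentially)
  have "(\<lambda>k. G (- real k)) \<longlonglongrightarrow> measure lborel (\<Union>k. D \<inter> {x. - real k < u x})"
    unfolding G_def
    by (rule Lim_measure_incseq) (use finD[of "\<Union>k. {x. - real k < u x}"] in \<open>auto simp: incseq_def\<close>)
  moreover have "(\<Union>k. D \<inter> {x. - real k < u x}) = D"
  proof -
    have "\<exists>k. - real k < u x" for x using reals_Archimedean2[of "- u x"] by (auto simp: minus_less_iff)
    then show ?thesis by blast
  qed
  ultimately have "(\<lambda>k. G (- real k)) \<longlonglongrightarrow> ?V" by simp
  then have "eventually (\<lambda>k. ?V / 2 < G (- real k)) sequentially"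
    using pos by (intro order_tendstoD) auto
  then obtain k2 where k2: "?V / 2 < G (- real k2)" by (auto simp: eventually_sequentially)
  have anti: "G t \<le> G s" if "s \<le> t" for s t
    unfolding G_def
  proof (rule measure_mono_fmeasurable)
    show "D \<inter> {x. s < u x} \<in> fmeasurable lborel" using finD by (intro fmeasurableI) (auto simp: less_top)
  qed (use that in auto)
  define T where "T = {t. G t \<le> ?V / 2}"
  have "T \<noteq> {}" using k1 by (auto simp: T_def intro!: less_imp_le)
  have bdd: "bdd_below T"
  proof (rule bdd_belowI)
    show "- real k2 \<le> t" if "t \<in> T" for t
      using that anti[of t "- real k2"] k2 by (force simp: T_def)
  qed
  define m where "m = Inf T"
  have above: "G t \<le> ?V / 2" if "m < t" for t
  proof -
    have "Inf T < t" using that by (simp add: m_def)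
    from cInf_lessD[OF \<open>T \<noteq> {}\<close> this] obtain s where "s \<in> T" "s < t" by blast
    then show ?thesis using anti[of s t] by (simp add: T_def)
  qed
  have below: "?V / 2 < G t" if "t < m" for t
  proof (rule ccontr)
    assume "\<not> ?thesis"
    then have "t \<in> T" by (simp add: T_def)
    from cInf_lower[OF this bdd] that show False by (simp add: m_def)
  qed
  show ?thesis
  proof (rule that[of m])
    have "(\<lambda>k. G (m + inverse (real (Suc k)))) \<longlonglongrightarrow> measure lborel (\<Union>k. D \<inter> {x. m + inverse (real (Suc k)) < u x})"
      unfolding G_def
    proof (rule Lim_measure_incseq)
      show "incseq (\<lambda>k. D \<inter> {x. m + inverse (real (Suc k)) < u x})"
        unfolding incseq_def
      proof (intro allI impI subsetI)
        fix i j :: nat and x assume "i \<le> j" and x: "x \<in> D \<inter> {x. m + inverse (real (Suc i)) < u x}"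
        have "inverse (real (Suc j)) \<le> inverse (real (Suc i))"
          using \<open>i \<le> j\<close> by (intro le_imp_inverse_le) auto
        moreover have "x \<in> D" "m + inverse (real (Suc i)) < u x" using x by blast+
        ultimately have "m + inverse (real (Suc j)) < u x" by linarith
        with \<open>x \<in> D\<close> show "x \<in> D \<inter> {x. m + inverse (real (Suc j)) < u x}" by blast
      qed
      show "emeasure lborel (\<Union>k. D \<inter> {x. m + inverse (real (Suc k)) < u x}) \<noteq> \<infinity>"
        using finD[of "\<Union>k. {x. m + inverse (real (Suc k)) < u x}"] by simp
    qed auto
    then have "measure lborel (\<Union>k. D \<inter> {x. m + inverse (real (Suc k)) < u x}) \<le> ?V / 2"
    proof (rule LIMSEQ_le_const2)
      show "\<exists>N. \<forall>k\<ge>N. G (m + inverse (real (Suc k))) \<le> ?V / 2"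
        by (intro exI[of _ 0] allI impI above) simp
    qed
    moreover have "(\<Union>k. D \<inter> {x. m + inverse (real (Suc k)) < u x}) = D \<inter> {x. m < u x}"
    proof -
      have "(\<exists>k. m + inverse (real (Suc k)) < u x) \<longleftrightarrow> m < u x" for x
      proof
        assume "m < u x"
        then show "\<exists>k. m + inverse (real (Suc k)) < u x"
        proof -
          obtain k where "inverse (real (Suc k)) < u x - m"
            using reals_Archimedean[of "u x - m"] \<open>m < u x\<close> by auto
          then have "m + inverse (real (Suc k)) < u x" by linarith
          then show ?thesis by blast
        qed
      next
        assume "\<exists>k. m + inverse (real (Suc k)) < u x"
        then obtain k where "m + inverse (real (Suc k)) < u x" by blast
        moreover have "0 < inverse (real (Suc k))" by simp
        ultimately show "m < u x" by linarith
      qed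
      then show ?thesis by blast
    qed
    ultimately show "measure lborel (D \<inter> {x. m < u x}) \<le> ?V / 2" by simp
    have "(\<lambda>k. measure lborel (D \<inter> {x. u x \<le> m - inverse (real (Suc k))})) \<longlonglongrightarrow>
        measure lborel (\<Union>k. D \<inter> {x. u x \<le> m - inverse (real (Suc k))})"
    proof (rule Lim_measure_incseq)
      show "incseq (\<lambda>k. D \<inter> {x. u x \<le> m - inverse (real (Suc k))})"
        unfolding incseq_def
      proof (intro allI impI subsetI)
        fix i j :: nat and x assume "i \<le> j" and x: "x \<in> D \<inter> {x. u x \<le> m - inverse (real (Suc i))}"
        have "inverse (real (Suc j)) \<le> inverse (real (Suc i))"
          using \<open>i \<le> j\<close> by (intro le_imp_inverse_le) auto
        moreover have "x \<in> D" "u x \<le> m - inverse (real (Suc i))" using x by blast+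
        ultimately have "u x \<le> m - inverse (real (Suc j))" by linarith
        with \<open>x \<in> D\<close> show "x \<in> D \<inter> {x. u x \<le> m - inverse (real (Suc j))}" by blast
      qed
      show "emeasure lborel (\<Union>k. D \<inter> {x. u x \<le> m - inverse (real (Suc k))}) \<noteq> \<infinity>"
        using finD[of "\<Union>k. {x. u x \<le> m - inverse (real (Suc k))}"] by simp
    qed auto
    then have "measure lborel (\<Union>k. D \<inter> {x. u x \<le> m - inverse (real (Suc k))}) \<le> ?V / 2"
    proof (rule LIMSEQ_le_const2)
      have "measure lborel (D \<inter> {x. u x \<le> m - inverse (real (Suc k))}) \<le> ?V / 2" for k
        using below[of "m - inverse (real (Suc k))"] unfolding compl by simp
      then show "\<exists>N. \<forall>k\<ge>N. measure lborel (D \<inter> {x. u x \<le> m - inverse (real (Suc k))}) \<le> ?V / 2" by blast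
    qed
    moreover have "(\<Union>k. D \<inter> {x. u x \<le> m - inverse (real (Suc k))}) = D \<inter> {x. u x < m}"
    proof -
      have "(\<exists>k. u x \<le> m - inverse (real (Suc k))) \<longleftrightarrow> u x < m" for x
      proof
        assume "u x < m"
        then show "\<exists>k. u x \<le> m - inverse (real (Suc k))"
        proof -
          obtain k where "inverse (real (Suc k)) < m - u x"
            using reals_Archimedean[of "m - u x"] \<open>u x < m\<close> by auto
          then have "u x \<le> m - inverse (real (Suc k))" by linarith
          then show ?thesis by blast
        qed
      next
        assume "\<exists>k. u x \<le> m - inverse (real (Suc k))"
        then obtain k where "u x \<le> m - inverse (real (Suc k))" by blast
        moreover have "0 < inverse (real (Suc k))" by simp
        ultimately show "u x < m" by linarith
      qed
      then show ?thesis by blast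
    qed
    ultimately show "measure lborel (D \<inter> {x. u x < m}) \<le> ?V / 2" by simp
  qed
qed

text \<open>If the lower and upper limits differ, the function crosses some interval between them
  infinitely often. Rational end points suffice, which later makes the family of oscillating sets
  countable.\<close>

lemma filter_limit_trichotomy:
  fixes f :: "'a \<Rightarrow> real"
  assumes F: "F \<noteq> bot"
    and no_osc: "\<And>a b :: rat. a < b \<Longrightarrow>
      \<not> ((\<exists>\<^sub>F x in F. f x < of_rat a) \<and> (\<exists>\<^sub>F x in F. of_rat b < f x))"
  obtains (finite) c where "(f \<longlongrightarrow> c) F" | (top) "filterlim f at_top F" | (bot) "filterlim f at_bot F"
proof -
  let ?f = "\<lambda>x. ereal (f x)"
  have le: "Liminf F ?f \<le> Limsup F ?f" by (rule Liminf_le_Limsup[OF F])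
  have "Liminf F ?f = Limsup F ?f"
  proof (rule ccontr)
    assume "Liminf F ?f \<noteq> Limsup F ?f"
    with le have "Liminf F ?f < Limsup F ?f" by simp
    \<comment> \<open>Two reals z1 < z2 are placed in the gap first, so that both rationals lie
      strictly between them and hence strictly between the two limits.\<close>
    then obtain z1 where z1: "Liminf F ?f < ereal z1" "ereal z1 < Limsup F ?f"
      using ereal_dense2 by blast
    obtain z2 where z2: "ereal z1 < ereal z2" "ereal z2 < Limsup F ?f"
      using ereal_dense2[OF z1(2)] by blast
    have "z1 < z2" using z2(1) by simp
    then obtain a where a: "z1 < of_rat a" "of_rat a < z2" using of_rat_dense by blast
    obtain b where b: "of_rat a < (of_rat b :: real)" "of_rat b < z2" using of_rat_dense[OF a(2)] by blast
    have "\<exists>\<^sub>F x in F. f x < of_rat a"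
    proof (rule ccontr)
      assume "\<not> ?thesis"
      then have "eventually (\<lambda>x. ereal (of_rat a) \<le> ?f x) F"
        by (simp add: not_frequently not_less)
      then have "ereal (of_rat a) \<le> Liminf F ?f" by (rule Liminf_bounded)
      then have "ereal (of_rat a) < ereal z1" using z1(1) by (rule order_le_less_trans)
      with a show False by simp
    qed
    moreover have "\<exists>\<^sub>F x in F. of_rat b < f x"
    proof (rule ccontr)
      assume "\<not> ?thesis"
      then have "eventually (\<lambda>x. ?f x \<le> ereal (of_rat b)) F"
        by (simp add: not_frequently not_less)
      then have "Limsup F ?f \<le> ereal (of_rat b)" by (rule Limsup_bounded)
      with z2(2) have "ereal z2 < ereal (of_rat b)" by (rule order_less_le_trans)
      with b show False by simp
    qed
    ultimately show False using no_osc[of a b] b(1) by (simp add: of_rat_less)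
  qed
  then have lim: "(?f \<longlongrightarrow> Liminf F ?f) F"
    using tendsto_iff_Liminf_eq_Limsup[OF F, of ?f] by simp
  show ?thesis
  proof (cases "Liminf F ?f")
    case (real c)
    then show ?thesis using lim finite by simp
  next
    case PInf
    then show ?thesis using lim top by (simp add: tendsto_PInfty filterlim_at_top_dense)
  next
    case MInf
    then show ?thesis using lim bot by (simp add: tendsto_MInfty filterlim_at_bot_dense)
  qed
qed

section \<open>Lebesgue values and full density of level sets\<close>

context increment_bounded
begin

definition lebesgue_value :: "real ^ 'n \<Rightarrow> real \<Rightarrow> bool" where
  "lebesgue_value y c \<longleftrightarrow> ((\<lambda>r. avg (\<lambda>x. \<bar>u x - c\<bar>) y r) \<longlongrightarrow> 0) (at_right 0)"

text \<open>The comparison value c may depend on the radius. This covers both a Lebesgue value,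
  where c is constant, and diverging averages, where c is the average over the ball.\<close>

lemma full_density_superlevelI:
  assumes y: "y \<in> D"
    and ev: "\<And>\<delta>. 0 < \<delta> \<Longrightarrow> eventually (\<lambda>r. \<exists>c>t. avg (\<lambda>x. \<bar>u x - c\<bar>) y r \<le> (c - t) * \<delta>) (at_right 0)"
  shows "full_density {x. t < u x} y"
  unfolding full_density_def
proof (rule tendstoI)
  fix e :: real assume e: "0 < e"
  let ?\<delta> = "e / (2 * unit_ball_vol (real CARD('n)))"
  have "0 < ?\<delta>" using e by simp
  from ev[OF this] eventually_cball_subset[OF D_open y] eventually_at_right_pos
  show "eventually (\<lambda>r. dist (measure lborel (ball y r - {x. t < u x}) / r ^ DIM(real ^ 'n)) 0 < e) (at_right 0)"
  proof eventually_elim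
    case (elim r)
    then obtain c where c: "t < c" "avg (\<lambda>x. \<bar>u x - c\<bar>) y r \<le> (c - t) * ?\<delta>" by blast
    have "measure lborel (ball y r - {x. t < u x}) \<le> unit_ball_vol (real CARD('n)) * r ^ CARD('n) * ?\<delta>"
      by (rule sublevel_small[OF elim(3,2) c])
    also have "\<dots> = r ^ CARD('n) * (e / 2)" by simp
    finally have le: "measure lborel (ball y r - {x. t < u x}) \<le> r ^ CARD('n) * (e / 2)" .
    have "measure lborel (ball y r - {x. t < u x}) / r ^ CARD('n) \<le> e / 2"
      using le elim(3) by (simp add: pos_divide_le_eq mult.commute)
    also have "\<dots> < e" using e by simp
    finally show ?case using elim(3) by simp
  qed
qed

lemma full_density_if_lebesgue_value:
  assumes "y \<in> D" "lebesgue_value y c" "t < c"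
  shows "full_density {x. t < u x} y"
proof (rule full_density_superlevelI[OF assms(1)])
  fix \<delta> :: real assume "0 < \<delta>"
  then have "eventually (\<lambda>r. avg (\<lambda>x. \<bar>u x - c\<bar>) y r < (c - t) * \<delta>) (at_right 0)"
    using assms(2,3) unfolding lebesgue_value_def by (intro order_tendstoD) auto
  then show "eventually (\<lambda>r. \<exists>c>t. avg (\<lambda>x. \<bar>u x - c\<bar>) y r \<le> (c - t) * \<delta>) (at_right 0)"
    by eventually_elim (use assms(3) in \<open>auto intro!: exI[of _ c]\<close>)
qed

lemma full_density_if_avg_at_top:
  assumes "y \<in> D" "(osc y \<longlongrightarrow> 0) (at_right 0)" "filterlim (avg u y) at_top (at_right 0)"
  shows "full_density {x. t < u x} y"
proof (rule full_density_superlevelI[OF assms(1)])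
  fix \<delta> :: real assume \<delta>: "0 < \<delta>"
  have "eventually (\<lambda>r. t + 1 < avg u y r) (at_right 0)"
    using assms(3) by (simp add: filterlim_at_top_dense)
  moreover have "eventually (\<lambda>r. osc y r < \<delta>) (at_right 0)"
    using assms(2) \<delta> by (intro order_tendstoD) auto
  ultimately show "eventually (\<lambda>r. \<exists>c>t. avg (\<lambda>x. \<bar>u x - c\<bar>) y r \<le> (c - t) * \<delta>) (at_right 0)"
  proof eventually_elim
    case (elim r)
    have "avg (\<lambda>x. \<bar>u x - avg u y r\<bar>) y r \<le> 1 * \<delta>" using elim(2) by (simp add: osc_def)
    also have "\<dots> \<le> (avg u y r - t) * \<delta>" using elim(1) \<delta> by (intro mult_right_mono) auto
    finally show ?case using elim(1) by (intro exI[of _ "avg u y r"]) auto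
  qed
qed

lemma lebesgue_value_if_avg_tendsto:
  assumes y: "y \<in> D" and "(osc y \<longlongrightarrow> 0) (at_right 0)" "(avg u y \<longlongrightarrow> c) (at_right 0)"
  shows "lebesgue_value y c"
  unfolding lebesgue_value_def
proof (rule tendsto_sandwich[where f = "\<lambda>_. 0" and h = "\<lambda>r. osc y r + \<bar>avg u y r - c\<bar>"])
  show "((\<lambda>r. osc y r + \<bar>avg u y r - c\<bar>) \<longlongrightarrow> 0) (at_right 0)"
    using tendsto_add[OF assms(2) tendsto_rabs[OF tendsto_diff[OF assms(3) tendsto_const[of c]]]] by simp
  show "eventually (\<lambda>r. avg (\<lambda>x. \<bar>u x - c\<bar>) y r \<le> osc y r + \<bar>avg u y r - c\<bar>) (at_right 0)"
    using eventually_cball_subset[OF D_open y] eventually_at_right_pos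
    by eventually_elim (rule avg_abs_diff_triangle)
  show "eventually (\<lambda>r. 0 \<le> avg (\<lambda>x. \<bar>u x - c\<bar>) y r) (at_right 0)"
    using eventually_cball_subset[OF D_open y] eventually_at_right_pos
    by eventually_elim (rule avg_nonneg, auto)
qed simp

text \<open>Once \<open>osc\<close> tends to 0, the averages converge, oscillate across a rational
  interval, or diverge to infinity; a finite limit of the averages is then a Lebesgue value.\<close>

lemma no_lebesgue_value_cases:
  "{y \<in> D. \<nexists>c. lebesgue_value y c} \<subseteq> unsettled_points \<union>
     (\<Union>(a, b)\<in>{(a, b :: rat). a < b}. oscillating_points (of_rat a) (of_rat b)) \<union>
     (divergent_points at_top) \<union>
     (divergent_points at_bot)"
  (is "_ \<subseteq> ?A \<union> ?B \<union> ?C \<union> ?E")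
proof (rule subsetI, rule ccontr)
  fix y assume y: "y \<in> {y \<in> D. \<nexists>c. lebesgue_value y c}" "y \<notin> ?A \<union> ?B \<union> ?C \<union> ?E"
  then have osc: "y \<in> D" "(osc y \<longlongrightarrow> 0) (at_right 0)" by auto
  have no: "\<not> ((\<exists>\<^sub>F r in at_right 0. avg u y r < of_rat a) \<and> (\<exists>\<^sub>F r in at_right 0. of_rat b < avg u y r))"
    if "a < b" for a b :: rat
    using y(2) osc that by blast
  show False
  proof (rule filter_limit_trichotomy[OF trivial_limit_at_right_real no])
    fix c assume "(avg u y \<longlongrightarrow> c) (at_right 0)"
    then show False using lebesgue_value_if_avg_tendsto[OF osc] y(1) by blast
  qed (use y(2) osc in auto)
qed

end

text \<open>The constant of \<open>content_full_density_le_perimeter\<close>: the Vitali factor with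
  its 6, times the isoperimetric factor 2 6^(n+1) / (\<theta> \<kappa>^2) for \<theta> = (1/2)^(n+1)
  and \<kappa> = \<open>unit_ball_vol n / (2 * K) ^ n\<close>.\<close>

definition density_constant :: "nat \<Rightarrow> real \<Rightarrow> real" where
  "density_constant n K = unit_ball_vol (real n - 1) * 6 powr (real n - 1) *
      (2 * 6 ^ Suc n / ((1 / 2) ^ Suc n * (unit_ball_vol (real n) / (2 * K) ^ n)\<^sup>2))"

lemma density_constant_pos:
  assumes "2 \<le> n" "1 \<le> K" shows "0 < density_constant n K"
  using assms by (auto simp: density_constant_def intro!: mult_pos_pos divide_pos_pos zero_less_power)

section \<open>The Choquet estimate on convex sets comparable to a ball\<close>

locale increment_bounded_convex = increment_bounded D u \<gamma>
  for D :: "(real ^ 'n) set" and u \<gamma> +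
  fixes x0 :: "real ^ 'n" and r K :: real
  assumes D_convex: "convex D" and r: "0 < r" and K: "1 \<le> K"
    and inner_ball: "ball x0 r \<subseteq> D" and outer_ball: "D \<subseteq> ball x0 (K * r)"
begin

lemma uminus_convex: "increment_bounded_convex D (\<lambda>x. - u x) \<gamma> x0 r K"
  by (intro increment_bounded_convex.intro uminus increment_bounded_convex_axioms.intro
      D_convex r K inner_ball outer_ball)

lemma content_le_perimeter:
  assumes half: "measure lborel (D \<inter> {x. m < u x}) \<le> measure lborel D / 2" and t: "m \<le> t"
    and S: "S \<subseteq> D" "\<And>y. y \<in> S \<Longrightarrow> full_density {x. t < u x} y"
  shows "hausdorff_content (real CARD('n) - 1) S \<le> ennreal (density_constant CARD('n) K) * perimeter {x. t < u x} D"
  unfolding density_constant_def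
proof (rule content_full_density_le_perimeter[OF dim _ D_open D_convex inner_ball outer_ball r K _ S refl])
  have "measure lborel (D \<inter> {x. t < u x}) \<le> measure lborel (D \<inter> {x. m < u x})"
  proof (rule measure_mono_fmeasurable)
    have "emeasure lborel (D \<inter> {x. m < u x}) \<le> emeasure lborel (ball x0 (K * r))"
      using outer_ball by (intro emeasure_mono) auto
    also have "\<dots> < \<infinity>" using r K by (simp add: emeasure_ball)
    finally show "D \<inter> {x. m < u x} \<in> fmeasurable lborel"
      using D_open by (intro fmeasurableI) auto
  qed (use t D_open in auto)
  then show "measure lborel (D \<inter> {x. t < u x}) \<le> measure lborel D / 2" using half by simp
qed auto

text \<open>These points have full density in every superlevel set, so any level above the median
  may be used. Between m and m + L some level has perimeter at most of order 1/L, and L is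
  arbitrary.\<close>

lemma content_avg_at_top:
  assumes half: "measure lborel (D \<inter> {x. m < u x}) \<le> measure lborel D / 2"
  shows "hausdorff_content (real CARD('n) - 1)
     (divergent_points at_top) = 0"
    (is "hausdorff_content _ ?S = 0")
proof -
  obtain X where X: "energy D = ennreal X" "0 \<le> X"
    using finite_energy by (cases "energy D") auto
  let ?\<omega> = "unit_ball_vol (real CARD('n))"
  have density_pos: "0 \<le> density_constant CARD('n) K" using density_constant_pos[OF dim K] by simp
  have bound: "hausdorff_content (real CARD('n) - 1) ?S \<le> 0 + ennreal e" if e: "0 < e" for e
  proof -
    \<comment> \<open>This choice turns the final bound into e. The summand 1 in X + 1 is the
      \<epsilon> of \<open>exists_level_small_perimeter\<close>.\<close>
    define L where "L = (density_constant CARD('n) K + 1) * ?\<omega> * (X + 1) / e"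
    have L: "0 < L" using density_pos X(2) e by (simp add: L_def)
    obtain t where t: "m < t" "t < m + L"
      "perimeter {x. t < u x} D \<le> ennreal (?\<omega> / (m + L - m)) * (energy D + ennreal 1)"
      using exists_level_small_perimeter[OF D_open order_refl, of m "m + L" 1] L by auto
    have "hausdorff_content (real CARD('n) - 1) ?S \<le> ennreal (density_constant CARD('n) K) * perimeter {x. t < u x} D"
      using t(1) by (intro content_le_perimeter[OF half]) (auto intro: full_density_if_avg_at_top)
    also have "\<dots> \<le> ennreal (density_constant CARD('n) K) * (ennreal (?\<omega> / (m + L - m)) * (energy D + ennreal 1))"
      by (rule mult_left_mono[OF t(3)]) simp
    also have "\<dots> = ennreal (density_constant CARD('n) K) * (ennreal (?\<omega> / L) * ennreal (X + 1))"
      using X by (subst ennreal_plus) auto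
    also have "\<dots> = ennreal (density_constant CARD('n) K * (?\<omega> / L * (X + 1)))"
    proof -
      have "ennreal (density_constant CARD('n) K) * (ennreal (?\<omega> / L) * ennreal (X + 1)) =
          ennreal (density_constant CARD('n) K) * ennreal (?\<omega> / L * (X + 1))"
        using X(2) L by (subst ennreal_mult) auto
      also have "\<dots> = ennreal (density_constant CARD('n) K * (?\<omega> / L * (X + 1)))"
        using X(2) L density_pos by (intro ennreal_mult[symmetric]) auto
      finally show ?thesis .
    qed
    also have "\<dots> \<le> ennreal e"
    proof (rule ennreal_leI)
      have "density_constant CARD('n) K * (?\<omega> / L * (X + 1)) \<le> (density_constant CARD('n) K + 1) * (?\<omega> / L * (X + 1))"
        using X(2) L by (intro mult_right_mono) auto
      also have "\<dots> = ((density_constant CARD('n) K + 1) * ?\<omega> * (X + 1)) / L" by simp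
      also have "\<dots> = e" using e density_pos X(2) by (simp add: L_def add_nonneg_eq_0_iff)
      finally show "density_constant CARD('n) K * (?\<omega> / L * (X + 1)) \<le> e" .
    qed
    finally show ?thesis by simp
  qed
  have "hausdorff_content (real CARD('n) - 1) ?S \<le> 0"
    by (rule ennreal_le_epsilon) (rule bound)
  then show ?thesis by simp
qed

text \<open>The majorant p, a multiple of the perimeter of the shifted level, is kept because it is
  measurable in t. The bounds for upper and lower level sets can then be added under the
  integral.\<close>

lemma nn_integral_content_le:
  assumes half: "measure lborel (D \<inter> {x. m < u x}) \<le> measure lborel D / 2"
  shows "\<exists>p. p \<in> borel_measurable borel \<and>
    (\<forall>t\<ge>0. hausdorff_content (real CARD('n) - 1) {y \<in> D. \<exists>c. lebesgue_value y c \<and> m + t < c} \<le> p t) \<and>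
    (\<integral>\<^sup>+ t. p t \<partial>lborel) \<le> ennreal (density_constant CARD('n) K * unit_ball_vol (real CARD('n))) * energy D"
proof -
  let ?P = "\<lambda>t. perimeter {x. t < u x} D"
  note coarea = perimeter_coarea[OF u_borel D_open increment[OF D_open order_refl]]
  have [measurable]: "?P \<in> borel_measurable borel" by (rule coarea(2))
  have density_pos: "0 \<le> density_constant CARD('n) K" using density_constant_pos[OF dim K] by simp
  have "(\<integral>\<^sup>+ t. ennreal (density_constant CARD('n) K) * ?P (t + m) \<partial>lborel) = ennreal (density_constant CARD('n) K) * (\<integral>\<^sup>+ t. ?P (t + m) \<partial>lborel)"
    by (rule nn_integral_cmult) measurable
  also have "(\<integral>\<^sup>+ t. ?P (t + m) \<partial>lborel) = (\<integral>\<^sup>+ t. ?P t \<partial>lborel)"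
    by (rule nn_integral_lborel_shift) measurable
  also have "ennreal (density_constant CARD('n) K) * (\<integral>\<^sup>+ t. ?P t \<partial>lborel) \<le> ennreal (density_constant CARD('n) K) * (ennreal (unit_ball_vol (real DIM(real ^ 'n))) * energy D)"
    by (intro mult_left_mono coarea(1)) simp
  also have "\<dots> = ennreal (density_constant CARD('n) K * unit_ball_vol (real CARD('n))) * energy D"
    using density_pos by (simp add: ennreal_mult mult.assoc)
  finally have "(\<integral>\<^sup>+ t. ennreal (density_constant CARD('n) K) * ?P (t + m) \<partial>lborel) \<le> ennreal (density_constant CARD('n) K * unit_ball_vol (real CARD('n))) * energy D" .
  moreover have "hausdorff_content (real CARD('n) - 1) {y \<in> D. \<exists>c. lebesgue_value y c \<and> m + t < c} \<le> ennreal (density_constant CARD('n) K) * ?P (t + m)"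
    if "0 \<le> t" for t
    using that by (intro content_le_perimeter[OF half])
      (auto simp: add.commute intro: full_density_if_lebesgue_value)
  ultimately show ?thesis
    by (intro exI[of _ "\<lambda>t. ennreal (density_constant CARD('n) K) * ?P (t + m)"]) auto
qed

text \<open>At a point with Lebesgue value c, |c - m| > t means c > m + t or -c > -m + t, and a
  median of u is, up to sign, a median of -u. The two cases give the factor 2. At the other points
  \<open>v\<close> is arbitrary, but they have content zero and so do not affect any level
  t.\<close>

lemma choquet_integral_le:
  assumes v: "\<And>y c. y \<in> D \<Longrightarrow> lebesgue_value y c \<Longrightarrow> v y = c"
  shows "\<exists>m. choquet_integral (real CARD('n) - 1) D (\<lambda>y. ennreal \<bar>v y - m\<bar>) \<le>
    ennreal (2 * density_constant CARD('n) K * unit_ball_vol (real CARD('n))) * energy D"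
proof -
  interpret neg: increment_bounded_convex D "\<lambda>x. - u x" \<gamma> x0 r K
    by (rule uminus_convex)
  let ?b = "real CARD('n) - 1"
  let ?X = "energy D"
  have b: "0 < ?b" using dim by simp
  have density_pos: "0 \<le> density_constant CARD('n) K" using density_constant_pos[OF dim K] by simp
  have D_borel: "D \<in> sets borel" using D_open by simp
  have "emeasure lborel D \<le> emeasure lborel (ball x0 (K * r))"
    using outer_ball by (intro emeasure_mono) auto
  also have "\<dots> < \<infinity>" using r K by (simp add: emeasure_ball)
  finally have fin: "emeasure lborel D < \<infinity>" .
  have "0 < measure lborel (ball x0 r)" using r by (simp add: content_ball)
  also have "\<dots> \<le> measure lborel D"
    using inner_ball fin D_borel by (intro measure_mono_fmeasurable) (auto intro: fmeasurableI)
  finally have pos: "0 < measure lborel D" .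
  obtain m where m: "measure lborel (D \<inter> {x. m < u x}) \<le> measure lborel D / 2"
      "measure lborel (D \<inter> {x. u x < m}) \<le> measure lborel D / 2"
    using exists_median[OF u_borel D_borel fin pos] by blast
  have m': "measure lborel (D \<inter> {x. - m < - u x}) \<le> measure lborel D / 2"
    using m(2) by simp
  \<comment> \<open>The interpretation for -u has its own averages, oscillations and Lebesgue
    values; these identities translate them back to those of u.\<close>
  have avg_neg: "neg.avg (\<lambda>x. - u x) y s = - avg u y s" for y s
    by (simp add: neg.avg_def avg_def)
  have avg_abs_neg: "neg.avg (\<lambda>x. \<bar>- u x - c\<bar>) y s = avg (\<lambda>x. \<bar>u x - (- c)\<bar>) y s" for y s c
  proof -
    have "\<bar>- u x - c\<bar> = \<bar>u x - (- c)\<bar>" for x by linarith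
    then show ?thesis by (simp add: neg.avg_def avg_def)
  qed
  have osc_neg: "neg.osc = osc"
    by (intro ext) (simp only: neg.osc_def osc_def avg_neg avg_abs_neg minus_minus)
  have value_neg: "neg.lebesgue_value y c \<longleftrightarrow> lebesgue_value y (- c)" for y c
    by (simp only: neg.lebesgue_value_def lebesgue_value_def avg_abs_neg)
  obtain p where p: "p \<in> borel_measurable borel"
    "\<And>t. 0 \<le> t \<Longrightarrow> hausdorff_content ?b {y \<in> D. \<exists>c. lebesgue_value y c \<and> m + t < c} \<le> p t"
    "(\<integral>\<^sup>+ t. p t \<partial>lborel) \<le> ennreal (density_constant CARD('n) K * unit_ball_vol (real CARD('n))) * ?X"
    using nn_integral_content_le[OF m(1)] by blast
  obtain q where q: "q \<in> borel_measurable borel"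
    "\<And>t. 0 \<le> t \<Longrightarrow> hausdorff_content ?b {y \<in> D. \<exists>c. neg.lebesgue_value y c \<and> - m + t < c} \<le> q t"
    "(\<integral>\<^sup>+ t. q t \<partial>lborel) \<le> ennreal (density_constant CARD('n) K * unit_ball_vol (real CARD('n))) * ?X"
    using neg.nn_integral_content_le[OF m'] by blast
  define N where "N = {y \<in> D. \<nexists>c. lebesgue_value y c}"
  have N: "hausdorff_content ?b N = 0"
  proof -
    let ?A = "unsettled_points"
    let ?B = "\<Union>(a, b)\<in>{(a, b :: rat). a < b}. oscillating_points (of_rat a) (of_rat b)"
    let ?C = "(divergent_points at_top)"
    let ?E = "(divergent_points at_bot)"
    have A: "hausdorff_content ?b ?A = 0" by (rule content_not_osc_tendsto_0)
    have B: "hausdorff_content ?b ?B = 0"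
    proof (rule hausdorff_content_UN_null[OF b])
      fix i :: "rat \<times> rat" assume "i \<in> {(a, b). a < b}"
      then show "hausdorff_content ?b (case i of (a, b) \<Rightarrow> oscillating_points (of_rat a) (of_rat b)) = 0"
        by (cases i) (auto intro!: content_oscillating_averages simp: of_rat_less)
    qed (rule countableI_type)
    have C: "hausdorff_content ?b ?C = 0" by (rule content_avg_at_top[OF m(1)])
    have "filterlim (avg u y) at_bot (at_right 0) \<longleftrightarrow> filterlim (\<lambda>s. - avg u y s) at_top (at_right 0)" for y
      by (simp add: filterlim_uminus_at_bot)
    then have E: "hausdorff_content ?b ?E = 0"
      using neg.content_avg_at_top[OF m'] unfolding osc_neg avg_neg by simp
    have "hausdorff_content ?b N \<le> hausdorff_content ?b (?A \<union> ?B \<union> ?C \<union> ?E)"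
      unfolding N_def by (intro hausdorff_content_mono no_lebesgue_value_cases)
    also have "\<dots> \<le> hausdorff_content ?b ?A + hausdorff_content ?b ?B + hausdorff_content ?b ?C + hausdorff_content ?b ?E"
      by (intro order_trans[OF hausdorff_content_Un_le[OF b]] add_mono order_refl)
    also have "\<dots> = 0" unfolding A B C E by simp
    finally show ?thesis by simp
  qed
  have content: "hausdorff_content ?b {y \<in> D. ennreal t < ennreal \<bar>v y - m\<bar>} \<le> p t + q t" if t: "0 \<le> t" for t
  proof -
    let ?P = "{y \<in> D. \<exists>c. lebesgue_value y c \<and> m + t < c}"
    let ?Q = "{y \<in> D. \<exists>c. neg.lebesgue_value y c \<and> - m + t < c}"
    have "{y \<in> D. ennreal t < ennreal \<bar>v y - m\<bar>} \<subseteq> ?P \<union> ?Q \<union> N"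
    proof
      fix y assume "y \<in> {y \<in> D. ennreal t < ennreal \<bar>v y - m\<bar>}"
      then have y: "y \<in> D" "t < \<bar>v y - m\<bar>" using t by (auto simp: ennreal_less_iff)
      show "y \<in> ?P \<union> ?Q \<union> N"
      proof (cases "\<exists>c. lebesgue_value y c")
        case True
        then obtain c where c: "lebesgue_value y c" by blast
        with y v have "t < \<bar>c - m\<bar>" by metis
        then consider "m + t < c" | "- m + t < - c" by linarith
        then show ?thesis
        proof cases
          case 1
          then show ?thesis using y c by blast
        next
          case 2
          moreover have "neg.lebesgue_value y (- c)" using c by (simp add: value_neg)
          ultimately show ?thesis using y by blast
        qed
      qed (use y in \<open>auto simp: N_def\<close>)
    qed
    then have "hausdorff_content ?b {y \<in> D. ennreal t < ennreal \<bar>v y - m\<bar>} \<le> hausdorff_content ?b (?P \<union> ?Q \<union> N)"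
      by (rule hausdorff_content_mono)
    also have "\<dots> \<le> hausdorff_content ?b ?P + hausdorff_content ?b ?Q + hausdorff_content ?b N"
      by (intro order_trans[OF hausdorff_content_Un_le[OF b]] add_mono order_refl)
    also have "\<dots> \<le> p t + q t + 0"
      using N by (intro add_mono p(2) q(2) t) auto
    finally show ?thesis by simp
  qed
  have "choquet_integral ?b D (\<lambda>y. ennreal \<bar>v y - m\<bar>) \<le> (\<integral>\<^sup>+ t. p t + q t \<partial>lborel)"
    unfolding choquet_integral_def using content
    by (intro nn_integral_mono) (auto simp: indicator_def)
  also have "\<dots> = (\<integral>\<^sup>+ t. p t \<partial>lborel) + (\<integral>\<^sup>+ t. q t \<partial>lborel)"
    using p(1) q(1) by (intro nn_integral_add) auto
  also have "\<dots> \<le> ennreal (density_constant CARD('n) K * unit_ball_vol (real CARD('n))) * ?X + ennreal (density_constant CARD('n) K * unit_ball_vol (real CARD('n))) * ?X"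
    by (intro add_mono p(3) q(3))
  also have "\<dots> = ennreal (2 * density_constant CARD('n) K * unit_ball_vol (real CARD('n))) * ?X"
  proof -
    have "ennreal (2 * density_constant CARD('n) K * unit_ball_vol (real CARD('n))) =
        ennreal (density_constant CARD('n) K * unit_ball_vol (real CARD('n))) + ennreal (density_constant CARD('n) K * unit_ball_vol (real CARD('n)))"
      using density_pos by (subst ennreal_plus[symmetric]) auto
    then show ?thesis by (simp add: distrib_right)
  qed
  finally show ?thesis by blast
qed

end

subsection \<open>The precise representative\<close>

text \<open>Values outside \<Omega> are arbitrary, so measurability is available only after cutting
  off to \<Omega>; it follows as a limit of cut-offs to an exhausting sequence of compact
  sets.\<close>

lemma locally_integrable_borel_version:
  fixes f :: "real ^ 'n \<Rightarrow> real"
  assumes \<Omega>: "open \<Omega>" and f: "locally_integrable \<Omega> f"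
  obtains f' where "f' \<in> borel_measurable borel" "AE x in lborel. x \<in> \<Omega> \<longrightarrow> f x = f' x"
    "\<And>x. x \<notin> \<Omega> \<Longrightarrow> f' x = 0" "(\<lambda>x. indicator \<Omega> x * f x) \<in> borel_measurable lebesgue"
proof -
  obtain C where C: "\<And>n. compact (C n)" "\<And>n. C n \<subseteq> \<Omega>" "\<And>n. C n \<subseteq> interior (C (Suc n))"
      "\<Union>(range C) = \<Omega>"
    using open_Union_compact_subsets[OF \<Omega>] by metis
  have "incseq C" using C(3) interior_subset by (intro incseq_SucI) blast
  have meas: "(\<lambda>x. indicator \<Omega> x * f x) \<in> borel_measurable lebesgue"
  proof (rule borel_measurable_LIMSEQ_real)
    fix k
    have "f absolutely_integrable_on C k" using f C(1,2) by (simp add: locally_integrable_def)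
    then show "(\<lambda>x. indicator (C k) x * f x) \<in> borel_measurable lebesgue"
      unfolding set_integrable_def by (auto dest: borel_measurable_integrable)
  next
    fix x
    show "(\<lambda>k. indicator (C k) x * f x) \<longlonglongrightarrow> indicator \<Omega> x * f x"
      using LIMSEQ_indicator_incseq[OF \<open>incseq C\<close>, of x] C(4) by (intro tendsto_mult_right) simp
  qed
  then obtain f'' where f'': "f'' \<in> borel_measurable lborel" "AE x in lborel. indicator \<Omega> x * f x = f'' x"
    using completion_ex_borel_measurable_real by blast
  show ?thesis
  proof (rule that[of "\<lambda>x. indicator \<Omega> x * f'' x"])
    show "(\<lambda>x. indicator \<Omega> x * f'' x) \<in> borel_measurable borel" using f''(1) \<Omega> by auto
    show "AE x in lborel. x \<in> \<Omega> \<longrightarrow> f x = indicator \<Omega> x * f'' x"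
      using f''(2) by eventually_elim auto
  qed (use meas in auto)
qed

lemma integrable_lebesgue_imp_lborel:
  fixes f f' :: "real ^ 'n \<Rightarrow> real"
  assumes "integrable lebesgue f" "AE x in lborel. f x = f' x" "f' \<in> borel_measurable borel"
  shows "integrable lborel f'"
proof -
  have "AE x in lebesgue. f x = f' x" using assms(2) by (rule AE_completion)
  moreover have "f' \<in> borel_measurable lebesgue" using assms(3) by (simp add: measurable_completion)
  ultimately have "integrable lebesgue f'"
    using assms(1) integrable_cong_AE[of f lebesgue f'] by (auto dest: borel_measurable_integrable)
  then show ?thesis using assms(3) by (simp add: integrable_completion)
qed

lemma integral_lebesgue_eq_lborel:
  fixes f f' :: "real ^ 'n \<Rightarrow> real"
  assumes "f \<in> borel_measurable lebesgue" "AE x in lborel. f x = f' x" "f' \<in> borel_measurable borel"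
  shows "integral\<^sup>L lebesgue f = integral\<^sup>L lborel f'"
proof -
  have "AE x in lebesgue. f x = f' x" using assms(2) by (rule AE_completion)
  moreover have "f' \<in> borel_measurable lebesgue" using assms(3) by (simp add: measurable_completion)
  ultimately have "integral\<^sup>L lebesgue f = integral\<^sup>L lebesgue f'"
    using assms(1) by (intro integral_cong_AE) auto
  then show ?thesis using assms(3) by (simp add: integral_completion)
qed

text \<open>The gradient is replaced componentwise. All Borel versions vanish outside \<Omega>,
  which turns the set integrals of the weak gradient identity into integrals over the whole
  space.\<close>

lemma sobolev_function_borel_version:
  fixes \<Omega> :: "(real ^ 'n) set"
  assumes \<Omega>: "open \<Omega>" and u: "u \<in> W11_loc \<Omega>" and g: "is_weak_gradient \<Omega> u g"
  obtains u' g' where "sobolev_function \<Omega> u' g'" "AE x in lborel. x \<in> \<Omega> \<longrightarrow> u x = u' x"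
    "AE x in lborel. x \<in> \<Omega> \<longrightarrow> g x = g' x" "(\<lambda>x. indicator \<Omega> x * u x) \<in> borel_measurable lebesgue"
proof -
  have u_loc: "locally_integrable \<Omega> u" using u by (simp add: W11_loc_def)
  have g_loc: "locally_integrable \<Omega> g" using g by (simp add: is_weak_gradient_def)
  have \<Omega>_borel: "\<Omega> \<in> sets borel" using \<Omega> by simp
  obtain u' where u': "u' \<in> borel_measurable borel" "AE x in lborel. x \<in> \<Omega> \<longrightarrow> u x = u' x"
      "\<And>x. x \<notin> \<Omega> \<Longrightarrow> u' x = 0" "(\<lambda>x. indicator \<Omega> x * u x) \<in> borel_measurable lebesgue"
    using locally_integrable_borel_version[OF \<Omega> u_loc] by blast
  have gi_loc: "locally_integrable \<Omega> (\<lambda>x. g x $ i)" for i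
    unfolding locally_integrable_def
  proof (intro allI impI)
    fix K assume "compact K \<and> K \<subseteq> \<Omega>"
    then have "g absolutely_integrable_on K" using g_loc by (simp add: locally_integrable_def)
    then have "(\<lambda>x. g x \<bullet> axis i 1) absolutely_integrable_on K"
      by (rule absolutely_integrable_component)
    then show "(\<lambda>x. g x $ i) absolutely_integrable_on K" by (simp add: cart_eq_inner_axis)
  qed
  have "\<exists>h. h \<in> borel_measurable borel \<and> (AE x in lborel. x \<in> \<Omega> \<longrightarrow> g x $ i = h x) \<and>
      (\<forall>x. x \<notin> \<Omega> \<longrightarrow> h x = 0) \<and> (\<lambda>x. indicator \<Omega> x * g x $ i) \<in> borel_measurable lebesgue" for i
    by (rule locally_integrable_borel_version[OF \<Omega> gi_loc[of i]]) blast
  then have "\<forall>i. \<exists>h. h \<in> borel_measurable borel \<and> (AE x in lborel. x \<in> \<Omega> \<longrightarrow> g x $ i = h x) \<and>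
      (\<forall>x. x \<notin> \<Omega> \<longrightarrow> h x = 0) \<and> (\<lambda>x. indicator \<Omega> x * g x $ i) \<in> borel_measurable lebesgue" by blast
  then obtain h where h: "\<forall>i. h i \<in> borel_measurable borel \<and> (AE x in lborel. x \<in> \<Omega> \<longrightarrow> g x $ i = h i x) \<and>
      (\<forall>x. x \<notin> \<Omega> \<longrightarrow> h i x = 0) \<and> (\<lambda>x. indicator \<Omega> x * g x $ i) \<in> borel_measurable lebesgue"
    by (rule choice[THEN exE])
  define g' where "g' x = (\<chi> i. h i x)" for x
  have g'_borel: "g' \<in> borel_measurable borel"
  proof (rule borel_measurable_euclidean_space[THEN iffD2], rule ballI)
    fix b :: "real ^ 'n" assume "b \<in> Basis"
    then obtain i where "b = axis i 1" by (auto simp: Basis_vec_def)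
    then have "(\<lambda>x. g' x \<bullet> b) = h i"
      by (simp add: g'_def fun_eq_iff cart_eq_inner_axis[symmetric])
    then show "(\<lambda>x. g' x \<bullet> b) \<in> borel_measurable borel" using h by simp
  qed
  have "AE x in lborel. \<forall>i. x \<in> \<Omega> \<longrightarrow> g x $ i = h i x"
    using h by (subst AE_all_countable) blast
  then have g'_AE: "AE x in lborel. x \<in> \<Omega> \<longrightarrow> g x = g' x"
    by eventually_elim (simp add: g'_def vec_eq_iff)
  have "sobolev_function \<Omega> u' g'"
  proof
    fix K assume K: "compact K" "K \<subseteq> \<Omega>"
    have [measurable]: "K \<in> sets borel" using K by (simp add: borel_compact)
    show "integrable lborel (\<lambda>x. indicator K x * u' x)"
    proof (rule integrable_lebesgue_imp_lborel)
      show "integrable lebesgue (\<lambda>x. indicator K x * u x)"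
        using u_loc K by (simp add: locally_integrable_def set_integrable_def)
      show "AE x in lborel. indicator K x * u x = indicator K x * u' x"
        using u'(2) by eventually_elim (use K in \<open>auto simp: indicator_def\<close>)
    qed (use u'(1) in measurable)
    show "integrable lborel (\<lambda>x. indicator K x * norm (g' x))"
    proof (rule integrable_lebesgue_imp_lborel)
      have "integrable lebesgue (\<lambda>x. norm (indicator K x *\<^sub>R g x))"
        using g_loc K by (intro integrable_norm) (simp add: locally_integrable_def set_integrable_def)
      then show "integrable lebesgue (\<lambda>x. indicator K x * norm (g x))"
        by simp
      show "AE x in lborel. indicator K x * norm (g x) = indicator K x * norm (g' x)"
        using g'_AE by eventually_elim (use K in \<open>auto simp: indicator_def\<close>)
    qed (use g'_borel in measurable)
  next
    fix \<phi> i assume \<phi>: "\<phi> \<in> test_functions \<Omega>"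
    have "C_k 1 \<phi>" "C_k 0 \<phi>" using \<phi> by (auto simp: test_functions_def simp del: C_k.simps)
    then have borel: "\<phi> \<in> borel_measurable borel" "partial_deriv i \<phi> \<in> borel_measurable borel"
      by (auto intro!: borel_measurable_continuous_onI)
    then have lebesgue: "\<phi> \<in> borel_measurable lebesgue" "partial_deriv i \<phi> \<in> borel_measurable lebesgue"
      by (auto simp: measurable_completion)
    have "(LINT x:\<Omega>|lebesgue. u x * partial_deriv i \<phi> x) = (\<integral>x. u' x * partial_deriv i \<phi> x \<partial>lborel)"
      unfolding set_lebesgue_integral_def
    proof (rule integral_lebesgue_eq_lborel)
      have "(\<lambda>x. (indicator \<Omega> x * u x) * partial_deriv i \<phi> x) \<in> borel_measurable lebesgue"
        by (rule borel_measurable_times[OF u'(4) lebesgue(2)])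
      then show "(\<lambda>x. indicator \<Omega> x *\<^sub>R (u x * partial_deriv i \<phi> x)) \<in> borel_measurable lebesgue"
        by (simp add: mult.assoc)
      show "AE x in lborel. indicator \<Omega> x *\<^sub>R (u x * partial_deriv i \<phi> x) = u' x * partial_deriv i \<phi> x"
        using u'(2) by eventually_elim (use u'(3) in \<open>auto simp: indicator_def\<close>)
    qed (use u'(1) borel in measurable)
    moreover have "(LINT x:\<Omega>|lebesgue. g x $ i * \<phi> x) = (\<integral>x. h i x * \<phi> x \<partial>lborel)"
      unfolding set_lebesgue_integral_def
    proof (rule integral_lebesgue_eq_lborel)
      have "(\<lambda>x. (indicator \<Omega> x * g x $ i) * \<phi> x) \<in> borel_measurable lebesgue"
        by (rule borel_measurable_times[OF _ lebesgue(1)]) (use h in blast)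
      then show "(\<lambda>x. indicator \<Omega> x *\<^sub>R (g x $ i * \<phi> x)) \<in> borel_measurable lebesgue"
        by (simp add: mult.assoc)
      have "AE x in lborel. x \<in> \<Omega> \<longrightarrow> g x $ i = h i x" "\<And>x. x \<notin> \<Omega> \<Longrightarrow> h i x = 0" using h by auto
      then show "AE x in lborel. indicator \<Omega> x *\<^sub>R (g x $ i * \<phi> x) = h i x * \<phi> x"
        by (auto elim!: eventually_mono simp: indicator_def)
      show "(\<lambda>x. h i x * \<phi> x) \<in> borel_measurable borel"
        using h borel by (intro borel_measurable_times) auto
    qed
    ultimately show "(\<integral>x. u' x * partial_deriv i \<phi> x \<partial>lborel) = - (\<integral>x. g' x $ i * \<phi> x \<partial>lborel)"
      using g \<phi> by (simp add: is_weak_gradient_def g'_def)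
  qed (use \<Omega> u'(1) g'_borel in auto)
  then show ?thesis using u' g'_AE by (intro that) auto
qed

lemma ball_average_eq:
  fixes f f' :: "real ^ 'n \<Rightarrow> real"
  assumes "0 < r" "ball y r \<subseteq> \<Omega>" "AE x in lborel. x \<in> \<Omega> \<longrightarrow> f x = f' x"
    "f' \<in> borel_measurable borel" "(\<lambda>x. indicator \<Omega> x * f x) \<in> borel_measurable lebesgue"
  shows "ball_average f y r = (\<integral>x. indicator (ball y r) x * f' x \<partial>lborel) / (unit_ball_vol (real CARD('n)) * r ^ CARD('n))"
proof -
  have "(LINT x:ball y r|lebesgue. f x) = (\<integral>x. indicator (ball y r) x * f' x \<partial>lborel)"
    unfolding set_lebesgue_integral_def
  proof (rule integral_lebesgue_eq_lborel)
    have "(\<lambda>x. indicator (ball y r) x * (indicator \<Omega> x * f x)) \<in> borel_measurable lebesgue"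
      by (intro borel_measurable_times assms(5) borel_measurable_indicator) simp
    moreover have "indicator (ball y r) x * (indicator \<Omega> x * f x) = indicator (ball y r) x *\<^sub>R f x" for x
      using assms(2) by (auto simp: indicator_def simp del: mem_ball)
    ultimately show "(\<lambda>x. indicator (ball y r) x *\<^sub>R f x) \<in> borel_measurable lebesgue" by simp
    show "AE x in lborel. indicator (ball y r) x *\<^sub>R f x = indicator (ball y r) x * f' x"
      using assms(3)
    proof eventually_elim
      case (elim x)
      then show ?case using assms(2) by (cases "x \<in> ball y r") (auto simp del: mem_ball)
    qed
    show "(\<lambda>x. indicator (ball y r) x * f' x) \<in> borel_measurable borel"
      using assms(4) by (intro borel_measurable_times borel_measurable_indicator) auto
  qed
  then show ?thesis using assms(1) by (simp add: ball_average_def content_ball)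
qed

text \<open>\<open>choquet_integral_le\<close> applied to the Borel version of u. What has to be
  checked is that \<open>precise_rep u\<close> takes the Lebesgue value of that version wherever
  there is one; averages over small balls cannot distinguish u from it.\<close>

lemma choquet_integral_precise_rep_le:
  fixes \<Omega> D :: "(real ^ 'n) set"
  assumes n: "CARD('n) \<ge> 2" and \<Omega>: "open \<Omega>" and u: "u \<in> W11_loc \<Omega>" and g: "is_weak_gradient \<Omega> u g"
    and D: "open D" "convex D" "D \<subseteq> \<Omega>" "ball x0 r \<subseteq> D" "D \<subseteq> ball x0 (K * r)" and r: "0 < r" and K: "1 \<le> K"
  shows "\<exists>m. choquet_integral (real CARD('n) - 1) D (\<lambda>y. ennreal \<bar>precise_rep u y - m\<bar>) \<le>
    ennreal (2 * density_constant CARD('n) K * unit_ball_vol (real CARD('n))) * (\<integral>\<^sup>+ y\<in>D. ennreal (norm (g y)) \<partial>lebesgue)"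
proof -
  obtain u' g' where sob: "sobolev_function \<Omega> u' g'" and u': "AE x in lborel. x \<in> \<Omega> \<longrightarrow> u x = u' x"
    "(\<lambda>x. indicator \<Omega> x * u x) \<in> borel_measurable lebesgue" and g': "AE x in lborel. x \<in> \<Omega> \<longrightarrow> g x = g' x"
    using sobolev_function_borel_version[OF \<Omega> u g] by blast
  interpret sobolev_function \<Omega> u' g' by (rule sob)
  let ?X = "\<integral>\<^sup>+ x\<in>D. ennreal (norm (g' x)) \<partial>lborel"
  have X: "(\<integral>\<^sup>+ y\<in>D. ennreal (norm (g y)) \<partial>lebesgue) = ?X"
    unfolding nn_integral_completion
    by (rule nn_integral_cong_AE) (use g' D(3) in \<open>auto elim!: eventually_mono simp: indicator_def\<close>)
  have C: "0 < 2 * density_constant CARD('n) K * unit_ball_vol (real CARD('n))"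
    using density_constant_pos[OF n K] by simp
  show ?thesis
  proof (cases "?X = \<infinity>")
    \<comment> \<open>Infinite energy lies outside the locale, but as the constant is positive the
      right-hand side is then infinite.\<close>
    case True
    have "ennreal (2 * density_constant CARD('n) K * unit_ball_vol (real CARD('n))) \<noteq> 0"
      using C by (simp only: ennreal_eq_0_iff not_le)
    then have "ennreal (2 * density_constant CARD('n) K * unit_ball_vol (real CARD('n))) * ?X = top"
      unfolding True ennreal_mult_eq_top_iff by simp
    then show ?thesis unfolding X by simp
  next
    case False
    interpret I: increment_bounded_convex D u' "\<lambda>x. ennreal (norm (g' x))" x0 r K
    proof
      show "total_increment u' U w \<le> ennreal (norm w) * (\<integral>\<^sup>+ x\<in>U. ennreal (norm (g' x)) \<partial>lborel)"
        if "open U" "U \<subseteq> D" for U w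
        using that D(3) by (intro total_increment_le) auto
      show "integrable lborel (\<lambda>x. indicator K x * u' x)" if "compact K" "K \<subseteq> D" for K
        using that D(3) by (intro u_integrable) auto
      show "?X < \<infinity>" using False by (simp add: less_top)
    qed (use n D r K in auto)
    have "precise_rep u y = c" if y: "y \<in> D" and c: "I.lebesgue_value y c" for y c
    proof -
      have avg_eq: "eventually (\<lambda>s. I.avg (\<lambda>x. \<bar>u' x - c\<bar>) y s = ball_average (\<lambda>x. \<bar>u x - c\<bar>) y s) (at_right 0)"
        using I.eventually_cball_subset[OF \<Omega> subsetD[OF D(3) y]] I.eventually_at_right_pos
      proof eventually_elim
        case (elim s)
        show ?case
          unfolding I.avg_def
        proof (rule ball_average_eq[symmetric])
          show "0 < s" "ball y s \<subseteq> \<Omega>" using elim ball_subset_cball by blast+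
          show "AE x in lborel. x \<in> \<Omega> \<longrightarrow> \<bar>u x - c\<bar> = \<bar>u' x - c\<bar>"
            using u'(1) by eventually_elim auto
          \<comment> \<open>Only \<open>u\<close> multiplied by the indicator of \<Omega> is known
            to be measurable, so the indicator is inserted under the absolute value before the
            product is formed.\<close>
          have "\<Omega> \<in> sets lebesgue" using \<Omega> by simp
          moreover have "(\<lambda>x. \<bar>(indicator \<Omega> x * u x) - c\<bar>) \<in> borel_measurable lebesgue"
            by (rule borel_measurable_abs[OF borel_measurable_diff[OF u'(2) borel_measurable_const]])
          ultimately have "(\<lambda>x. indicator \<Omega> x * \<bar>indicator \<Omega> x * u x - c\<bar>) \<in> borel_measurable lebesgue"
            by (intro borel_measurable_times[OF borel_measurable_indicator])
          moreover have "indicator \<Omega> x * \<bar>indicator \<Omega> x * u x - c\<bar> = indicator \<Omega> x * \<bar>u x - c\<bar>" for x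
            by (simp add: indicator_def)
          ultimately show "(\<lambda>x. indicator \<Omega> x * \<bar>u x - c\<bar>) \<in> borel_measurable lebesgue" by simp
        qed measurable
      qed
      have lim0: "((\<lambda>s. I.avg (\<lambda>x. \<bar>u' x - c\<bar>) y s) \<longlongrightarrow> 0) (at_right 0)"
        using c by (simp add: I.lebesgue_value_def)
      then have "((\<lambda>s. ball_average (\<lambda>x. \<bar>u x - c\<bar>) y s) \<longlongrightarrow> 0) (at_right 0)"
        by (rule Lim_transform_eventually[OF _ avg_eq])
      then have "lebesgue_point u y" unfolding lebesgue_point_def by blast
      moreover have "(ball_average u y \<longlongrightarrow> c) (at_right 0)"
      proof (rule Lim_null[THEN iffD2], rule Lim_null_comparison[OF _ lim0])
        show "eventually (\<lambda>s. norm (ball_average u y s - c) \<le> I.avg (\<lambda>x. \<bar>u' x - c\<bar>) y s) (at_right 0)"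
          using I.eventually_cball_subset[OF D(1) y] I.eventually_at_right_pos
        proof eventually_elim
          case (elim s)
          have "ball_average u y s = I.avg u' y s"
            unfolding I.avg_def
          proof (rule ball_average_eq[OF elim(2) _ u'(1) u_borel u'(2)])
            show "ball y s \<subseteq> \<Omega>" using elim(1) D(3) ball_subset_cball by blast
          qed
          then show ?case using I.abs_avg_diff_le[OF elim(2,1), of c] by simp
        qed
      qed
      then have "Lim (at_right 0) (ball_average u y) = c"
        by (rule tendsto_Lim[OF trivial_limit_at_right_real])
      ultimately show ?thesis by (simp add: precise_rep_def)
    qed
    then show ?thesis unfolding X by (rule I.choquet_integral_le)
  qed
qed

section \<open>Cubes between concentric balls\<close>

lemma open_cube: "open (cube x l)" and convex_cube: "convex (cube x l)"
proof -
  have eq: "cube x l = box (\<chi> i. x $ i - l / 2) (\<chi> i. x $ i + l / 2)"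
  proof (rule set_eqI)
    fix y
    have "\<bar>y $ i - x $ i\<bar> < l / 2 \<longleftrightarrow> x $ i - l / 2 < y $ i \<and> y $ i < x $ i + l / 2" for i
      by linarith
    then show "y \<in> cube x l \<longleftrightarrow> y \<in> box (\<chi> i. x $ i - l / 2) (\<chi> i. x $ i + l / 2)"
      unfolding cube_def mem_box_cart by simp
  qed
  show "open (cube x l)" "convex (cube x l)" unfolding eq by (auto intro: open_box convex_box)
qed

lemma ball_subset_cube: "ball x (l / 2) \<subseteq> cube x l"
proof
  fix y assume "y \<in> ball x (l / 2)"
  then have "norm (y - x) < l / 2" by (simp add: dist_norm norm_minus_commute)
  then have "\<bar>(y - x) $ i\<bar> < l / 2" for i
    using component_le_norm_cart[of "y - x" i] by linarith
  then show "y \<in> cube x l" by (simp add: cube_def)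
qed

lemma cube_subset_ball: "cube x l \<subseteq> ball (x :: real ^ 'n) (real CARD('n) * (l / 2))"
proof
  fix y assume y: "y \<in> cube x l"
  have "norm (y - x) \<le> (\<Sum>i\<in>UNIV. \<bar>(y - x) $ i\<bar>)" by (rule norm_le_l1_cart)
  also have "\<dots> < (\<Sum>i\<in>(UNIV :: 'n set). l / 2)"
    using y by (intro sum_strict_mono) (auto simp: cube_def)
  finally show "y \<in> ball x (real CARD('n) * (l / 2))" by (simp add: dist_norm norm_minus_commute)
qed

theorem theorem1p4:
  assumes "CARD('n::finite) \<ge> 2"
  shows "\<exists>C::real. C > 0 \<and>
    (\<forall>(\<Omega> :: (real ^ 'n) set) u g.
       open \<Omega> \<and> u \<in> W11_loc \<Omega> \<and> is_weak_gradient \<Omega> u g \<longrightarrow>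
       (\<forall>x r. r > 0 \<and> ball x r \<subseteq> \<Omega> \<longrightarrow>
          (INF c :: real. choquet_integral (real CARD('n) - 1) (ball x r)
                            (\<lambda>y. ennreal \<bar>precise_rep u y - c\<bar>))
            \<le> ennreal C * (\<integral>\<^sup>+ y\<in>ball x r. ennreal (norm (g y)) \<partial>lebesgue)) \<and>
       ((\<lambda>y. norm (g y)) \<in> morrey_space (real CARD('n) - 1) \<Omega> \<longrightarrow>
          bmo_norm (real CARD('n) - 1) \<Omega> (precise_rep u)
            \<le> ennreal C * morrey_norm (real CARD('n) - 1) \<Omega> g))"
proof -
  let ?n = "CARD('n)"
  let ?b = "real ?n - 1"
  \<comment> \<open>A ball is its own inner and outer ball, hence K = 1. A cube of side l lies
    between the balls of radius l/2 and n l/2, hence K = n in \<open>C2\<close>.\<close>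
  define C1 where "C1 = 2 * density_constant ?n 1 * unit_ball_vol (real ?n)"
  define C2 where "C2 = 2 * density_constant ?n (real ?n) * unit_ball_vol (real ?n)"
  \<comment> \<open>The factor (n/2)^(n-1) is the ratio of R^(n-1) to l^(n-1) for the radius R = n
    l/2 of a ball around the cube.\<close>
  define C where "C = C1 + C2 * (real ?n / 2) powr ?b"
  have pos: "0 < 2 * density_constant ?n K * unit_ball_vol (real ?n)" if "1 \<le> K" for K
    using density_constant_pos[OF assms that] by simp
  have C1: "0 < C1" and C2: "0 < C2" using pos[of 1] pos[of "real ?n"] assms by (auto simp: C1_def C2_def)
  then have C: "C1 \<le> C" "C2 * (real ?n / 2) powr ?b \<le> C" "0 < C"
    using assms by (auto simp: C_def intro!: add_pos_nonneg)
  show ?thesis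
  proof (intro exI[of _ C] conjI allI impI)
    show "0 < C" by fact
  next
    fix \<Omega> :: "(real ^ 'n) set" and u g x r
    assume *: "open \<Omega> \<and> u \<in> W11_loc \<Omega> \<and> is_weak_gradient \<Omega> u g" "0 < r \<and> ball x r \<subseteq> \<Omega>"
    obtain m where "choquet_integral ?b (ball x r) (\<lambda>y. ennreal \<bar>precise_rep u y - m\<bar>) \<le>
        ennreal C1 * (\<integral>\<^sup>+ y\<in>ball x r. ennreal (norm (g y)) \<partial>lebesgue)"
      using choquet_integral_precise_rep_le[of \<Omega> u g "ball x r" x r 1] * assms unfolding C1_def by auto
    also have "\<dots> \<le> ennreal C * (\<integral>\<^sup>+ y\<in>ball x r. ennreal (norm (g y)) \<partial>lebesgue)"
      using C by (intro mult_right_mono ennreal_leI) auto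
    finally show "(INF c :: real. choquet_integral ?b (ball x r) (\<lambda>y. ennreal \<bar>precise_rep u y - c\<bar>))
        \<le> ennreal C * (\<integral>\<^sup>+ y\<in>ball x r. ennreal (norm (g y)) \<partial>lebesgue)"
      by (rule INF_lower2[OF UNIV_I])
  next
    fix \<Omega> :: "(real ^ 'n) set" and u g
    assume *: "open \<Omega> \<and> u \<in> W11_loc \<Omega> \<and> is_weak_gradient \<Omega> u g"
    show "bmo_norm ?b \<Omega> (precise_rep u) \<le> ennreal C * morrey_norm ?b \<Omega> g"
      unfolding bmo_norm_def
    proof (rule SUP_least, clarify)
      fix x :: "real ^ 'n" and l :: real assume l: "0 < l" and sub: "cube x (2 * l) \<subseteq> \<Omega>"
      have cube: "cube x l \<subseteq> \<Omega>" "x \<in> \<Omega>"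
      proof -
        have "cube x l \<subseteq> cube x (2 * l)"
        proof
          fix y assume "y \<in> cube x l"
          then have y: "\<bar>y $ i - x $ i\<bar> < l / 2" for i by (simp add: cube_def)
          have "\<bar>y $ i - x $ i\<bar> < 2 * l / 2" for i using y[of i] l by linarith
          then show "y \<in> cube x (2 * l)" by (simp add: cube_def)
        qed
        then show "cube x l \<subseteq> \<Omega>" using sub by blast
        have "x \<in> cube x (2 * l)" using l by (simp add: cube_def)
        then show "x \<in> \<Omega>" using sub by blast
      qed
      \<comment> \<open>The Morrey norm is tested with the concentric ball containing the cube. That
        norm integrates over \<Omega> \<inter> ball x R, which contains the cube even when the ball
        leaves \<Omega>.\<close>
      define R where "R = real ?n * (l / 2)"
      have R: "0 < R" using l by (simp add: R_def)
      let ?I = "\<integral>\<^sup>+ y\<in>\<Omega> \<inter> ball x R. ennreal (norm (g y)) \<partial>lebesgue"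
      obtain m where "choquet_integral ?b (cube x l) (\<lambda>y. ennreal \<bar>precise_rep u y - m\<bar>) \<le>
          ennreal C2 * (\<integral>\<^sup>+ y\<in>cube x l. ennreal (norm (g y)) \<partial>lebesgue)"
        using choquet_integral_precise_rep_le[of \<Omega> u g "cube x l" x "l / 2" "real ?n"] * assms l cube(1)
          open_cube[of x l] convex_cube[of x l] ball_subset_cube[of x l] cube_subset_ball[of x l]
        unfolding C2_def by auto
      also have "\<dots> \<le> ennreal C2 * ?I"
        using cube(1) cube_subset_ball[of x l]
        by (intro mult_left_mono nn_integral_mono) (auto simp: indicator_def R_def)
      also have "?I \<le> ennreal (R powr ?b) * morrey_norm ?b \<Omega> g"
      proof -
        have "ennreal (R powr (- ?b)) * ?I \<le> morrey_norm ?b \<Omega> g"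
          unfolding morrey_norm_def by (rule SUP_upper2[of "(x, R)"]) (use cube R in auto)
        then have "ennreal (R powr ?b) * (ennreal (R powr (- ?b)) * ?I) \<le> ennreal (R powr ?b) * morrey_norm ?b \<Omega> g"
          by (rule mult_left_mono) simp
        moreover have "ennreal (R powr ?b) * ennreal (R powr (- ?b)) = 1"
          using R by (simp add: ennreal_mult[symmetric] powr_add[symmetric])
        ultimately show ?thesis by (simp add: mult.assoc[symmetric])
      qed
      finally have le: "choquet_integral ?b (cube x l) (\<lambda>y. ennreal \<bar>precise_rep u y - m\<bar>) \<le>
          ennreal C2 * (ennreal (R powr ?b) * morrey_norm ?b \<Omega> g)"
        by (simp add: mult_left_mono)
      have "choquet_integral ?b (cube x l) (\<lambda>y. ennreal \<bar>precise_rep u y - m\<bar>) / ennreal (l powr ?b) \<le>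
          ennreal C2 * (ennreal (R powr ?b) * morrey_norm ?b \<Omega> g) / ennreal (l powr ?b)"
        by (rule divide_right_mono_ennreal[OF le])
      also have "\<dots> = ennreal (C2 * (real ?n / 2) powr ?b) * morrey_norm ?b \<Omega> g"
      proof -
        have "R powr ?b = (real ?n / 2) powr ?b * l powr ?b"
          using l by (simp add: R_def powr_mult[symmetric])
        then have "ennreal C2 * (ennreal (R powr ?b) * morrey_norm ?b \<Omega> g) =
            (ennreal (C2 * (real ?n / 2) powr ?b) * morrey_norm ?b \<Omega> g) * ennreal (l powr ?b)"
          using C2 by (simp add: ennreal_mult ac_simps)
        moreover have "ennreal (l powr ?b) \<noteq> 0" "ennreal (l powr ?b) \<noteq> top" using l by auto
        ultimately show ?thesis by (simp add: ennreal_mult_divide_eq)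
      qed
      also have "\<dots> \<le> ennreal C * morrey_norm ?b \<Omega> g"
        using C by (intro mult_right_mono ennreal_leI) auto
      finally show "(INF c :: real. choquet_integral ?b (cube x l) (\<lambda>y. ennreal \<bar>precise_rep u y - c\<bar>) / ennreal (l powr ?b))
          \<le> ennreal C * morrey_norm ?b \<Omega> g"
        by (rule INF_lower2[OF UNIV_I])
    qed
  qed
qed

end
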